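(* A graph $G$ is a connected induced-$(P_2+3P_1)$ free graph containing a top vertex that is not a Gallai vertex if and only if $G\in\mathcal G$, where $\mathcal G$ is the family of graphs defined in the context (membership being understood up to isomorphism).
   Context: All graphs are finite and simple, and equality of graphs (hence membership in a family of graphs) is up to isomorphism. $P_n$ denotes the path of order (number of vertices) $n$; $K_{m,n}$ is the complete bipartite graph with parts of orders $m$ and $n$; $G+H$ is the disjoint union of graphs and $kG$ is the disjoint union of $k$ copies of $G$. A graph is induced-$H$ free if it has no induced subgraph isomorphic to $H$. A top vertex of $G$ is a vertex whose degree equals the maximum degree of $G$. A longest path is a path with the maximum possible number of vertices, and a Gallai vertex of $G$ is a vertex belonging to every longest path of $G$. Definition of the family $\mathcal G$. For each integer $t\ge 3$, let $K=K_{t,t+2}$ be a complete bipartite graph with bipartition $(X,Y)$, where $|X|=t$ and $|Y|=t+2$. Choose a vertex $u\in Y$ and let $Y_0=Y\setminus\{u\}$. Let $K[X,Y_0]$ denote the complete bipartite graph with parts $X$ and $Y_0$ (the subgraph of $K$ induced by $X\cup Y_0$). For $t=3$, let $\mathcal F_3$ be the family of all spanning subgraphs $F$ of $K[X,Y_0]$ such that $F=P_7$. For each integer $t\ge 4$, let $\mathcal F_t$ be the family of all spanning subgraphs $F$ of $K[X,Y_0]$ (that is, with vertex set $X\cup Y_0$) of the form $F=Q+C_1+\cdots+C_s$, where $s\ge 0$, the graphs $C_1,\dots,C_s$ are even cycles, the components $Q,C_1,\dots,C_s$ are pairwise vertex-disjoint, and $Q$ is a path satisfying one of the following: (i) $Q$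 is nontrivial (has at least two vertices) and both endpoints of $Q$ belong to $Y_0$; or (ii) $Q$ is trivial and consists of a single vertex of $Y_0$. For every $F\in\mathcal F_t$, let $G_F$ be the graph with $V(G_F)=X\cup Y$ and $E(G_F)=E(K_{t,t+2})\setminus E(F)$. Set $\mathcal G_t=\{G_F:F\in\mathcal F_t\}$ and $\mathcal G=\bigcup_{t\ge 3}\mathcal G_t$. *)

theory Defs
  imports Main
begin

record 'a ugraph =
  verts :: "'a set"
  edges :: "'a set set"

definition simple_graph :: "'a ugraph \<Rightarrow> bool" where
  "simple_graph G \<longleftrightarrow> finite (verts G) \<and> (\<forall>e\<in>edges G. e \<subseteq> verts G \<and> card e = 2)"

(* Meaningful for simple graphs only: edges not contained in the vertex set are ignored. *)
definition graph_iso :: "'a ugraph \<Rightarrow> 'b ugraph \<Rightarrow> bool" where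
  "graph_iso G H \<longleftrightarrow> (\<exists>f. bij_betw f (verts G) (verts H) \<and>
     (\<forall>u\<in>verts G. \<forall>v\<in>verts G. {u, v} \<in> edges G \<longleftrightarrow> {f u, f v} \<in> edges H))"

definition member_upto_iso :: "'a ugraph \<Rightarrow> 'b ugraph set \<Rightarrow> bool" where
  "member_upto_iso G \<H> \<longleftrightarrow> (\<exists>H\<in>\<H>. graph_iso G H)"

definition spanning_subgraph :: "'a ugraph \<Rightarrow> 'a ugraph \<Rightarrow> bool" where
  "spanning_subgraph F G \<longleftrightarrow> verts F = verts G \<and> edges F \<subseteq> edges G"

definition induced_subgraph :: "'a ugraph \<Rightarrow> 'a set \<Rightarrow> 'a ugraph" where
  "induced_subgraph G S = \<lparr>verts = S, edges = {e \<in> edges G. e \<subseteq> S}\<rparr>"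

definition induced_free :: "'b ugraph \<Rightarrow> 'a ugraph \<Rightarrow> bool" where
  "induced_free H G \<longleftrightarrow> \<not> (\<exists>S\<subseteq>verts G. graph_iso (induced_subgraph G S) H)"

definition degree :: "'a ugraph \<Rightarrow> 'a \<Rightarrow> nat" where
  "degree G v = card {w \<in> verts G. {v, w} \<in> edges G}"

definition max_degree :: "'a ugraph \<Rightarrow> nat" where
  "max_degree G = Max (degree G ` verts G)"

definition top_vertex :: "'a ugraph \<Rightarrow> 'a \<Rightarrow> bool" where
  "top_vertex G v \<longleftrightarrow> v \<in> verts G \<and> degree G v = max_degree G"

definition path_in :: "'a ugraph \<Rightarrow> 'a list \<Rightarrow> bool" where
  "path_in G xs \<longleftrightarrow> xs \<noteq> [] \<and> distinct xs \<and> set xs \<subseteq> verts G \<and>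
     (\<forall>i. Suc i < length xs \<longrightarrow> {xs ! i, xs ! Suc i} \<in> edges G)"

definition longest_path :: "'a ugraph \<Rightarrow> 'a list \<Rightarrow> bool" where
  "longest_path G xs \<longleftrightarrow> path_in G xs \<and> (\<forall>ys. path_in G ys \<longrightarrow> length ys \<le> length xs)"

definition gallai_vertex :: "'a ugraph \<Rightarrow> 'a \<Rightarrow> bool" where
  "gallai_vertex G v \<longleftrightarrow> v \<in> verts G \<and> (\<forall>xs. longest_path G xs \<longrightarrow> v \<in> set xs)"

definition connected_graph :: "'a ugraph \<Rightarrow> bool" where
  "connected_graph G \<longleftrightarrow> verts G \<noteq> {} \<and>
     (\<forall>u\<in>verts G. \<forall>v\<in>verts G. \<exists>xs. path_in G xs \<and> hd xs = u \<and> last xs = v)"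

definition path_of_list :: "'a list \<Rightarrow> 'a ugraph" where
  "path_of_list xs =
     \<lparr>verts = set xs, edges = {{xs ! i, xs ! Suc i} | i. Suc i < length xs}\<rparr>"

definition path_graph :: "nat \<Rightarrow> nat ugraph" where
  "path_graph n = path_of_list [0..<n]"

(* Only used for n \<ge> 3. *)
definition cycle_graph :: "nat \<Rightarrow> nat ugraph" where
  "cycle_graph n = \<lparr>verts = {..<n}, edges = {{i, Suc i mod n} | i. i < n}\<rparr>"

definition even_cycle :: "'a ugraph \<Rightarrow> bool" where
  "even_cycle C \<longleftrightarrow> simple_graph C \<and> (\<exists>n\<ge>3. even n \<and> graph_iso C (cycle_graph n))"

(* Only used for disjoint X and Y. *)
definition complete_bipartite :: "'a set \<Rightarrow> 'a set \<Rightarrow> 'a ugraph" where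
  "complete_bipartite X Y = \<lparr>verts = X \<union> Y, edges = {{x, y} | x y. x \<in> X \<and> y \<in> Y}\<rparr>"

definition graph_sum :: "'a ugraph \<Rightarrow> 'b ugraph \<Rightarrow> ('a + 'b) ugraph" where
  "graph_sum G H = \<lparr>verts = verts G <+> verts H,
     edges = (`) Inl ` edges G \<union> (`) Inr ` edges H\<rparr>"

definition graph_copies :: "nat \<Rightarrow> 'a ugraph \<Rightarrow> (nat \<times> 'a) ugraph" where
  "graph_copies k G = \<lparr>verts = {..<k} \<times> verts G,
     edges = {Pair i ` e | i e. i < k \<and> e \<in> edges G}\<rparr>"

(* Internal version of the disjoint union: F is literally the union of the listed graphs. *)
definition is_disjoint_union :: "'a ugraph \<Rightarrow> 'a ugraph list \<Rightarrow> bool" where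
  "is_disjoint_union F Hs \<longleftrightarrow>
     verts F = (\<Union>H\<in>set Hs. verts H) \<and> edges F = (\<Union>H\<in>set Hs. edges H) \<and>
     (\<forall>i j. i < j \<and> j < length Hs \<longrightarrow> verts (Hs ! i) \<inter> verts (Hs ! j) = {})"

(* The path Q is given by its vertex sequence; its endpoints are hd qs and last qs. *)
definition family_F :: "nat \<Rightarrow> 'a set \<Rightarrow> 'a set \<Rightarrow> 'a ugraph set" where
  "family_F t X Y0 =
     {F. spanning_subgraph F (complete_bipartite X Y0) \<and>
         (if t = 3 then graph_iso F (path_graph 7)
          else \<exists>qs Cs. distinct qs \<and>
                 (length qs \<ge> 2 \<and> hd qs \<in> Y0 \<and> last qs \<in> Y0 \<or> (\<exists>y\<in>Y0. qs = [y])) \<and>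
                 (\<forall>C\<in>set Cs. even_cycle C) \<and>
                 is_disjoint_union F (path_of_list qs # Cs))}"

definition G_of :: "'a set \<Rightarrow> 'a set \<Rightarrow> 'a ugraph \<Rightarrow> 'a ugraph" where
  "G_of X Y F = \<lparr>verts = X \<union> Y, edges = edges (complete_bipartite X Y) - edges F\<rparr>"

(* The naturals serve as a supply of vertex names; membership is taken up to isomorphism. *)
definition family_G_at :: "nat \<Rightarrow> nat ugraph set" where
  "family_G_at t = {G_of X Y F | X Y u F.
     finite X \<and> finite Y \<and> X \<inter> Y = {} \<and> card X = t \<and> card Y = t + 2 \<and>
     u \<in> Y \<and> F \<in> family_F t X (Y - {u})}"

definition family_G :: "nat ugraph set" where
  "family_G = (\<Union>t\<in>{3..}. family_G_at t)"

end

theory Submission imports Defs begin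

text \<open>
  Let \<open>v\<close> be a top vertex missed by a longest path \<open>P\<close>, and let \<open>C\<close> be the component of \<open>G - P\<close>
  containing \<open>v\<close>. The first vertex of \<open>P\<close> and the successors on \<open>P\<close> of the neighbours of \<open>C\<close> are
  independent and not adjacent to \<open>C\<close>. So if \<open>C\<close> has an edge, then it is attached to \<open>P\<close> at a single
  vertex \<open>z\<close>; in that case \<open>C\<close> and the two parts of \<open>P - z\<close> are cliques, both parts have at
  least \<open>|C|\<close> vertices, and the degree bound at \<open>z\<close> leaves two non-neighbours of \<open>z\<close> in \<open>C\<close> and
  one in each part, which together with \<open>z\<close> induce \<open>P\<^sub>2 + 3P\<^sub>1\<close>. If \<open>C = {v}\<close>, then the independent set above,
  together with \<open>v\<close>, has \<open>deg v + 2\<close> vertices, and counting the neighbours of a vertex of \<open>P\<close> in it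
  shows that \<open>P\<close> alternates between \<open>N(v)\<close> and its complement. This makes \<open>G\<close> bipartite with parts
  \<open>N(v)\<close> and \<open>Y\<close>, where every vertex of \<open>N(v)\<close> has exactly two, and every vertex of \<open>Y\<close> at
  most two, non-neighbours on the other side.

  The bipartite complement is then a path with both ends in \<open>Y - {v}\<close> plus even cycles. Conversely, for
  \<open>t \<ge> 4\<close> a closure argument in the style of Moon and Moser gives a Hamilton path of \<open>G - u\<close>: the vertex \<open>u\<close>
  itself serves as the extra vertex that balances the two sides.
\<close>

text \<open>Both directions meet in \<open>bipartite_form\<close>, which keeps the existence of a
  path through all vertices except \<open>u\<close> as a separate condition. For t \<ge> 4 this path
  follows from the degrees: the two ends of a pair have together at most 2 + 2 forbidden partners,
  and the closure argument on sides of t + 1 vertices needs 4 < t + 1. At t = 3 the inequality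
  fails, and so does the conclusion: if F is P_3 + C_4, then G_F - u is disconnected, and if F is
  P_1 + C_6, it is a spider with three legs of length two. Hence the exceptional P_7 at t = 3; there
  the path is exhibited directly and, conversely, determines F. The exact value 2 for the
  non-neighbours of a vertex of N(v) is the equality case of two opposite bounds: freeness allows at
  most two non-neighbours among the deg v + 2 independent vertices, and maximality of deg v allows
  at most deg v neighbours.\<close>

lemma path_in_iff:
  "path_in G xs \<longleftrightarrow> xs \<noteq> [] \<and> distinct xs \<and> set xs \<subseteq> verts G \<and>
     successively (\<lambda>a b. {a, b} \<in> edges G) xs"
  by (auto simp: path_in_def successively_conv_nth)

lemma simple_graph_edgeD:
  assumes "simple_graph G" "{a, b} \<in> edges G"
  shows "a \<in> verts G" "b \<in> verts G" "a \<noteq> b"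
proof -
  from assms have "{a, b} \<subseteq> verts G" "card {a, b} = 2"
    by (auto simp: simple_graph_def)
  then show "a \<in> verts G" "b \<in> verts G" "a \<noteq> b" by auto
qed

lemma simple_graph_edgeE:
  assumes "simple_graph G" "e \<in> edges G"
  obtains a b where "e = {a, b}" "a \<noteq> b" "a \<in> verts G" "b \<in> verts G"
  using assms unfolding simple_graph_def by (metis card_2_iff insert_subset)

lemma simple_graph_no_loop: "simple_graph G \<Longrightarrow> {a} \<notin> edges G"
  by (auto simp: simple_graph_def)

lemma path_in_rev:
  assumes "path_in G xs" shows "path_in G (rev xs)"
  using assms by (simp add: path_in_iff successively_rev insert_commute)

lemma longest_path_rev:
  assumes "longest_path G xs" shows "longest_path G (rev xs)"
  using assms by (simp add: longest_path_def path_in_rev)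

text \<open>An induced P_2 + 3P_1 with the isomorphism stripped off, so that later arguments only
  have to name an edge and a triple. The last clause includes \<open>c = d\<close>, which is
  harmless in a simple graph since it has no loops.\<close>

definition three_isolated :: "'a ugraph \<Rightarrow> 'a \<Rightarrow> 'a \<Rightarrow> 'a set \<Rightarrow> bool" where
  "three_isolated G a b T \<longleftrightarrow> {a, b} \<in> edges G \<and> T \<subseteq> verts G \<and> card T = 3 \<and>
     a \<notin> T \<and> b \<notin> T \<and> (\<forall>c\<in>T. {a, c} \<notin> edges G \<and> {b, c} \<notin> edges G) \<and>
     (\<forall>c\<in>T. \<forall>d\<in>T. {c, d} \<notin> edges G)"

lemma three_isolatedI:
  assumes "{a, b} \<in> edges G" "T \<subseteq> verts G" "card T = 3" "a \<notin> T" "b \<notin> T"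
    and "\<forall>c\<in>T. {a, c} \<notin> edges G \<and> {b, c} \<notin> edges G" "\<forall>c\<in>T. \<forall>d\<in>T. {c, d} \<notin> edges G"
  shows "three_isolated G a b T"
  using assms unfolding three_isolated_def by blast

lemma P2_3P1_verts:
  "verts (graph_sum (path_graph 2) (graph_copies 3 (path_graph 1))) =
     {Inl 0, Inl 1, Inr (0, 0), Inr (1, 0), Inr (2, 0)}"
  by (auto simp: graph_sum_def path_graph_def path_of_list_def graph_copies_def
        numeral_eq_Suc lessThan_Suc)

lemma P2_3P1_edges:
  "edges (graph_sum (path_graph 2) (graph_copies 3 (path_graph 1))) = {{Inl 0, Inl 1}}"
proof -
  have "edges (path_graph 2) = {{0, 1}}"
    by (auto simp: path_graph_def path_of_list_def numeral_eq_Suc)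
  moreover have "edges (graph_copies 3 (path_graph 1)) = {}"
    by (auto simp: path_graph_def path_of_list_def graph_copies_def)
  ultimately show ?thesis by (simp add: graph_sum_def)
qed

text \<open>Trades an isomorphism onto a sum type for named vertices: the single edge
  \<open>{Inl 0, Inl 1}\<close> corresponds to \<open>{a, b}\<close>, and every other pair to a
  non-edge.\<close>

lemma induced_P2_3P1_free_iff:
  assumes G: "simple_graph G"
  shows "induced_free (graph_sum (path_graph 2) (graph_copies 3 (path_graph 1))) G \<longleftrightarrow>
     (\<nexists>a b T. three_isolated G a b T)" (is "induced_free ?H G \<longleftrightarrow> _")
proof
  assume free: "induced_free ?H G"
  show "\<nexists>a b T. three_isolated G a b T"
  proof
    assume "\<exists>a b T. three_isolated G a b T"
    then obtain a b T where T: "three_isolated G a b T" by blast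
    then have "card T = 3" by (simp add: three_isolated_def)
    then obtain c d e where cde: "T = {c, d, e}" "c \<noteq> d" "d \<noteq> e" "c \<noteq> e"
      by (auto simp: card_3_iff)
    have ab: "a \<in> verts G" "b \<in> verts G" "a \<noteq> b"
      using simple_graph_edgeD[OF G] T by (auto simp: three_isolated_def)
    let ?S = "{a, b, c, d, e}"
    let ?f = "\<lambda>v. if v = a then Inl 0 else if v = b then Inl 1 else if v = c then Inr (0, 0)
       else if v = d then Inr (1, 0) else (Inr (2, 0) :: nat + nat \<times> nat)"
    have dist: "a \<noteq> c" "a \<noteq> d" "a \<noteq> e" "b \<noteq> c" "b \<noteq> d" "b \<noteq> e"
      using T cde by (auto simp: three_isolated_def)
    have bij: "bij_betw ?f ?S {Inl 0, Inl 1, Inr (0, 0), Inr (1, 0), Inr (2, 0)}"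
      using dist cde ab by (auto simp: bij_betw_def inj_on_def)
    have E1: "{u, v} \<in> edges G \<longleftrightarrow> {u, v} = {a, b}" if "u \<in> ?S" "v \<in> ?S" for u v
    proof
      assume uv: "{u, v} \<in> edges G"
      have "u \<in> {a, b} \<or> u \<in> T" "v \<in> {a, b} \<or> v \<in> T" using that cde by auto
      moreover have "\<not> (u \<in> T \<and> v \<in> T)" "\<not> (u \<in> {a, b} \<and> v \<in> T)" "\<not> (v \<in> {a, b} \<and> u \<in> T)"
        using T uv insert_commute[of u v "{}"] by (auto simp: three_isolated_def)
      moreover have "u \<noteq> v" using simple_graph_edgeD(3)[OF G uv] .
      ultimately show "{u, v} = {a, b}" by blast
    next
      assume "{u, v} = {a, b}"
      then show "{u, v} \<in> edges G" using T by (simp add: three_isolated_def)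
    qed
    have E2: "{u, v} = {a, b} \<longleftrightarrow> {?f u, ?f v} = {Inl 0, Inl 1}" if "u \<in> ?S" "v \<in> ?S" for u v
    proof -
      have "?f ` {u, v} = ?f ` {a, b} \<longleftrightarrow> {u, v} = {a, b}"
        using bij that by (intro inj_on_image_eq_iff[of ?f ?S]) (auto simp only: bij_betw_def)
      moreover have "?f ` {a, b} = {Inl 0, Inl 1}" using ab by auto
      ultimately show ?thesis by (simp only: image_insert image_empty)
    qed
    have iff: "{u, v} \<in> edges G \<longleftrightarrow> {?f u, ?f v} = {Inl 0, Inl 1}"
      if "u \<in> ?S" "v \<in> ?S" for u v
      using E1[OF that] E2[OF that] by (rule trans)
    have "graph_iso (induced_subgraph G ?S) ?H"
      unfolding graph_iso_def
    proof (intro exI[of _ ?f] conjI ballI)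
      show "bij_betw ?f (verts (induced_subgraph G ?S)) (verts ?H)"
        using bij unfolding P2_3P1_verts by (simp only: induced_subgraph_def ugraph.select_convs)
      fix u v
      assume "u \<in> verts (induced_subgraph G ?S)" "v \<in> verts (induced_subgraph G ?S)"
      then have uv: "u \<in> ?S" "v \<in> ?S" by (simp_all only: induced_subgraph_def ugraph.select_convs)
      have "{u, v} \<in> edges (induced_subgraph G ?S) \<longleftrightarrow> {u, v} \<in> edges G"
        using uv by (simp only: induced_subgraph_def ugraph.select_convs) blast
      then show "{u, v} \<in> edges (induced_subgraph G ?S) \<longleftrightarrow> {?f u, ?f v} \<in> edges ?H"
        using iff[OF uv] unfolding P2_3P1_edges by (simp only: singleton_iff)
    qed
    moreover have "?S \<subseteq> verts G" using T cde ab by (auto simp: three_isolated_def)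
    ultimately show False using free unfolding induced_free_def by blast
  qed
next
  assume none: "\<nexists>a b T. three_isolated G a b T"
  show "induced_free ?H G"
    unfolding induced_free_def
  proof
    assume "\<exists>S\<subseteq>verts G. graph_iso (induced_subgraph G S) ?H"
    then obtain S f where S: "S \<subseteq> verts G" and f: "bij_betw f S (verts ?H)"
      and e: "\<forall>u\<in>S. \<forall>v\<in>S. {u, v} \<in> edges (induced_subgraph G S) \<longleftrightarrow> {f u, f v} \<in> edges ?H"
      by (auto simp: graph_iso_def induced_subgraph_def)
    define g where "g = inv_into S f"
    have g: "g w \<in> S" "f (g w) = w" if "w \<in> verts ?H" for w
      using bij_betw_apply[OF bij_betw_inv_into[OF f] that] bij_betw_inv_into_right[OF f that]
      by (simp_all only: g_def)
    let ?T = "{g (Inr (0, 0)), g (Inr (1, 0)), g (Inr (2, 0))}"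
    have adj: "{g w, g w'} \<in> edges G \<longleftrightarrow> {w, w'} = {Inl 0, Inl 1}"
      if w: "w \<in> verts ?H" "w' \<in> verts ?H" for w w'
    proof -
      have "{g w, g w'} \<in> edges (induced_subgraph G S) \<longleftrightarrow> {w, w'} = {Inl 0, Inl 1}"
        using e[rule_format, OF g(1)[OF w(1)] g(1)[OF w(2)]]
        unfolding g(2)[OF w(1)] g(2)[OF w(2)] P2_3P1_edges by (simp only: singleton_iff)
      moreover have "{g w, g w'} \<subseteq> S" using g(1)[OF w(1)] g(1)[OF w(2)] by (simp only: insert_subset empty_subsetI)
      ultimately show ?thesis by (simp only: induced_subgraph_def ugraph.select_convs mem_Collect_eq simp_thms)
    qed
    have inj: "g w = g w' \<longleftrightarrow> w = w'" if "w \<in> verts ?H" "w' \<in> verts ?H" for w w'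
      using g(2)[OF that(1)] g(2)[OF that(2)] by metis
    have "three_isolated G (g (Inl 0)) (g (Inl 1)) ?T"
      unfolding three_isolated_def
      using S g(1)[unfolded P2_3P1_verts]
      by (simp add: adj[unfolded P2_3P1_verts] inj[unfolded P2_3P1_verts] doubleton_eq_iff
          subset_iff simple_graph_no_loop[OF G])
    then show False using none by blast
  qed
qed

section \<open>Reachability, and paths that avoid consecutive vertices of a set\<close>

lemma path_in_reachable:
  assumes "(a, b) \<in> {(p, q). p \<in> W \<and> q \<in> W \<and> {p, q} \<in> edges G}\<^sup>*" "a \<in> W" "W \<subseteq> verts G"
  shows "\<exists>xs. path_in G xs \<and> set xs \<subseteq> W \<and> hd xs = a \<and> last xs = b"
  using assms(1)
proof (induction rule: rtrancl_induct)
  case base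
  show ?case using assms by (intro exI[of _ "[a]"]) (auto simp: path_in_iff)
next
  case (step b c)
  then obtain xs where xs: "path_in G xs" "set xs \<subseteq> W" "hd xs = a" "last xs = b" by blast
  show ?case
  proof (cases "c \<in> set xs")
    case True
    then obtain us vs where "xs = us @ c # vs" by (meson split_list)
    \<comment> \<open>When the walk returns to a vertex of the path, the path is cut back to that
      vertex, which keeps it simple and inside \<open>W\<close>.\<close>
    then have "xs = (us @ [c]) @ vs" by simp
    with xs show ?thesis
      by (intro exI[of _ "us @ [c]"])
        (auto simp: path_in_iff successively_append_iff hd_append split: if_splits)
  next
    case False
    with xs step assms show ?thesis
      by (intro exI[of _ "xs @ [c]"]) (auto simp: path_in_iff successively_append_iff hd_append)
  qed
qed

lemma connected_graphI:
  assumes "a \<in> verts G" "\<And>b. b \<in> verts G \<Longrightarrow>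
    (a, b) \<in> {(p, q). p \<in> verts G \<and> q \<in> verts G \<and> {p, q} \<in> edges G}\<^sup>*"
  shows "connected_graph G"
proof -
  let ?r = "{(p, q). p \<in> verts G \<and> q \<in> verts G \<and> {p, q} \<in> edges G}"
  have "sym ?r" by (auto simp: sym_def insert_commute)
  then have sy: "sym (?r\<^sup>*)" by (rule sym_rtrancl)
  have "\<exists>xs. path_in G xs \<and> hd xs = u \<and> last xs = v" if "u \<in> verts G" "v \<in> verts G" for u v
  proof -
    have "(u, a) \<in> ?r\<^sup>*" using assms(2)[OF that(1)] sy by (meson symD)
    then have "(u, v) \<in> ?r\<^sup>*" using assms(2)[OF that(2)] by (rule rtrancl_trans)
    from path_in_reachable[OF this that(1)] show ?thesis by auto
  qed
  then show ?thesis using assms(1) by (auto simp: connected_graph_def)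
qed

text \<open>The members outside \<open>A\<close> separate those of \<open>A\<close>; the last two terms account for the two ends.\<close>
lemma alternating_count:
  assumes "successively (\<lambda>a b. \<not> (a \<in> A \<and> b \<in> A)) xs" "xs \<noteq> []"
  shows "length (filter (\<lambda>x. x \<in> A) xs) + 1 \<le> length (filter (\<lambda>x. x \<notin> A) xs) +
     of_bool (hd xs \<in> A) + of_bool (last xs \<in> A)"
  using assms
proof (induction xs)
  case (Cons a xs)
  then show ?case
    by (cases "xs = []"; cases "hd xs \<in> A") (auto simp: successively_Cons split: if_splits)
qed simp

section \<open>The bipartite form\<close>

text \<open>The common form of both sides of the characterization, phrased without F: in the
  bipartite complement the vertices of X have degree 2, those of Y at most 2, and \<open>u\<close>
  is isolated. Finiteness is implied by the cardinalities. The final clause holds what the degree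
  conditions do not give when \<open>card X = 3\<close>.\<close>

definition bipartite_form :: "'a ugraph \<Rightarrow> 'a set \<Rightarrow> 'a set \<Rightarrow> 'a \<Rightarrow> bool" where
  "bipartite_form G X Y u \<longleftrightarrow>
     verts G = X \<union> Y \<and> X \<inter> Y = {} \<and> card Y = card X + 2 \<and> card X \<ge> 3 \<and> u \<in> Y \<and>
     (\<forall>x\<in>X. \<forall>x'\<in>X. {x, x'} \<notin> edges G) \<and> (\<forall>y\<in>Y. \<forall>y'\<in>Y. {y, y'} \<notin> edges G) \<and>
     (\<forall>x\<in>X. {x, u} \<in> edges G) \<and>
     (\<forall>x\<in>X. card {y\<in>Y. {x, y} \<notin> edges G} = 2) \<and>
     (\<forall>y\<in>Y. card {x\<in>X. {x, y} \<notin> edges G} \<le> 2) \<and>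
     (\<exists>ws. path_in G ws \<and> set ws = verts G - {u})"

lemma bipartite_formD:
  assumes "bipartite_form G X Y u"
  shows "verts G = X \<union> Y" "X \<inter> Y = {}" "card Y = card X + 2" "card X \<ge> 3" "u \<in> Y"
    and "\<And>x x'. x \<in> X \<Longrightarrow> x' \<in> X \<Longrightarrow> {x, x'} \<notin> edges G"
    and "\<And>y y'. y \<in> Y \<Longrightarrow> y' \<in> Y \<Longrightarrow> {y, y'} \<notin> edges G"
    and "\<And>x. x \<in> X \<Longrightarrow> {x, u} \<in> edges G"
    and "\<And>x. x \<in> X \<Longrightarrow> card {y\<in>Y. {x, y} \<notin> edges G} = 2"
    and "\<And>y. y \<in> Y \<Longrightarrow> card {x\<in>X. {x, y} \<notin> edges G} \<le> 2"
  using assms by (simp_all add: bipartite_form_def)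

text \<open>\<open>family_G\<close> lives on the naturals while the theorem is about an arbitrary
  vertex type, so the form has to be carried across isomorphisms.\<close>

lemma bipartite_form_iso:
  assumes form: "bipartite_form G X Y u" and iso: "graph_iso G H"
  shows "\<exists>X' Y' u'. bipartite_form H X' Y' u'"
proof -
  obtain f where f: "bij_betw f (verts G) (verts H)"
    and e: "\<And>u v. u \<in> verts G \<Longrightarrow> v \<in> verts G \<Longrightarrow> {f u, f v} \<in> edges H \<longleftrightarrow> {u, v} \<in> edges G"
    using iso by (auto simp: graph_iso_def)
  have V: "verts G = X \<union> Y" and u: "u \<in> Y" using form by (auto simp: bipartite_form_def)
  have inj: "inj_on f (X \<union> Y)" using f V by (auto simp: bij_betw_def)
  have eXY: "{f x, f y} \<in> edges H \<longleftrightarrow> {x, y} \<in> edges G" if "x \<in> X \<union> Y" "y \<in> X \<union> Y" for x y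
    using e that V by auto
  have sub: "card {y \<in> f ` B. {f x, y} \<notin> edges H} = card {y \<in> B. {x, y} \<notin> edges G}"
    if "B \<subseteq> X \<union> Y" "x \<in> X \<union> Y" for B x
  proof -
    have "{y \<in> f ` B. {f x, y} \<notin> edges H} = f ` {y \<in> B. {x, y} \<notin> edges G}"
      using that eXY by blast
    moreover have "inj_on f {y \<in> B. {x, y} \<notin> edges G}"
      using that by (intro inj_on_subset[OF inj]) auto
    ultimately show ?thesis by (simp add: card_image)
  qed
  have sub': "card {y \<in> f ` B. {y, f x} \<notin> edges H} = card {y \<in> B. {y, x} \<notin> edges G}"
    if "B \<subseteq> X \<union> Y" "x \<in> X \<union> Y" for B x
    using sub[OF that] by (simp add: insert_commute)
  obtain ws where ws: "path_in G ws" "set ws = verts G - {u}"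
    using form by (auto simp only: bipartite_form_def)
  have "distinct (map f ws)"
    using ws inj V by (auto simp: distinct_map path_in_def intro: inj_on_subset)
  moreover have "set (map f ws) = verts H - {f u}"
  proof -
    have "f ` (X \<union> Y - {u}) = f ` (X \<union> Y) - f ` {u}"
      using u by (intro inj_on_image_set_diff[OF inj]) auto
    then show ?thesis using ws V f by (auto simp: bij_betw_def)
  qed
  moreover have "{map f ws ! i, map f ws ! Suc i} \<in> edges H" if "Suc i < length ws" for i
  proof -
    have "ws ! i \<in> verts G" "ws ! Suc i \<in> verts G"
      using that ws(2) nth_mem[of i ws] nth_mem[of "Suc i" ws] by auto
    then show ?thesis using e ws that by (auto simp: path_in_def)
  qed
  ultimately have ham: "path_in H (map f ws)" "set (map f ws) = verts H - {f u}"
    using ws(1) by (auto simp: path_in_def)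
  note D = bipartite_formD[OF form]
  have "bipartite_form H (f ` X) (f ` Y) (f u)"
    unfolding bipartite_form_def
  proof (intro conjI ballI)
    show "verts H = f ` X \<union> f ` Y" using f V by (auto simp: bij_betw_def)
    show "f ` X \<inter> f ` Y = {}" using inj_on_image_Int[OF inj, of X Y] D(2) by simp
    have "card (f ` X) = card X" "card (f ` Y) = card Y"
      by (auto intro!: card_image inj_on_subset[OF inj])
    then show "card (f ` Y) = card (f ` X) + 2" "3 \<le> card (f ` X)" using D(3,4) by simp_all
    show "f u \<in> f ` Y" using u by simp
    show "\<exists>ws. path_in H ws \<and> set ws = verts H - {f u}" using ham by blast
  next
    fix x x' assume "x \<in> f ` X" "x' \<in> f ` X"
    then show "{x, x'} \<notin> edges H" using D(6) eXY by auto
  next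
    fix y y' assume "y \<in> f ` Y" "y' \<in> f ` Y"
    then show "{y, y'} \<notin> edges H" using D(7) eXY by auto
  next
    fix x assume "x \<in> f ` X"
    then obtain x0 where x0: "x0 \<in> X" "x = f x0" by blast
    show "{x, f u} \<in> edges H" using x0 D(8) eXY u by simp
    show "card {y \<in> f ` Y. {x, y} \<notin> edges H} = 2" using sub[of Y x0] D(9) x0 by simp
  next
    fix y assume "y \<in> f ` Y"
    then obtain y0 where y0: "y0 \<in> Y" "y = f y0" by blast
    show "card {x \<in> f ` X. {x, y} \<notin> edges H} \<le> 2" using sub'[of X y0] D(10) y0 by simp
  qed
  then show ?thesis by blast
qed

lemma graph_iso_sym:
  assumes "graph_iso G H" shows "graph_iso H G"
proof -
  obtain f where f: "bij_betw f (verts G) (verts H)"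
    and e: "\<And>u v. u \<in> verts G \<Longrightarrow> v \<in> verts G \<Longrightarrow> {f u, f v} \<in> edges H \<longleftrightarrow> {u, v} \<in> edges G"
    using assms by (auto simp: graph_iso_def)
  let ?g = "inv_into (verts G) f"
  have b: "bij_betw ?g (verts H) (verts G)" using f by (rule bij_betw_inv_into)
  moreover have "{u, v} \<in> edges H \<longleftrightarrow> {?g u, ?g v} \<in> edges G"
    if "u \<in> verts H" "v \<in> verts H" for u v
    using e[of "?g u" "?g v"] that b bij_betw_inv_into_right[OF f] bij_betwE[OF b] by auto
  ultimately show ?thesis unfolding graph_iso_def by blast
qed

text \<open>The edges are mapped as image sets, so the copy is again simple;
  \<open>graph_iso\<close> alone would admit stray edges outside the vertex set.\<close>

lemma simple_graph_iso_nat: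
  fixes G :: "'a ugraph"
  assumes "simple_graph G"
  obtains H :: "nat ugraph" where "simple_graph H" "graph_iso G H"
proof -
  have "finite (verts G)" using assms by (simp add: simple_graph_def)
  then obtain f :: "'a \<Rightarrow> nat" where f: "inj_on f (verts G)"
    using finite_imp_inj_to_nat_seg by meson
  let ?H = "\<lparr>verts = f ` verts G, edges = (`) f ` edges G\<rparr>"
  have inj: "inj_on f e" if "e \<in> edges G" for e
    using that assms f by (auto simp: simple_graph_def intro: inj_on_subset)
  have "simple_graph ?H"
    using assms inj by (auto simp: simple_graph_def card_image)
  moreover have "{f u, f v} \<in> (`) f ` edges G \<longleftrightarrow> {u, v} \<in> edges G"
    if "u \<in> verts G" "v \<in> verts G" for u v
  proof
    assume "{f u, f v} \<in> (`) f ` edges G"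
    then obtain e where e: "e \<in> edges G" "f ` {u, v} = f ` e" by auto
    then have "{u, v} = e"
      using assms that by (intro inj_on_image_eq_iff[OF f, THEN iffD1]) (auto simp: simple_graph_def)
    with e show "{u, v} \<in> edges G" by simp
  next
    assume "{u, v} \<in> edges G"
    then show "{f u, f v} \<in> (`) f ` edges G" by (intro image_eqI[of _ _ "{u, v}"]) auto
  qed
  then have "graph_iso G ?H"
    unfolding graph_iso_def using f by (intro exI[of _ f]) (auto simp: bij_betw_def)
  ultimately show ?thesis by (rule that)
qed

lemma three_isolated_commute: "three_isolated G a b T \<Longrightarrow> three_isolated G b a T"
  unfolding three_isolated_def by (subst insert_commute) blast

lemma bipartite_form_suffices:
  assumes G: "simple_graph G" and form: "bipartite_form G X Y u"
  shows "connected_graph G" "\<nexists>a b T. three_isolated G a b T"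
    "top_vertex G u" "\<not> gallai_vertex G u"
proof -
  note V = bipartite_formD(1)[OF form] and dj = bipartite_formD(2)[OF form]
    and cY = bipartite_formD(3)[OF form] and X3 = bipartite_formD(4)[OF form]
    and u = bipartite_formD(5)[OF form] and iX = bipartite_formD(6)[OF form]
    and iY = bipartite_formD(7)[OF form] and uX = bipartite_formD(8)[OF form]
    and nX = bipartite_formD(9)[OF form] and nY = bipartite_formD(10)[OF form]
  have fin: "finite X" "finite Y" using V G by (simp_all add: simple_graph_def)
  obtain ws where ws: "path_in G ws" "set ws = verts G - {u}"
    using form by (auto simp only: bipartite_form_def)
  show "connected_graph G"
  proof (rule connected_graphI)
    let ?r = "{(p, q). p \<in> verts G \<and> q \<in> verts G \<and> {p, q} \<in> edges G}"
    show "u \<in> verts G" using u V by auto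
    have X: "(u, x) \<in> ?r\<^sup>*" if "x \<in> X" for x
      using that u V uX[OF that] by (intro r_into_rtrancl) (simp add: insert_commute)
    fix b assume b: "b \<in> verts G"
    show "(u, b) \<in> ?r\<^sup>*"
    proof (cases "b \<in> X")
      case False
      then have "b \<in> Y" using b V by auto
      from nY[OF this] have "card {x \<in> X. {x, b} \<notin> edges G} \<noteq> card X" using X3 by linarith
      then have "{x \<in> X. {x, b} \<notin> edges G} \<noteq> X" by auto
      then obtain x where x: "x \<in> X" "{x, b} \<in> edges G" by auto
      then have "(x, b) \<in> ?r" using b V by auto
      with X[OF x(1)] show ?thesis by (rule rtrancl_into_rtrancl)
    qed (rule X)
  qed
  have edge: "(a \<in> X \<and> b \<in> Y) \<or> (a \<in> Y \<and> b \<in> X)" if "{a, b} \<in> edges G" for a b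
    using simple_graph_edgeD[OF G that] V iX[of a b] iY[of a b] that by auto
  show "\<nexists>a b T. three_isolated G a b T"
  proof
    assume "\<exists>a b T. three_isolated G a b T"
    then obtain a b T where ab: "three_isolated G a b T" by blast
    then have "{a, b} \<in> edges G" by (simp add: three_isolated_def)
    from edge[OF this] obtain x y where T: "three_isolated G x y T" and xy: "x \<in> X" "y \<in> Y"
      using ab three_isolated_commute[OF ab] by blast
    let ?A = "{b \<in> Y. {x, b} \<notin> edges G}" and ?B = "{a \<in> X. {a, y} \<notin> edges G}"
    have TT: "T \<subseteq> X \<union> Y" "card T = 3" "x \<notin> T" "y \<notin> T" "{x, y} \<in> edges G"
      and nx: "\<And>c. c \<in> T \<Longrightarrow> {x, c} \<notin> edges G"
      and ny: "\<And>c. c \<in> T \<Longrightarrow> {y, c} \<notin> edges G"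
      and nT: "\<And>c d. c \<in> T \<Longrightarrow> d \<in> T \<Longrightarrow> {c, d} \<notin> edges G"
      using T V by (simp_all add: three_isolated_def)
    have ny': "{c, y} \<notin> edges G" if "c \<in> T" for c
      using ny[OF that] by (simp add: insert_commute)
    have finT: "finite T" using TT(1) fin by (auto intro: finite_subset)
    have cA: "card ?A = 2" and cB: "card ?B \<le> 2" using nX nY xy by auto
    have fAB: "finite ?A" "finite ?B" using fin by auto
    have TA: "T \<inter> Y \<subseteq> ?A" and TB: "T \<inter> X \<subseteq> ?B" using nx ny' by auto
    have sp: "card T = card (T \<inter> X) + card (T \<inter> Y)"
    proof -
      have "T = (T \<inter> X) \<union> (T \<inter> Y)" using TT(1) by auto
      moreover have "(T \<inter> X) \<inter> (T \<inter> Y) = {}" using dj by auto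
      ultimately show ?thesis using finT by (metis card_Un_disjoint finite_Int)
    qed
    have le: "card (T \<inter> Y) \<le> 2" "card (T \<inter> X) \<le> 2"
      using card_mono[OF fAB(1) TA] card_mono[OF fAB(2) TB] cA cB by auto
    show False
    \<comment> \<open>At most two vertices of \<open>T\<close> lie on each side, so one side holds
      exactly two. A member of \<open>T\<close> on the other side misses these two and also the end
      of the edge \<open>x y\<close> on their side: three vertices, one too many.\<close>
    proof (cases "card (T \<inter> Y) = 2")
      case True
      then have "T \<inter> X \<noteq> {}" using sp TT(2) by force
      then obtain x' where x': "x' \<in> T" "x' \<in> X" by auto
      have "insert y (T \<inter> Y) \<subseteq> {b \<in> Y. {x', b} \<notin> edges G}"
        using ny'[OF x'(1)] nT[OF x'(1)] xy by auto
      moreover have "card (insert y (T \<inter> Y)) = 3" using TT(4) finT True by simp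
      ultimately have "3 \<le> card {b \<in> Y. {x', b} \<notin> edges G}"
        using fin card_mono[of "{b \<in> Y. {x', b} \<notin> edges G}" "insert y (T \<inter> Y)"] by simp
      then show False using nX[OF x'(2)] by simp
    next
      case False
      then have two: "card (T \<inter> X) = 2" and "T \<inter> Y \<noteq> {}" using le sp TT(2) by force+
      then obtain y' where y': "y' \<in> T" "y' \<in> Y" by auto
      have "insert x (T \<inter> X) \<subseteq> {b \<in> X. {b, y'} \<notin> edges G}"
        using nx[OF y'(1)] nT[OF _ y'(1)] xy by auto
      moreover have "card (insert x (T \<inter> X)) = 3" using TT(3) finT two by simp
      ultimately have "3 \<le> card {b \<in> X. {b, y'} \<notin> edges G}"
        using fin card_mono[of "{b \<in> X. {b, y'} \<notin> edges G}" "insert x (T \<inter> X)"] by simp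
      then show False using nY[OF y'(2)] by simp
    qed
  qed
  have degY: "degree G y \<le> card X" if "y \<in> Y" for y
  proof -
    have "{w \<in> verts G. {y, w} \<in> edges G} \<subseteq> X" using edge[of y] that dj by blast
    then show ?thesis unfolding degree_def using fin by (intro card_mono)
  qed
  have degX: "degree G x = card X" if "x \<in> X" for x
  proof -
    have "{w \<in> verts G. {x, w} \<in> edges G} = Y - {y \<in> Y. {x, y} \<notin> edges G}"
      using that V iX by auto
    then show ?thesis using nX[OF that] cY fin unfolding degree_def by (auto simp: card_Diff_subset)
  qed
  have degu: "degree G u = card X"
  proof -
    have "{w \<in> verts G. {u, w} \<in> edges G} = X"
      using V iY u uX by (auto simp: insert_commute)
    then show ?thesis by (simp add: degree_def)
  qed
  have "max_degree G = card X"
    unfolding max_degree_def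
  proof (rule Max_eqI)
    show "finite (degree G ` verts G)" using fin V by simp
    show "d \<le> card X" if "d \<in> degree G ` verts G" for d
      using that degY degX V by auto
    show "card X \<in> degree G ` verts G" using degu u V by (metis UnCI image_eqI)
  qed
  then show "top_vertex G u" using degu u V by (auto simp: top_vertex_def)
  \<comment> \<open>\<open>Y\<close> is independent, so a path has at most one more vertex in
    \<open>Y\<close> than in \<open>X\<close>, hence at most 2 |X| + 1 vertices. The path through
    all vertices except \<open>u\<close> has exactly that many.\<close>
  have "length ys \<le> length ws" if "path_in G ys" for ys
  proof -
    have ys: "ys \<noteq> []" "distinct ys" "set ys \<subseteq> X \<union> Y" "successively (\<lambda>a b. {a, b} \<in> edges G) ys"
      using that V by (auto simp: path_in_iff)
    have "successively (\<lambda>a b. \<not> (a \<in> Y \<and> b \<in> Y)) ys"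
      using ys(4) by (rule successively_mono) (use iY in auto)
    from alternating_count[OF this ys(1)]
    have "length (filter (\<lambda>x. x \<in> Y) ys) \<le> length (filter (\<lambda>x. x \<notin> Y) ys) + 1"
      by (auto simp: of_bool_def split: if_splits)
    moreover have "length (filter (\<lambda>x. x \<notin> Y) ys) \<le> card X"
      using ys fin by (subst distinct_card[symmetric]) (auto intro!: card_mono)
    ultimately have "length ys \<le> 2 * card X + 1"
      using sum_length_filter_compl[of "\<lambda>x. x \<in> Y" ys] by simp
    also have "\<dots> = card (set ws)"
    proof -
      have "card (X \<union> Y) = card X + card Y" using dj fin by (simp add: card_Un_disjoint)
      then show ?thesis using ws V cY u by (simp add: card_Diff_singleton)
    qed
    also have "\<dots> = length ws" using ws(1) by (simp add: distinct_card path_in_iff)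
    finally show ?thesis .
  qed
  then have "longest_path G ws" using ws by (auto simp: longest_path_def)
  then show "\<not> gallai_vertex G u" using ws by (auto simp: gallai_vertex_def)
qed

section \<open>Hamilton cycles in dense bipartite graphs\<close>

text \<open>Closure argument: while re-inserting the forbidden pairs one at a time, a Hamilton cycle through
  a newly forbidden pair \<open>x y\<close> is rerouted, since \<open>x\<close> and \<open>y\<close> have few forbidden partners.\<close>

definition allowed :: "'a set \<Rightarrow> 'a set \<Rightarrow> ('a \<times> 'a) set \<Rightarrow> 'a \<Rightarrow> 'a \<Rightarrow> bool" where
  "allowed A B N p q \<longleftrightarrow> (p \<in> A \<and> q \<in> B \<and> (p, q) \<notin> N) \<or> (p \<in> B \<and> q \<in> A \<and> (q, p) \<notin> N)"

text \<open>A two-vertex list counts as a cycle, its single edge being used twice; the complete case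
  with \<open>card A = 1\<close> relies on this.\<close>

definition ham_cycle :: "'a set \<Rightarrow> ('a \<Rightarrow> 'a \<Rightarrow> bool) \<Rightarrow> 'a list \<Rightarrow> bool" where
  "ham_cycle V R zs \<longleftrightarrow> zs \<noteq> [] \<and> distinct zs \<and> set zs = V \<and> successively R zs \<and> R (last zs) (hd zs)"

lemma allowed_commute: "allowed A B N p q \<longleftrightarrow> allowed A B N q p"
  by (auto simp: allowed_def)

lemma ham_cycle_rotate:
  assumes "ham_cycle V R (us @ vs)" shows "ham_cycle V R (vs @ us)"
  using assms by (cases "us = []"; cases "vs = []") (auto simp: ham_cycle_def successively_append_iff)

lemma ham_cycle_rev:
  assumes "ham_cycle V R zs" "\<And>p q. R p q \<longleftrightarrow> R q p" shows "ham_cycle V R (rev zs)"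
proof -
  have "successively (\<lambda>x y. R y x) zs"
    using assms by (auto simp: ham_cycle_def elim: successively_mono)
  then show ?thesis using assms by (auto simp: ham_cycle_def hd_rev last_rev)
qed

lemma ham_cycle_complete:
  assumes "finite A" "finite B" "card A = card B" "A \<noteq> {}" "A \<inter> B = {}"
  shows "\<exists>zs. ham_cycle (A \<union> B) (allowed A B {}) zs"
proof -
  \<comment> \<open>The claim fixes the ends so that two new vertices can be put in front and the
    closing edge from \<open>B\<close> to \<open>A\<close> is always available.\<close>
  have "\<exists>zs. zs \<noteq> [] \<and> distinct zs \<and> set zs = A \<union> B \<and> successively (allowed A B {}) zs \<and>
      hd zs \<in> A \<and> last zs \<in> B"
    using assms(1,4,2,3,5)
  proof (induction A arbitrary: B rule: finite_ne_induct)
    case (singleton x)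
    then have "card B = 1" by simp
    then obtain y where "B = {y}" by (rule card_1_singletonE)
    with singleton show ?case by (intro exI[of _ "[x, y]"]) (auto simp: allowed_def)
  next
    case (insert x A)
    then have "B \<noteq> {}" by auto
    then obtain y where y: "y \<in> B" by blast
    let ?B = "B - {y}"
    have "card A = card ?B" using insert y by simp
    with insert obtain zs where zs: "zs \<noteq> []" "distinct zs" "set zs = A \<union> ?B"
        "successively (allowed A ?B {}) zs" "hd zs \<in> A" "last zs \<in> ?B"
      using insert.IH[of ?B] by auto
    have "successively (allowed (Set.insert x A) B {}) zs"
      using zs(4) by (rule successively_mono) (auto simp: allowed_def)
    then show ?case
      using zs insert y
      by (intro exI[of _ "x # y # zs"]) (auto simp: successively_Cons allowed_def)
  qed
  then obtain zs where zs: "zs \<noteq> []" "distinct zs" "set zs = A \<union> B" "successively (allowed A B {}) zs"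
      "hd zs \<in> A" "last zs \<in> B" by blast
  then show ?thesis by (intro exI[of _ zs]) (auto simp: ham_cycle_def allowed_def)
qed

text \<open>Ore's crossing argument. Every vertex of \<open>A\<close> is followed on the path by a
  vertex of \<open>B\<close>. Too few of these steps are spoiled by a pair forbidden at
  \<open>x\<close> or at \<open>y\<close> to exhaust \<open>A\<close>, so some step can be replaced
  by a crossing pair of allowed edges.\<close>

lemma ham_path_close:
  assumes ws: "distinct ws" "set ws = A \<union> B" "successively (allowed A B N) ws"
    and x: "ws \<noteq> []" "hd ws = x" "last ws = y" "x \<in> A" "y \<in> B"
    and fin: "finite A" "finite B" and dj: "A \<inter> B = {}"
    and small: "card {b \<in> B. (x, b) \<in> N} + card {a \<in> A. (a, y) \<in> N} < card A"
  shows "\<exists>zs. ham_cycle (A \<union> B) (allowed A B N) zs"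
proof -
  let ?I = "{i. Suc i < length ws \<and> ws ! i \<in> A}"
  let ?P = "{i \<in> ?I. (x, ws ! Suc i) \<in> N}" and ?Q = "{i \<in> ?I. (ws ! i, y) \<in> N}"
  have finI: "finite ?I" by (rule finite_subset[of _ "{..<length ws}"]) auto
  have succ: "ws ! Suc i \<in> B" if "i \<in> ?I" for i
    using that ws(3) dj by (auto simp: successively_conv_nth allowed_def)
  have "A \<subseteq> (\<lambda>i. ws ! i) ` ?I"
  proof
    fix a assume a: "a \<in> A"
    then have "a \<in> set ws" using ws by simp
    then obtain i where i: "i < length ws" "ws ! i = a" by (auto simp: in_set_conv_nth)
    \<comment> \<open>The last vertex \<open>y\<close> lies in \<open>B\<close>, so every vertex of
      \<open>A\<close> has a successor on the path.\<close>
    have "i \<noteq> length ws - 1" using i a x dj by (auto simp: last_conv_nth)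
    then show "a \<in> (\<lambda>i. ws ! i) ` ?I" using i a by auto
  qed
  then have cI: "card A \<le> card ?I" using finI surj_card_le by blast
  have "inj_on (\<lambda>i. ws ! Suc i) ?P" using ws(1) by (auto simp: inj_on_def nth_eq_iff_index_eq)
  then have cP: "card ?P \<le> card {b \<in> B. (x, b) \<in> N}"
    by (rule card_inj_on_le) (use succ fin in auto)
  have "inj_on (\<lambda>i. ws ! i) ?Q" using ws(1) by (auto simp: inj_on_def nth_eq_iff_index_eq)
  then have cQ: "card ?Q \<le> card {a \<in> A. (a, y) \<in> N}"
    by (rule card_inj_on_le) (use fin in auto)
  have "card (?P \<union> ?Q) < card ?I"
    using card_Un_le[of ?P ?Q] cP cQ cI small by linarith
  then have "?P \<union> ?Q \<noteq> ?I" by auto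
  then obtain i where i: "i \<in> ?I" "(x, ws ! Suc i) \<notin> N" "(ws ! i, y) \<notin> N" by blast
  define us vs where "us = take (Suc i) ws" and "vs = drop (Suc i) ws"
  have ne: "us \<noteq> []" "vs \<noteq> []" and split: "ws = us @ vs" using i by (auto simp: us_def vs_def)
  have "last us = ws ! i" using i by (auto simp: us_def take_Suc_conv_app_nth)
  moreover have "hd vs = ws ! Suc i" using i by (auto simp: vs_def hd_drop_conv_nth)
  moreover have "hd us = x" "last vs = y" using x ne split by auto
  moreover have "successively (allowed A B N) (rev vs)"
  proof -
    have "successively (allowed A B N) vs" using ws(3) by (simp add: split successively_append_iff)
    then have "successively (\<lambda>p q. allowed A B N q p) vs"
      by (rule successively_mono) (rule allowed_commute[THEN iffD1])
    then show ?thesis by simp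
  qed
  \<comment> \<open>Follow the path up to \<open>ws ! i\<close>, jump to \<open>y\<close>, walk back
    to \<open>ws ! Suc i\<close>, and close up at \<open>x\<close>.\<close>
  ultimately have "ham_cycle (A \<union> B) (allowed A B N) (us @ rev vs)"
    using ws ne i x succ[OF i(1)]
    by (auto simp: split ham_cycle_def successively_append_iff hd_rev last_rev allowed_def)
  then show ?thesis by blast
qed

lemma bipartite_ham_cycle:
  assumes "finite N" and fin: "finite A" "finite B" and dj: "A \<inter> B = {}" and eq: "card A = card B"
    and "N \<subseteq> A \<times> B"
    and "\<And>a b. a \<in> A \<Longrightarrow> b \<in> B \<Longrightarrow> card {b \<in> B. (a, b) \<in> N} + card {a \<in> A. (a, b) \<in> N} < card A"
    and ne: "A \<noteq> {}"
  shows "\<exists>zs. ham_cycle (A \<union> B) (allowed A B N) zs"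
  using assms(1,6,7)
proof (induction N rule: finite_induct)
  case empty
  show ?case using ham_cycle_complete[OF fin eq ne dj] .
next
  case (insert e N)
  obtain x y where e: "e = (x, y)" "x \<in> A" "y \<in> B" using insert.prems by auto
  have "card {b \<in> B. (a, b) \<in> N} + card {a \<in> A. (a, b) \<in> N} < card A" if "a \<in> A" "b \<in> B" for a b
  proof -
    have "card {b \<in> B. (a, b) \<in> N} \<le> card {b \<in> B. (a, b) \<in> Set.insert e N}"
      "card {a \<in> A. (a, b) \<in> N} \<le> card {a \<in> A. (a, b) \<in> Set.insert e N}"
      using fin by (auto intro!: card_mono)
    then show ?thesis using insert.prems(2)[OF that] by linarith
  qed
  with insert obtain zs where zs: "ham_cycle (A \<union> B) (allowed A B N) zs" by auto
  have allowed: "allowed A B (Set.insert e N) p q \<longleftrightarrow>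
      allowed A B N p q \<and> (p, q) \<noteq> (x, y) \<and> (p, q) \<noteq> (y, x)" for p q
    using e dj by (auto simp: allowed_def)
  \<comment> \<open>Once the new pair is the closing edge of a cycle, the list itself is a Hamilton
    path from \<open>x\<close> to \<open>y\<close> that avoids the pair.\<close>
  have close: "\<exists>zs. ham_cycle (A \<union> B) (allowed A B (Set.insert e N)) zs"
    if zs: "ham_cycle (A \<union> B) (allowed A B N) zs" and "hd zs = x" "last zs = y" for zs
  proof (rule ham_path_close)
    have z: "zs \<noteq> []" "distinct zs" "set zs = A \<union> B" "successively (allowed A B N) zs"
      using zs by (auto simp: ham_cycle_def)
    show "card {b \<in> B. (x, b) \<in> Set.insert e N} + card {a \<in> A. (a, y) \<in> Set.insert e N} < card A"
      using insert.prems(2)[OF e(2,3)] .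
    show "distinct zs" "set zs = A \<union> B" "zs \<noteq> []" "hd zs = x" "last zs = y" using z that by auto
    have "x \<noteq> y" using e dj by auto
    show "successively (allowed A B (Set.insert e N)) zs"
      unfolding successively_conv_nth allowed
    proof (intro allI impI conjI)
      fix i assume i: "Suc i < length zs"
      show "allowed A B N (zs ! i) (zs ! Suc i)" using z i by (simp add: successively_conv_nth)
      have x: "zs ! 0 = x" and y: "zs ! (length zs - 1) = y"
        using that z by (auto simp: hd_conv_nth last_conv_nth)
      have "zs ! Suc i \<noteq> x" using x z(2) i nth_eq_iff_index_eq[OF z(2), of "Suc i" 0] by fastforce
      then show "(zs ! i, zs ! Suc i) \<noteq> (y, x)" by auto
      \<comment> \<open>With only two vertices the closing edge would also be a step of the list.
        The new pair counts once at each of its ends in the degree bound, which forces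
        \<open>card A \<ge> 3\<close>.\<close>
      have "3 < length zs"
      proof (rule ccontr)
        assume "\<not> 3 < length zs"
        moreover have "length zs = card A + card B"
          using z dj fin by (metis card_Un_disjoint distinct_card)
        ultimately have "card A \<le> 1" using eq by linarith
        moreover have "card {b \<in> B. (x, b) \<in> Set.insert e N} > 0"
          using e fin by (auto simp: card_gt_0_iff)
        moreover have "card {a \<in> A. (a, y) \<in> Set.insert e N} > 0"
          using e fin by (auto simp: card_gt_0_iff)
        ultimately show False using insert.prems(2)[OF e(2,3)] by linarith
      qed
      moreover have "zs ! i = x \<Longrightarrow> i = 0" "zs ! Suc i = y \<Longrightarrow> Suc i = length zs - 1"
        using x y i nth_eq_iff_index_eq[OF z(2), of i 0]
          nth_eq_iff_index_eq[OF z(2), of "Suc i" "length zs - 1"] by fastforce+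
      ultimately have "\<not> (zs ! i = x \<and> zs ! Suc i = y)" by linarith
      then show "(zs ! i, zs ! Suc i) \<noteq> (x, y)" by auto
    qed
  qed (use e fin dj in auto)
  show ?case
  proof (cases "ham_cycle (A \<union> B) (allowed A B (Set.insert e N)) zs")
    case False
    \<comment> \<open>If the cycle uses the newly forbidden pair, it can be rotated so that this
      pair becomes the closing edge; its orientation is settled below by reversal.\<close>
    obtain us where us: "ham_cycle (A \<union> B) (allowed A B N) us" "{last us, hd us} = {x, y}"
    proof (cases "successively (allowed A B (Set.insert e N)) zs")
      case True
      then have "\<not> allowed A B (Set.insert e N) (last zs) (hd zs)"
        using False zs by (auto simp: ham_cycle_def)
      then have "{last zs, hd zs} = {x, y}" using zs by (auto simp: allowed ham_cycle_def)
      with zs show thesis by (rule that)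
    next
      case False
      then obtain i where i: "Suc i < length zs"
          "\<not> allowed A B (Set.insert e N) (zs ! i) (zs ! Suc i)"
        by (auto simp: successively_conv_nth)
      moreover have "allowed A B N (zs ! i) (zs ! Suc i)"
        using zs i by (auto simp: ham_cycle_def successively_conv_nth)
      ultimately have "{zs ! i, zs ! Suc i} = {x, y}" by (auto simp: allowed)
      moreover have "last (drop (Suc i) zs @ take (Suc i) zs) = zs ! i"
        "hd (drop (Suc i) zs @ take (Suc i) zs) = zs ! Suc i"
        using i(1) by (simp_all add: take_Suc_conv_app_nth hd_drop_conv_nth)
      ultimately have "{last (drop (Suc i) zs @ take (Suc i) zs),
          hd (drop (Suc i) zs @ take (Suc i) zs)} = {x, y}" by simp
      moreover have "ham_cycle (A \<union> B) (allowed A B N) (drop (Suc i) zs @ take (Suc i) zs)"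
        using zs by (subst (asm) append_take_drop_id[of "Suc i", symmetric]) (rule ham_cycle_rotate)
      ultimately show thesis using that by blast
    qed
    show ?thesis
    proof (cases "hd us = x")
      case True
      then have "last us = y" using us e dj by (auto simp: doubleton_eq_iff)
      then show ?thesis using close us True by blast
    next
      case False
      then have "hd us = y" "last us = x" using us by (auto simp: doubleton_eq_iff)
      moreover have "ham_cycle (A \<union> B) (allowed A B N) (rev us)"
        using us(1) allowed_commute by (rule ham_cycle_rev)
      ultimately show ?thesis using close[of "rev us"] us
        by (auto simp: hd_rev last_rev ham_cycle_def)
    qed
  qed blast
qed

section \<open>Members of the family have the bipartite form\<close>

definition nbrs :: "'a ugraph \<Rightarrow> 'a \<Rightarrow> 'a set" where
  "nbrs F a = {b. {a, b} \<in> edges F}"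

lemma edges_path_of_list:
  "{a, b} \<in> edges (path_of_list qs) \<longleftrightarrow> (\<exists>i. Suc i < length qs \<and> {a, b} = {qs ! i, qs ! Suc i})"
  by (auto simp: path_of_list_def)

lemma edges_path_of_list_nth:
  assumes "distinct qs" "i < length qs" "j < length qs"
  shows "{qs ! i, qs ! j} \<in> edges (path_of_list qs) \<longleftrightarrow> j = Suc i \<or> i = Suc j"
proof
  assume "{qs ! i, qs ! j} \<in> edges (path_of_list qs)"
  then obtain k where "Suc k < length qs" "{qs ! i, qs ! j} = {qs ! k, qs ! Suc k}"
    unfolding edges_path_of_list by blast
  then show "j = Suc i \<or> i = Suc j"
    using assms by (auto simp: doubleton_eq_iff nth_eq_iff_index_eq)
next
  assume "j = Suc i \<or> i = Suc j"
  then show "{qs ! i, qs ! j} \<in> edges (path_of_list qs)"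
    using assms unfolding edges_path_of_list by blast
qed

lemma nbrs_path_of_list:
  assumes "distinct qs" "i < length qs"
  shows "nbrs (path_of_list qs) (qs ! i) = (\<lambda>j. qs ! j) ` {j. j < length qs \<and> (j = Suc i \<or> i = Suc j)}"
proof -
  have "b \<in> set qs" if "{qs ! i, b} \<in> edges (path_of_list qs)" for b
    using that unfolding edges_path_of_list by (auto simp: doubleton_eq_iff)
  then show ?thesis
    using edges_path_of_list_nth[OF assms] by (fastforce simp: nbrs_def in_set_conv_nth)
qed

lemma card_nbrs_path_of_list:
  assumes "distinct qs" "i < length qs"
  shows "card (nbrs (path_of_list qs) (qs ! i)) \<le> 2"
    and "0 < i \<Longrightarrow> Suc i < length qs \<Longrightarrow> card (nbrs (path_of_list qs) (qs ! i)) = 2"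
proof -
  let ?J = "{j. j < length qs \<and> (j = Suc i \<or> i = Suc j)}"
  have c: "card (nbrs (path_of_list qs) (qs ! i)) = card ?J"
    unfolding nbrs_path_of_list[OF assms] using assms(1)
    by (intro card_image) (auto simp: inj_on_def nth_eq_iff_index_eq)
  have "?J \<subseteq> {Suc i, i - 1}" by auto
  then have "card ?J \<le> card {Suc i, i - 1}" by (intro card_mono) auto
  also have "\<dots> = 2" by simp
  finally show "card (nbrs (path_of_list qs) (qs ! i)) \<le> 2" by (simp add: c)
  assume "0 < i" "Suc i < length qs"
  then have "?J = {Suc i, i - 1}" by auto
  then show "card (nbrs (path_of_list qs) (qs ! i)) = 2" by (simp add: c)
qed

text \<open>The cyclic predecessor and successor are the only neighbours, and they differ because
  the length is at least 3.\<close>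

lemma card_nbrs_even_cycle:
  assumes C: "even_cycle C" and a: "a \<in> verts C"
  shows "card (nbrs C a) = 2"
proof -
  obtain n f where n: "n \<ge> 3" and f: "bij_betw f (verts C) (verts (cycle_graph n))"
    and e0: "\<forall>u\<in>verts C. \<forall>v\<in>verts C. {u, v} \<in> edges C \<longleftrightarrow> {f u, f v} \<in> edges (cycle_graph n)"
    using C unfolding even_cycle_def graph_iso_def by blast
  have f: "bij_betw f (verts C) {..<n}" using f by (simp add: cycle_graph_def)
  have e: "{u, v} \<in> edges C \<longleftrightarrow> (\<exists>i<n. {f u, f v} = {i, Suc i mod n})"
    if "u \<in> verts C" "v \<in> verts C" for u v
    using e0[rule_format, OF that] by (auto simp: cycle_graph_def)
  have s: "simple_graph C" using C by (simp add: even_cycle_def)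
  let ?k = "f a"
  have k: "?k < n" using f a by (auto simp: bij_betw_def)
  \<comment> \<open>The cyclic predecessor, with the wrap-around written out because
    \<open>?k - 1\<close> truncates at \<open>?k = 0\<close>.\<close>
  let ?p = "if ?k = 0 then n - 1 else ?k - 1"
  have M: "(\<exists>i<n. {?k, m} = {i, Suc i mod n}) \<longleftrightarrow> m = Suc ?k mod n \<or> m = ?p" if "m < n" for m
  proof
    assume "\<exists>i<n. {?k, m} = {i, Suc i mod n}"
    then obtain i where i: "i < n" "{?k, m} = {i, Suc i mod n}" by blast
    then consider "?k = i" "m = Suc i mod n" | "m = i" "?k = Suc i mod n"
      by (auto simp: doubleton_eq_iff)
    then show "m = Suc ?k mod n \<or> m = ?p"
    proof cases
      case 2
      then show ?thesis using i(1) by (cases "Suc i = n") auto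
    qed simp
  next
    assume "m = Suc ?k mod n \<or> m = ?p"
    then show "\<exists>i<n. {?k, m} = {i, Suc i mod n}"
    proof
      assume "m = Suc ?k mod n" then show ?thesis using k by blast
    next
      assume "m = ?p"
      then have "?k = Suc m mod n" using k n by (auto split: if_splits)
      then have "{?k, m} = {m, Suc m mod n}" by auto
      then show ?thesis using that by blast
    qed
  qed
  have "f ` nbrs C a = {Suc ?k mod n, ?p}"
  proof (intro equalityI subsetI)
    fix m assume "m \<in> f ` nbrs C a"
    then obtain b where b: "{a, b} \<in> edges C" "m = f b" by (auto simp: nbrs_def)
    have "b \<in> verts C" using b simple_graph_edgeD[OF s] by blast
    moreover from this have "f b < n" using f by (auto simp: bij_betw_def)
    ultimately show "m \<in> {Suc ?k mod n, ?p}" using e[of a b] M[of "f b"] b a by blast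
  next
    fix m assume m: "m \<in> {Suc ?k mod n, ?p}"
    then have "m < n" using k by auto
    then have "m \<in> f ` verts C" using f by (simp add: bij_betw_def)
    then obtain b where b: "b \<in> verts C" "f b = m" by blast
    then have "{a, b} \<in> edges C" using e[OF a b(1)] M[OF \<open>m < n\<close>] m b(2) by simp
    then show "m \<in> f ` nbrs C a" using b by (auto simp: nbrs_def)
  qed
  moreover have "inj_on f (nbrs C a)"
    using f simple_graph_edgeD[OF s] by (auto simp: bij_betw_def nbrs_def intro: inj_on_subset)
  moreover have "Suc ?k mod n \<noteq> ?p"
    using n k by (cases "Suc ?k = n") auto
  ultimately show ?thesis using card_image[of f "nbrs C a"] by simp
qed

text \<open>\<open>is_disjoint_union\<close> treats vertices and edges separately;
  \<open>inside\<close> ties an edge to the part containing its ends, and disjointness then puts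
  every edge at \<open>a\<close> into \<open>H\<close>.\<close>

lemma nbrs_disjoint_union:
  assumes un: "is_disjoint_union F Hs" and H: "H \<in> set Hs" "a \<in> verts H"
    and inside: "\<And>H e. H \<in> set Hs \<Longrightarrow> e \<in> edges H \<Longrightarrow> e \<subseteq> verts H"
  shows "nbrs F a = nbrs H a"
proof -
  have "{a, b} \<in> edges H" if b: "{a, b} \<in> edges F" for b
  proof -
    obtain H' where H': "H' \<in> set Hs" "{a, b} \<in> edges H'"
      using un b by (auto simp: is_disjoint_union_def)
    then have a': "a \<in> verts H'" using inside by blast
    obtain i j where ij: "i < length Hs" "j < length Hs" "Hs ! i = H" "Hs ! j = H'"
      using H(1) H'(1) by (auto simp: in_set_conv_nth)
    have "i = j"
    proof (rule ccontr)
      assume "i \<noteq> j"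
      then have "verts (Hs ! i) \<inter> verts (Hs ! j) = {}"
        using un ij unfolding is_disjoint_union_def
        by (metis inf_commute linorder_neqE_nat)
      then show False using a' H(2) ij by auto
    qed
    then show ?thesis using ij H' by auto
  qed
  moreover have "edges H \<subseteq> edges F" using un H(1) by (auto simp: is_disjoint_union_def)
  ultimately show ?thesis by (auto simp: nbrs_def)
qed

lemma edges_complete_bipartite:
  "{a, b} \<in> edges (complete_bipartite X Y) \<longleftrightarrow> (a \<in> X \<and> b \<in> Y) \<or> (a \<in> Y \<and> b \<in> X)"
  by (auto simp: complete_bipartite_def doubleton_eq_iff)

text \<open>Equality case of \<open>alternating_count\<close>: with one more vertex in
  \<open>Y\<close> than in \<open>X\<close>, both end terms must be 1. It yields the ends in
  \<open>Y0\<close> that the definition of the family does not state for P_7.\<close>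

lemma alternating_ends:
  assumes ws: "distinct ws" "ws \<noteq> []" "set ws = X \<union> Y" "X \<inter> Y = {}" "finite X" "finite Y"
    and c: "card Y = Suc (card X)" and s: "successively (\<lambda>a b. \<not> (a \<in> Y \<and> b \<in> Y)) ws"
  shows "hd ws \<in> Y" "last ws \<in> Y"
proof -
  have "length (filter (\<lambda>x. x \<in> Y) ws) = card Y"
    using ws by (subst distinct_card[symmetric]) (auto intro!: arg_cong[of _ _ card])
  moreover have "length (filter (\<lambda>x. x \<notin> Y) ws) = card X"
    using ws by (subst distinct_card[symmetric]) (auto intro!: arg_cong[of _ _ card])
  ultimately have "of_bool (hd ws \<in> Y) + of_bool (last ws \<in> Y) \<ge> (2::nat)"
    using alternating_count[OF s ws(2)] c by simp
  then show "hd ws \<in> Y" "last ws \<in> Y" by (auto simp: of_bool_def split: if_splits)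
qed

text \<open>Simplicity is what upgrades the isomorphism to an equality of records, since
  \<open>graph_iso\<close> ignores edges outside the vertex set.\<close>

lemma iso_path_graphD:
  assumes s: "simple_graph F" and iso: "graph_iso F (path_graph n)"
  obtains qs where "distinct qs" "length qs = n" "F = path_of_list qs"
proof -
  obtain f where f: "bij_betw f (verts F) {..<n}"
    and e: "\<And>u v. u \<in> verts F \<Longrightarrow> v \<in> verts F \<Longrightarrow>
      {u, v} \<in> edges F \<longleftrightarrow> {f u, f v} \<in> edges (path_of_list [0..<n])"
    using iso by (auto simp: graph_iso_def path_graph_def path_of_list_def lessThan_atLeast0)
  let ?g = "inv_into (verts F) f"
  have g: "bij_betw ?g {..<n} (verts F)" using f by (rule bij_betw_inv_into)
  have fg: "f (?g i) = i" if "i < n" for i using f that by (simp add: bij_betw_inv_into_right)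
  define qs where "qs = map ?g [0..<n]"
  have d: "distinct qs" "length qs = n" "set qs = verts F"
    using g by (auto simp: qs_def distinct_map bij_betw_def lessThan_atLeast0)
  have q: "f (qs ! i) = i" if "i < n" for i using fg that by (simp add: qs_def)
  have E: "{qs ! i, qs ! j} \<in> edges F \<longleftrightarrow> {qs ! i, qs ! j} \<in> edges (path_of_list qs)"
    if "i < n" "j < n" for i j
  proof -
    have "qs ! i \<in> verts F" "qs ! j \<in> verts F" using that d by (metis nth_mem)+
    then show ?thesis
      using e edges_path_of_list_nth[of "[0..<n]" i j] edges_path_of_list_nth[of qs i j] that d q
      by simp
  qed
  have "edges F = edges (path_of_list qs)"
  proof (intro equalityI subsetI)
    fix e assume e: "e \<in> edges F"
    then obtain a b where ab: "e = {a, b}" "a \<in> verts F" "b \<in> verts F"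
      by (rule simple_graph_edgeE[OF s])
    then obtain i j where "i < n" "j < n" "a = qs ! i" "b = qs ! j"
      using d by (metis in_set_conv_nth)
    then show "e \<in> edges (path_of_list qs)" using E e ab by simp
  next
    fix e assume "e \<in> edges (path_of_list qs)"
    then obtain i where "Suc i < n" "e = {qs ! i, qs ! Suc i}" using d by (auto simp: path_of_list_def)
    then show "e \<in> edges F"
      using E[of i "Suc i"] d edges_path_of_list_nth[of qs i "Suc i"] by simp
  qed
  then have "F = path_of_list qs" using d by (simp add: path_of_list_def)
  with d show ?thesis using that by blast
qed

text \<open>Gives t = 3 and t \<ge> 4 one shape: P_7 is a path Q with no cycles beside it, and a
  trivial Q has both ends equal.\<close>

lemma family_F_D:
  assumes F: "F \<in> family_F t X Y0" and fin: "finite X" "finite Y0" and dj: "X \<inter> Y0 = {}"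
    and c: "card X = t" "card Y0 = Suc t"
  obtains qs Cs where "distinct qs" "qs \<noteq> []" "hd qs \<in> Y0" "last qs \<in> Y0"
    "\<And>C. C \<in> set Cs \<Longrightarrow> even_cycle C" "is_disjoint_union F (path_of_list qs # Cs)"
    "t = 3 \<Longrightarrow> F = path_of_list qs \<and> length qs = 7"
proof (cases "t = 3")
  case False
  with F obtain qs Cs where q: "distinct qs"
      "length qs \<ge> 2 \<and> hd qs \<in> Y0 \<and> last qs \<in> Y0 \<or> (\<exists>y\<in>Y0. qs = [y])"
      "\<forall>C\<in>set Cs. even_cycle C" "is_disjoint_union F (path_of_list qs # Cs)"
    by (auto simp: family_F_def)
  show ?thesis
    by (rule that[of qs Cs]) (use q False in auto)
next
  case True
  have sp: "verts F = X \<union> Y0" "edges F \<subseteq> edges (complete_bipartite X Y0)"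
    and iso: "graph_iso F (path_graph 7)"
    using F True by (auto simp: family_F_def spanning_subgraph_def complete_bipartite_def)
  have "simple_graph F"
    unfolding simple_graph_def
  proof (intro conjI ballI)
    show "finite (verts F)" using sp fin by simp
    fix e assume "e \<in> edges F"
    then obtain x y where "e = {x, y}" "x \<in> X" "y \<in> Y0" using sp by (auto simp: complete_bipartite_def)
    moreover then have "x \<noteq> y" using dj by auto
    ultimately show "e \<subseteq> verts F" "card e = 2" using sp by auto
  qed
  then obtain qs where qs: "distinct qs" "length qs = 7" "F = path_of_list qs"
    using iso by (rule iso_path_graphD)
  have "set qs = X \<union> Y0" using qs sp by (simp add: path_of_list_def)
  moreover have "successively (\<lambda>a b. \<not> (a \<in> Y0 \<and> b \<in> Y0)) qs"
  proof -
    have "\<not> (qs ! i \<in> Y0 \<and> qs ! Suc i \<in> Y0)" if "Suc i < length qs" for i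
    proof -
      have "{qs ! i, qs ! Suc i} \<in> edges F" using qs that by (auto simp: path_of_list_def)
      then show ?thesis using sp(2) dj edges_complete_bipartite[of "qs ! i" "qs ! Suc i" X Y0] by blast
    qed
    then show ?thesis by (simp add: successively_conv_nth)
  qed
  moreover have "qs \<noteq> []" using qs by auto
  ultimately have "hd qs \<in> Y0" "last qs \<in> Y0"
    using alternating_ends[of qs X Y0] qs fin dj c by auto
  moreover have "is_disjoint_union F [path_of_list qs]" using qs by (simp add: is_disjoint_union_def)
  ultimately show ?thesis using that[of qs "[]"] qs \<open>qs \<noteq> []\<close> by simp
qed

text \<open>Only the ends of Q can have degree below 2, and these lie in \<open>Y0\<close>.\<close>

lemma card_nbrs_family_F:
  assumes F: "F \<in> family_F t X Y0" and fin: "finite X" "finite Y0" and dj: "X \<inter> Y0 = {}"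
    and c: "card X = t" "card Y0 = Suc t"
  shows "x \<in> X \<Longrightarrow> card (nbrs F x) = 2" and "y \<in> X \<union> Y0 \<Longrightarrow> card (nbrs F y) \<le> 2"
proof -
  obtain qs Cs where q: "distinct qs" "qs \<noteq> []" "hd qs \<in> Y0" "last qs \<in> Y0"
    and Cs: "\<And>C. C \<in> set Cs \<Longrightarrow> even_cycle C"
    and un: "is_disjoint_union F (path_of_list qs # Cs)"
    by (rule family_F_D[OF assms]) (rule that)
  have inside: "e \<subseteq> verts H" if "H \<in> set (path_of_list qs # Cs)" "e \<in> edges H" for H e
    using that Cs by (auto simp: path_of_list_def even_cycle_def simple_graph_def)
  have V: "verts F = X \<union> Y0"
    using F by (auto simp: family_F_def spanning_subgraph_def complete_bipartite_def)
  have *: "card (nbrs F a) = 2 \<or> a \<in> Y0 \<and> card (nbrs F a) \<le> 2" if "a \<in> X \<union> Y0" for a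
  proof -
    have "verts F = (\<Union>H\<in>set (path_of_list qs # Cs). verts H)"
      using un unfolding is_disjoint_union_def by (rule conjunct1)
    then have "a \<in> (\<Union>H\<in>set (path_of_list qs # Cs). verts H)" using that V by (simp only:)
    then obtain H where H: "H \<in> set (path_of_list qs # Cs)" "a \<in> verts H" by (rule UN_E)
    have nb: "nbrs F a = nbrs H a" using un H inside by (rule nbrs_disjoint_union)
    show ?thesis
    proof (cases "H \<in> set Cs")
      case True
      then show ?thesis using nb card_nbrs_even_cycle[OF Cs H(2)] by simp
    next
      case False
      then have HQ: "H = path_of_list qs" using H by simp
      then obtain i where i: "i < length qs" "a = qs ! i"
        using H by (auto simp: path_of_list_def in_set_conv_nth)
      show ?thesis
      proof (cases "0 < i \<and> Suc i < length qs")
        case True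
        then show ?thesis using card_nbrs_path_of_list[OF q(1) i(1)] nb HQ i by simp
      next
        case False
        then have "i = 0 \<or> i = length qs - 1" using i by auto
        then have "a \<in> Y0" using q i by (auto simp: hd_conv_nth last_conv_nth)
        then show ?thesis using card_nbrs_path_of_list[OF q(1) i(1)] nb HQ i by simp
      qed
    qed
  qed
  show "x \<in> X \<Longrightarrow> card (nbrs F x) = 2" using *[of x] dj by auto
  show "y \<in> X \<union> Y0 \<Longrightarrow> card (nbrs F y) \<le> 2" using *[of y] by auto
qed

lemma edges_G_of:
  "{a, b} \<in> edges (G_of X Y F) \<longleftrightarrow>
     ((a \<in> X \<and> b \<in> Y) \<or> (a \<in> Y \<and> b \<in> X)) \<and> {a, b} \<notin> edges F"
  by (auto simp: G_of_def edges_complete_bipartite)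

text \<open>\<open>u\<close> is moved to the side of \<open>X\<close> and declared compatible with
  all of \<open>Y - {u}\<close>, so both sides have t + 1 vertices. The bound 2 + 2 < t + 1 is
  exactly t \<ge> 4. All artificial edges meet \<open>u\<close>, so cutting the Hamilton cycle at
  \<open>u\<close> leaves a path of the graph itself.\<close>

lemma G_of_ham_path:
  assumes fin: "finite X" "finite Y" and dj: "X \<inter> Y = {}" and c: "card X = t" "card Y = t + 2"
    and t: "t \<ge> 4" and u: "u \<in> Y"
    and dX: "\<And>x. x \<in> X \<Longrightarrow> card (nbrs F x) \<le> 2" and dY: "\<And>y. y \<in> Y - {u} \<Longrightarrow> card (nbrs F y) \<le> 2"
    and finF: "\<And>v. finite (nbrs F v)"
  shows "\<exists>ws. path_in (G_of X Y F) ws \<and> set ws = X \<union> Y - {u}"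
proof -
  let ?A = "insert u X" and ?B = "Y - {u}"
  let ?N = "{(x, y). x \<in> X \<and> y \<in> ?B \<and> {x, y} \<in> edges F}"
  have uX: "u \<notin> X" using u dj by auto
  have cA: "card ?A = t + 1" using uX fin c by simp
  have "\<exists>zs. ham_cycle (?A \<union> ?B) (allowed ?A ?B ?N) zs"
  proof (rule bipartite_ham_cycle)
    show "finite ?N" by (rule finite_subset[of _ "X \<times> Y"]) (use fin in auto)
    show "finite ?A" "finite ?B" "?A \<inter> ?B = {}" "?N \<subseteq> ?A \<times> ?B" "?A \<noteq> {}" using fin dj by auto
    show "card ?A = card ?B" using cA c u fin by simp
    fix a b assume ab: "a \<in> ?A" "b \<in> ?B"
    have "card {b \<in> ?B. (a, b) \<in> ?N} \<le> 2"
    proof (cases "a \<in> X")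
      case True
      have "card {b \<in> ?B. (a, b) \<in> ?N} \<le> card (nbrs F a)"
        by (intro card_mono finF) (auto simp: nbrs_def)
      then show ?thesis using dX[OF True] by linarith
    qed simp
    moreover have "card {a \<in> ?A. (a, b) \<in> ?N} \<le> card (nbrs F b)"
      by (intro card_mono finF) (auto simp: nbrs_def insert_commute)
    ultimately show "card {b \<in> ?B. (a, b) \<in> ?N} + card {a \<in> ?A. (a, b) \<in> ?N} < card ?A"
      using dY[OF ab(2)] cA t by linarith
  qed
  then obtain zs where zs: "ham_cycle (?A \<union> ?B) (allowed ?A ?B ?N) zs" by blast
  then have "u \<in> set zs" by (simp add: ham_cycle_def)
  then obtain us vs where "zs = us @ u # vs" by (meson split_list)
  with zs have "ham_cycle (?A \<union> ?B) (allowed ?A ?B ?N) ((u # vs) @ us)"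
    using ham_cycle_rotate by blast
  then have h: "distinct (u # vs @ us)" "set (u # vs @ us) = ?A \<union> ?B"
      "successively (allowed ?A ?B ?N) (u # vs @ us)"
    by (simp_all add: ham_cycle_def)
  define ws where "ws = vs @ us"
  have ws: "distinct ws" "u \<notin> set ws" "insert u (set ws) = ?A \<union> ?B"
    "successively (allowed ?A ?B ?N) ws"
    using h by (auto simp: ws_def successively_Cons)
  have S: "set ws = X \<union> Y - {u}" using ws u uX by auto
  moreover have "successively (\<lambda>a b. {a, b} \<in> edges (G_of X Y F)) ws"
    using ws(4)
  proof (rule successively_mono)
    fix p q assume pq: "p \<in> set ws" "q \<in> set ws" and al: "allowed ?A ?B ?N p q"
    have "p \<noteq> u" "q \<noteq> u" using pq ws by auto
    then show "{p, q} \<in> edges (G_of X Y F)"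
      using al unfolding edges_G_of allowed_def by (auto simp: insert_commute)
  qed
  moreover have "ws \<noteq> []"
  proof
    assume "ws = []"
    then have "X \<union> Y - {u} = {}" using S by simp
    then have "X = {}" using uX by auto
    then show False using c t by simp
  qed
  ultimately have "path_in (G_of X Y F) ws" using ws by (auto simp: path_in_iff G_of_def)
  then show ?thesis using S by blast
qed

lemma distinct_length7:
  assumes "length qs = 7"
  obtains a b c d e f g where "qs = [a, b, c, d, e, f, g]"
  using assms by (auto simp: numeral_eq_Suc length_Suc_conv)

lemma family_G_bipartite_form:
  assumes "H \<in> family_G"
  shows "\<exists>X Y u. bipartite_form H X Y u"
proof -
  obtain t X Y u F where H: "H = G_of X Y F" and fin: "finite X" "finite Y" and dj: "X \<inter> Y = {}"
    and c: "card X = t" "card Y = t + 2" and u: "u \<in> Y" and F: "F \<in> family_F t X (Y - {u})"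
    and t: "t \<ge> 3"
    using assms by (auto simp: family_G_def family_G_at_def)
  let ?Y0 = "Y - {u}"
  have c0: "card ?Y0 = Suc t" "finite ?Y0" "X \<inter> ?Y0 = {}" using c u fin dj by auto
  have sp: "edges F \<subseteq> edges (complete_bipartite X ?Y0)"
    using F by (auto simp: family_F_def spanning_subgraph_def)
  have FE: "(a \<in> X \<and> b \<in> ?Y0) \<or> (a \<in> ?Y0 \<and> b \<in> X)" if "{a, b} \<in> edges F" for a b
    using subsetD[OF sp that] unfolding edges_complete_bipartite .
  note deg = card_nbrs_family_F[OF F fin(1) c0(2,3) c(1) c0(1)]
  have finF: "finite (nbrs F v)" for v
    by (rule finite_subset[of _ "X \<union> Y"]) (use fin FE in \<open>auto simp: nbrs_def\<close>)
  have ham: "\<exists>ws. path_in H ws \<and> set ws = X \<union> Y - {u}"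
  proof (cases "t = 3")
    case False
    show ?thesis unfolding H
      by (rule G_of_ham_path[OF fin dj c _ u _ _ finF]) (use False t deg in auto)
  next
    case True
    obtain qs where q0: "distinct qs" "hd qs \<in> ?Y0" "t = 3 \<Longrightarrow> F = path_of_list qs \<and> length qs = 7"
      by (rule family_F_D[OF F fin(1) c0(2,3) c(1) c0(1)]) (rule that)
    then have q: "distinct qs" "hd qs \<in> ?Y0" "F = path_of_list qs" "length qs = 7"
      using True by simp_all
    have V: "set qs = X \<union> ?Y0"
      using F q by (auto simp: family_F_def spanning_subgraph_def complete_bipartite_def path_of_list_def)
    have E: "{qs ! i, qs ! j} \<in> edges F \<longleftrightarrow> j = Suc i \<or> i = Suc j" if "i < 7" "j < 7" for i j
      using that q edges_path_of_list_nth[of qs i j] by simp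
    have alt: "qs ! i \<in> (if even i then ?Y0 else X)" if "i < 7" for i
      using that
    proof (induction i)
      case 0
      then show ?case using q by (cases qs) auto
    next
      case (Suc i)
      then have "{qs ! i, qs ! Suc i} \<in> edges F" using E by simp
      from FE[OF this] Suc show ?case using dj by (auto split: if_splits)
    qed
    have adj: "{qs ! i, qs ! j} \<in> edges H"
      if "i < 7" "j < 7" "even i \<noteq> even j" "j \<noteq> Suc i" "i \<noteq> Suc j" for i j
      using alt[OF that(1)] alt[OF that(2)] that(3-) E[OF that(1,2)] unfolding H edges_G_of
      by (auto split: if_splits)
    \<comment> \<open>The bipartite complement of a \<open>P\<^sub>7\<close> is again a \<open>P\<^sub>7\<close>, traced in this order.\<close>
    define ws where "ws = map (\<lambda>i. qs ! i) [2, 5, 0, 3, 6, 1, 4]"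
    have "distinct ws" using q by (simp add: ws_def nth_eq_iff_index_eq)
    moreover have "set ws = set qs"
    proof -
      obtain a b c d e f g where "qs = [a, b, c, d, e, f, g]" using q(4) by (rule distinct_length7)
      then show ?thesis by (auto simp: ws_def)
    qed
    moreover have "successively (\<lambda>a b. {a, b} \<in> edges H) ws"
      using adj by (simp add: ws_def)
    moreover have "ws \<noteq> []" by (simp add: ws_def)
    ultimately have "path_in H ws" "set ws = X \<union> Y - {u}"
      using V u dj by (auto simp: path_in_iff H G_of_def)
    then show ?thesis by blast
  qed
  have "bipartite_form H X Y u"
    unfolding bipartite_form_def
  proof (intro conjI ballI)
    show VH: "verts H = X \<union> Y" by (simp add: H G_of_def)
    show "X \<inter> Y = {}" "card Y = card X + 2" "3 \<le> card X" "u \<in> Y" using dj c t u by auto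
    show "\<exists>ws. path_in H ws \<and> set ws = verts H - {u}" using ham VH by simp
  next
    fix x x' assume "x \<in> X" "x' \<in> X"
    then show "{x, x'} \<notin> edges H" using dj unfolding H edges_G_of by auto
  next
    fix x x' assume "x \<in> Y" "x' \<in> Y"
    then show "{x, x'} \<notin> edges H" using dj unfolding H edges_G_of by auto
  next
    fix x assume x: "x \<in> X"
    show "{x, u} \<in> edges H" using FE[of x u] x u dj unfolding H edges_G_of by auto
    have "{y \<in> Y. {x, y} \<notin> edges H} = nbrs F x"
      using FE[of x] x dj unfolding H edges_G_of nbrs_def by auto
    then show "card {y \<in> Y. {x, y} \<notin> edges H} = 2" using deg(1)[OF x] by simp
  next
    fix y assume y: "y \<in> Y"
    have *: "{x \<in> X. {x, y} \<notin> edges H} = {x \<in> X. {y, x} \<in> edges F}"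
      using y unfolding H edges_G_of by (auto simp: insert_commute)
    show "card {x \<in> X. {x, y} \<notin> edges H} \<le> 2"
    proof (cases "y = u")
      case True
      then have none: "{x \<in> X. {y, x} \<in> edges F} = {}" using FE[of y] dj y by auto
      show ?thesis unfolding * none by simp
    next
      case False
      have "card {x \<in> X. {y, x} \<in> edges F} \<le> card (nbrs F y)"
        by (intro card_mono finF) (auto simp: nbrs_def)
      then show ?thesis using deg(2)[of y] False y unfolding * by simp
    qed
  qed
  then show ?thesis by blast
qed

section \<open>Decomposing the bipartite complement\<close>

lemma finite_nbrs:
  assumes "simple_graph F" shows "finite (nbrs F a)"
  by (rule finite_subset[of _ "verts F"])
    (use assms simple_graph_edgeD[OF assms] in \<open>auto simp: nbrs_def simple_graph_def\<close>)

lemma nbrs_altdef: "nbrs F a = {b. {b, a} \<in> edges F}"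
  by (simp add: nbrs_def insert_commute)

text \<open>A longest path among those starting at \<open>a\<close> cannot be extended at its far
  end.\<close>

lemma maximal_path_from:
  assumes s: "simple_graph F" and a: "a \<in> verts F"
  obtains qs where "path_in F qs" "hd qs = a" "nbrs F (last qs) \<subseteq> set qs"
proof -
  let ?P = "\<lambda>qs. path_in F qs \<and> hd qs = a"
  have fin: "finite (verts F)" using s by (simp add: simple_graph_def)
  have "?P [a]" using a by (simp add: path_in_def)
  moreover have "\<forall>qs. ?P qs \<longrightarrow> length qs < Suc (card (verts F))"
    using fin by (auto simp: path_in_def less_Suc_eq_le distinct_card[symmetric] intro!: card_mono)
  ultimately obtain qs where qs: "?P qs" "\<And>ys. ?P ys \<Longrightarrow> length ys \<le> length qs"
    using ex_has_greatest_nat[of ?P "[a]" length "Suc (card (verts F))"] by blast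
  have "b \<in> set qs" if "{last qs, b} \<in> edges F" for b
  proof (rule ccontr)
    assume "b \<notin> set qs"
    then have "?P (qs @ [b])"
      using qs(1) that simple_graph_edgeD[OF s that]
      by (auto simp: path_in_iff successively_append_iff hd_append)
    from qs(2)[OF this] show False by simp
  qed
  then show ?thesis using that qs(1) by (auto simp: nbrs_def)
qed

text \<open>The two neighbours along the path are distinct and exhaust the degree bound.\<close>

lemma nbrs_path_interior:
  assumes s: "simple_graph F" and qs: "path_in F qs" and c: "card (nbrs F (qs ! i)) \<le> 2"
    and i: "0 < i" "Suc i < length qs"
  shows "nbrs F (qs ! i) = {qs ! (i - 1), qs ! Suc i}"
proof -
  have "{qs ! (i - 1), qs ! i} \<in> edges F" "{qs ! i, qs ! Suc i} \<in> edges F"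
    using qs i unfolding path_in_def by (metis Suc_pred' less_SucI Suc_lessD Suc_diff_1)+
  then have sub: "{qs ! (i - 1), qs ! Suc i} \<subseteq> nbrs F (qs ! i)"
    by (auto simp: nbrs_def insert_commute)
  have "distinct qs" using qs by (simp add: path_in_def)
  then have "qs ! (i - 1) \<noteq> qs ! Suc i" using i by (simp add: nth_eq_iff_index_eq)
  then show ?thesis
    using card_seteq[OF finite_nbrs[OF s] sub] c by simp
qed

text \<open>An interior vertex already has both its neighbours next to it on the path, so an edge
  from the last vertex back into the path reaches only the first vertex or the last but one.\<close>

lemma maximal_path_last_nbr:
  assumes s: "simple_graph F" and qs: "path_in F qs" and c: "\<And>v. v \<in> set qs \<Longrightarrow> card (nbrs F v) \<le> 2"
    and j: "Suc j < length qs" "qs ! j \<in> nbrs F (last qs)"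
  shows "j = 0 \<or> Suc (Suc j) = length qs"
proof (rule ccontr)
  assume n: "\<not> (j = 0 \<or> Suc (Suc j) = length qs)"
  have d: "distinct qs" "qs \<noteq> []" using qs by (auto simp: path_in_def)
  have "nbrs F (qs ! j) = {qs ! (j - 1), qs ! Suc j}"
    by (rule nbrs_path_interior[OF s qs c]) (use j n in auto)
  moreover have "last qs \<in> nbrs F (qs ! j)" using j(2) by (simp add: nbrs_def insert_commute)
  ultimately have "qs ! (length qs - 1) = qs ! (j - 1) \<or> qs ! (length qs - 1) = qs ! Suc j"
    using d by (simp add: last_conv_nth)
  moreover have "length qs - 1 < length qs" "j - 1 < length qs" using d j by auto
  ultimately have "length qs - 1 = j - 1 \<or> length qs - 1 = Suc j"
    using d(1) j(1) by (simp add: nth_eq_iff_index_eq)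
  then show False using n j by auto
qed

definition remove_verts :: "'a ugraph \<Rightarrow> 'a set \<Rightarrow> 'a ugraph" where
  "remove_verts F W = \<lparr>verts = verts F - W, edges = {e \<in> edges F. e \<inter> W = {}}\<rparr>"

text \<open>A set closed under neighbours is a union of components: no edge crosses its boundary, so
  degrees outside survive its removal.\<close>

lemma remove_closed:
  assumes s: "simple_graph F" and closed: "\<forall>a\<in>W. nbrs F a \<subseteq> W"
  shows "simple_graph (remove_verts F W)"
    and "a \<notin> W \<Longrightarrow> nbrs (remove_verts F W) a = nbrs F a"
    and "edges F = edges (induced_subgraph F W) \<union> edges (remove_verts F W)"
proof -
  show "simple_graph (remove_verts F W)"
    using s by (auto simp: simple_graph_def remove_verts_def)
  show "nbrs (remove_verts F W) a = nbrs F a" if a: "a \<notin> W" for a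
  proof -
    have "b \<notin> W" if "{a, b} \<in> edges F" for b
    proof
      assume "b \<in> W"
      moreover have "a \<in> nbrs F b" using that by (simp add: nbrs_def insert_commute)
      ultimately show False using closed a by blast
    qed
    then show ?thesis using a by (auto simp: nbrs_def remove_verts_def)
  qed
  have "e \<subseteq> W \<or> e \<inter> W = {}" if ed: "e \<in> edges F" for e
  proof -
    obtain a b where e: "e = {a, b}" by (rule simple_graph_edgeE[OF s ed]) (rule that)
    then have "b \<in> nbrs F a" "a \<in> nbrs F b" using ed by (auto simp: nbrs_def insert_commute)
    then show ?thesis using closed e by blast
  qed
  then show "edges F = edges (induced_subgraph F W) \<union> edges (remove_verts F W)"
    by (auto simp: induced_subgraph_def remove_verts_def)
qed

lemma is_disjoint_union_Cons:
  assumes un: "is_disjoint_union (remove_verts F W) Hs" and W: "W \<subseteq> verts F"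
    and H: "verts H = W" "edges F = edges H \<union> edges (remove_verts F W)"
  shows "is_disjoint_union F (H # Hs)"
proof -
  have V: "verts F - W = (\<Union>H\<in>set Hs. verts H)" and E: "edges (remove_verts F W) = (\<Union>H\<in>set Hs. edges H)"
    and D: "\<And>i j. i < j \<Longrightarrow> j < length Hs \<Longrightarrow> verts (Hs ! i) \<inter> verts (Hs ! j) = {}"
    using un by (auto simp: is_disjoint_union_def remove_verts_def)
  have "verts ((H # Hs) ! i) \<inter> verts ((H # Hs) ! j) = {}" if "i < j" "j < length (H # Hs)" for i j
  proof (cases i)
    case 0
    have "verts (Hs ! (j - 1)) \<subseteq> verts F - W" using V that by (auto simp: nth_mem)
    then show ?thesis using 0 that H by auto
  next
    case (Suc k)
    then show ?thesis using D[of k "j - 1"] that by auto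
  qed
  moreover have "verts F = W \<union> (\<Union>H\<in>set Hs. verts H)" using V W by auto
  ultimately show ?thesis using E H unfolding is_disjoint_union_def by simp
qed

text \<open>The last vertex needs two neighbours, and the only candidates are its predecessor and
  the first vertex. So the path closes to a cycle, and all degrees on it are used up.\<close>

lemma even_cycle_component:
  assumes s: "simple_graph F" and ws: "path_in F ws" "nbrs F (last ws) \<subseteq> set ws"
    and c: "\<forall>v\<in>set ws. card (nbrs F v) = 2"
    and bip: "\<forall>a b. {a, b} \<in> edges F \<longrightarrow> (a \<in> X \<longleftrightarrow> b \<notin> X)"
  shows "even_cycle (induced_subgraph F (set ws))" "\<forall>a\<in>set ws. nbrs F a \<subseteq> set ws"
proof -
  define n where "n = length ws"
  have d: "distinct ws" "ws \<noteq> []" using ws by (auto simp: path_in_def)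
  have n0: "n > 0" using d by (simp add: n_def)
  have l: "last ws = ws ! (n - 1)" using d by (simp add: last_conv_nth n_def)
  have c': "card (nbrs F (ws ! i)) = 2" if "i < n" for i using c that by (simp add: n_def)
  have "last ws \<notin> nbrs F (last ws)" using simple_graph_no_loop[OF s] by (simp add: nbrs_def)
  then have "nbrs F (last ws) \<subseteq> set ws - {last ws}" using ws by auto
  then have "card (nbrs F (last ws)) \<le> card (set ws - {last ws})" by (intro card_mono) auto
  then have n3: "n \<ge> 3" using c'[of "n - 1"] n0 d l by (simp add: distinct_card n_def)
  have "nbrs F (last ws) \<subseteq> {ws ! (n - 2), ws ! 0}"
  proof
    fix b assume b: "b \<in> nbrs F (last ws)"
    then have "b \<in> set ws" using ws by blast
    then obtain j where j: "j < n" "b = ws ! j" by (auto simp: in_set_conv_nth n_def)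
    have "b \<noteq> last ws" using b simple_graph_no_loop[OF s] by (auto simp: nbrs_def)
    then have "j \<noteq> n - 1" using l j by auto
    then have "Suc j < n" using j by auto
    then have "j = 0 \<or> Suc (Suc j) = n"
      using maximal_path_last_nbr[OF s ws(1), of j] c b j by (simp add: n_def)
    then show "b \<in> {ws ! (n - 2), ws ! 0}" using j by auto
  qed
  moreover have "card {ws ! (n - 2), ws ! 0} = 2"
    using d n3 by (simp add: nth_eq_iff_index_eq n_def)
  ultimately have nl: "nbrs F (ws ! (n - 1)) = {ws ! (n - 2), ws ! 0}"
    using c'[of "n - 1"] n0 l by (intro card_subset_eq) auto
  have "ws ! Suc 0 \<in> nbrs F (ws ! 0)" using ws n3 by (auto simp: path_in_def nbrs_def n_def)
  moreover have "ws ! 0 \<in> nbrs F (ws ! (n - 1))" using nl by simp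
  then have "ws ! (n - 1) \<in> nbrs F (ws ! 0)" by (simp add: nbrs_def insert_commute)
  ultimately have "{ws ! Suc 0, ws ! (n - 1)} \<subseteq> nbrs F (ws ! 0)" by simp
  moreover have "card {ws ! Suc 0, ws ! (n - 1)} = 2"
    using d n3 by (simp add: nth_eq_iff_index_eq n_def)
  ultimately have n0': "nbrs F (ws ! 0) = {ws ! Suc 0, ws ! (n - 1)}"
    using c'[of 0] n0 finite_nbrs[OF s] by (intro card_subset_eq[symmetric]) auto
  \<comment> \<open>One cyclic index formula for the first, last and interior positions, in the
    shape of \<open>cycle_graph\<close>.\<close>
  have nb: "nbrs F (ws ! i) = (\<lambda>j. ws ! j) ` {j. j < n \<and> (j = Suc i mod n \<or> i = Suc j mod n)}"
    if i: "i < n" for i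
  proof -
    consider "i = 0" | "i = n - 1" | "0 < i" "Suc i < n" using i by linarith
    then show ?thesis
    proof cases
      case 1
      then have "{j. j < n \<and> (j = Suc i mod n \<or> i = Suc j mod n)} = {Suc 0, n - 1}"
        using n3 by (auto simp: mod_Suc)
      then show ?thesis using 1 n0' by simp
    next
      case 2
      then have "{j. j < n \<and> (j = Suc i mod n \<or> i = Suc j mod n)} = {n - 2, 0}"
        using n3 by (auto simp: mod_Suc)
      then show ?thesis using 2 nl by simp
    next
      case 3
      then have "{j. j < n \<and> (j = Suc i mod n \<or> i = Suc j mod n)} = {i - 1, Suc i}"
        by (auto simp: mod_Suc)
      moreover have "nbrs F (ws ! i) = {ws ! (i - 1), ws ! Suc i}"
        by (rule nbrs_path_interior[OF s ws(1)]) (use 3 c' n_def in auto)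
      ultimately show ?thesis by simp
    qed
  qed
  show "\<forall>a\<in>set ws. nbrs F a \<subseteq> set ws"
  proof
    fix a assume a: "a \<in> set ws"
    obtain i where "i < n" "a = ws ! i" using a by (auto simp: in_set_conv_nth n_def)
    then show "nbrs F a \<subseteq> set ws" using nb[of i] by (auto simp: n_def)
  qed
  have E: "{ws ! i, ws ! j} \<in> edges F \<longleftrightarrow> j = Suc i mod n \<or> i = Suc j mod n" if "i < n" "j < n" for i j
  proof -
    have "{ws ! i, ws ! j} \<in> edges F \<longleftrightarrow> ws ! j \<in> nbrs F (ws ! i)" by (simp add: nbrs_def)
    also have "\<dots> \<longleftrightarrow> j \<in> {j. j < n \<and> (j = Suc i mod n \<or> i = Suc j mod n)}"
      unfolding nb[OF that(1)] using d(1) that(2)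
      by (intro inj_on_image_mem_iff[of _ "{..<n}"]) (auto simp: inj_on_def nth_eq_iff_index_eq n_def)
    finally show ?thesis using that by simp
  qed
  \<comment> \<open>Sides alternate along the cycle, and the edge from index \<open>n - 1\<close>
    back to 0 then forces \<open>n\<close> to be even.\<close>
  have "ws ! i \<in> X \<longleftrightarrow> (even i \<longleftrightarrow> ws ! 0 \<in> X)" if "i < n" for i
    using that
  proof (induction i)
    case (Suc i)
    then have "{ws ! i, ws ! Suc i} \<in> edges F" using E[of i "Suc i"] by simp
    then show ?case using bip[rule_format, of "ws ! i" "ws ! Suc i"] Suc by auto
  qed simp
  from this[of "n - 1"] have "even n"
    using bip[rule_format, of "ws ! (n - 1)" "ws ! 0"] E[of "n - 1" 0] n0 n3 by (cases n) auto
  moreover have "graph_iso (cycle_graph n) (induced_subgraph F (set ws))"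
    unfolding graph_iso_def
  proof (intro exI[of _ "\<lambda>i. ws ! i"] conjI ballI)
    show "bij_betw ((!) ws) (verts (cycle_graph n)) (verts (induced_subgraph F (set ws)))"
      using d by (simp add: cycle_graph_def induced_subgraph_def n_def bij_betw_nth)
    fix i j assume "i \<in> verts (cycle_graph n)" "j \<in> verts (cycle_graph n)"
    then have ij: "i < n" "j < n" by (auto simp: cycle_graph_def)
    have "{i, j} \<in> edges (cycle_graph n) \<longleftrightarrow> j = Suc i mod n \<or> i = Suc j mod n"
      using ij by (auto simp: cycle_graph_def doubleton_eq_iff)
    also have "\<dots> \<longleftrightarrow> {ws ! i, ws ! j} \<in> edges (induced_subgraph F (set ws))"
      using E[OF ij] ij by (simp add: induced_subgraph_def n_def)
    finally show "{i, j} \<in> edges (cycle_graph n) \<longleftrightarrow>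
        {ws ! i, ws ! j} \<in> edges (induced_subgraph F (set ws))" .
  qed
  then have "graph_iso (induced_subgraph F (set ws)) (cycle_graph n)" by (rule graph_iso_sym)
  moreover have "simple_graph (induced_subgraph F (set ws))"
    using s by (auto simp: simple_graph_def induced_subgraph_def)
  ultimately show "even_cycle (induced_subgraph F (set ws))"
    using n3 unfolding even_cycle_def by blast
qed

text \<open>Each cycle found is a whole component, so the rest is again 2-regular and induction on
  the number of vertices applies.\<close>

lemma two_regular_decomposition:
  assumes "simple_graph F" "\<And>v. v \<in> verts F \<Longrightarrow> card (nbrs F v) = 2"
    and "\<And>a b. {a, b} \<in> edges F \<Longrightarrow> a \<in> X \<longleftrightarrow> b \<notin> X"
  shows "\<exists>Cs. (\<forall>C\<in>set Cs. even_cycle C) \<and> is_disjoint_union F Cs"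
  using assms
proof (induction "card (verts F)" arbitrary: F rule: less_induct)
  case less
  note s = less.prems(1)
  show ?case
  proof (cases "verts F = {}")
    case True
    then have "edges F = {}" using s by (auto simp: simple_graph_def)
    then have "is_disjoint_union F []" using True by (simp add: is_disjoint_union_def)
    then show ?thesis by (intro exI[of _ "[]"]) simp
  next
    case False
    then obtain a where "a \<in> verts F" by blast
    then obtain ws where ws: "path_in F ws" "nbrs F (last ws) \<subseteq> set ws"
      using maximal_path_from[OF s] by metis
    have sub: "set ws \<subseteq> verts F" "ws \<noteq> []" using ws by (auto simp: path_in_def)
    have d2: "\<forall>v\<in>set ws. card (nbrs F v) = 2" using less.prems(2) sub by blast
    have "\<forall>a b. {a, b} \<in> edges F \<longrightarrow> (a \<in> X \<longleftrightarrow> b \<notin> X)" using less.prems(3) by simp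
    note comp = even_cycle_component[OF s ws d2 this]
    note rem = remove_closed[OF s comp(2)]
    let ?R = "remove_verts F (set ws)"
    have VR: "verts ?R = verts F - set ws" by (simp add: remove_verts_def)
    have "verts F - set ws \<subset> verts F" using sub by (cases ws) auto
    then have "card (verts ?R) < card (verts F)"
      unfolding VR using s by (intro psubset_card_mono) (auto simp: simple_graph_def)
    moreover have "card (nbrs ?R v) = 2" if "v \<in> verts ?R" for v
      using that rem(2) less.prems(2) unfolding VR by simp
    moreover have "a \<in> X \<longleftrightarrow> b \<notin> X" if "{a, b} \<in> edges ?R" for a b
      using that less.prems(3)[of a b] by (simp add: remove_verts_def)
    ultimately obtain Cs where Cs: "\<forall>C\<in>set Cs. even_cycle C" "is_disjoint_union ?R Cs"
      using less.hyps[OF _ rem(1)] by blast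
    have "is_disjoint_union F (induced_subgraph F (set ws) # Cs)"
      by (rule is_disjoint_union_Cons[OF Cs(2) sub(1) _ rem(3)]) (simp add: induced_subgraph_def)
    then show ?thesis using Cs(1) comp(1)
      by (intro exI[of _ "induced_subgraph F (set ws) # Cs"]) simp
  qed
qed

text \<open>Starting at a vertex of degree at most 1 keeps the maximal path from closing up, so it
  is an entire component and its far end has degree at most 1 as well.\<close>

lemma path_component:
  assumes s: "simple_graph F" and qs: "path_in F qs" "nbrs F (last qs) \<subseteq> set qs"
    and c: "\<forall>v\<in>set qs. card (nbrs F v) \<le> 2" and h: "card (nbrs F (hd qs)) \<le> 1"
  shows "a \<in> set qs \<Longrightarrow> nbrs F a = nbrs (path_of_list qs) a"
    and "card (nbrs F (last qs)) \<le> 1"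
proof -
  define n where "n = length qs"
  have d: "distinct qs" "qs \<noteq> []" using qs by (auto simp: path_in_def)
  have n0: "n > 0" using d by (simp add: n_def)
  have l: "last qs = qs ! (n - 1)" and hd: "hd qs = qs ! 0"
    using d by (auto simp: last_conv_nth hd_conv_nth n_def)
  have edge: "{qs ! i, qs ! Suc i} \<in> edges F" if "Suc i < n" for i
    using qs that by (simp add: path_in_def n_def)
  have eq: "qs ! i = qs ! j \<longleftrightarrow> i = j" if "i < n" "j < n" for i j
    using d that by (simp add: nth_eq_iff_index_eq n_def)
  have first: "nbrs F (qs ! 0) = {qs ! Suc 0}" if "n \<ge> 2"
  proof -
    have "{qs ! Suc 0} \<subseteq> nbrs F (qs ! 0)" using edge[of 0] that by (simp add: nbrs_def)
    then show ?thesis using card_seteq[OF finite_nbrs[OF s, of "qs ! 0"], of "{qs ! Suc 0}"] h hd by simp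
  qed
  have lastn: "nbrs F (last qs) \<subseteq> {qs ! (n - 2)} \<and> n \<ge> 2" if "nbrs F (last qs) \<noteq> {}"
  proof -
    have *: "Suc j < n \<and> Suc (Suc j) = n" if b: "qs ! j \<in> nbrs F (last qs)" "j < n" for j
    proof -
      have "j \<noteq> n - 1" using b l simple_graph_no_loop[OF s] by (auto simp: nbrs_def)
      then have j: "Suc j < n" using b by auto
      \<comment> \<open>The only neighbour of the first vertex is \<open>qs ! Suc 0\<close>, so the
        last vertex is adjacent to it only in a path of two vertices.\<close>
      have "\<not> (j = 0 \<and> Suc (Suc j) \<noteq> n)"
      proof
        assume "j = 0 \<and> Suc (Suc j) \<noteq> n"
        moreover have "last qs \<in> nbrs F (qs ! j)" using b by (simp add: nbrs_def insert_commute)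
        ultimately have "qs ! (n - 1) = qs ! Suc 0" "n \<noteq> 2" using first j l by auto
        then show False using eq[of "n - 1" "Suc 0"] j by auto
      qed
      then show ?thesis using maximal_path_last_nbr[OF s qs(1) c[rule_format], of j] j b by (auto simp: n_def)
    qed
    have "b \<in> {qs ! (n - 2)} \<and> n \<ge> 2" if b: "b \<in> nbrs F (last qs)" for b
    proof -
      have "b \<in> set qs" using b qs(2) by blast
      then obtain j where j: "j < n" "b = qs ! j" by (auto simp: in_set_conv_nth n_def)
      then have "Suc j < n \<and> Suc (Suc j) = n" using *[of j] b by simp
      then have "j = n - 2" "n \<ge> 2" by auto
      then show ?thesis using j by simp
    qed
    then show ?thesis using that by blast
  qed
  then have "nbrs F (last qs) \<subseteq> {qs ! (n - 2)}" by blast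
  then have "card (nbrs F (last qs)) \<le> card {qs ! (n - 2)}" by (intro card_mono) simp
  then show "card (nbrs F (last qs)) \<le> 1" by simp
  assume "a \<in> set qs"
  then obtain i where i: "i < n" "a = qs ! i" by (auto simp: in_set_conv_nth n_def)
  have P: "nbrs (path_of_list qs) a = (\<lambda>j. qs ! j) ` {j. j < n \<and> (j = Suc i \<or> i = Suc j)}"
    unfolding i(2) n_def using d(1) i(1) by (intro nbrs_path_of_list) (simp_all add: n_def)
  consider "n = 1" | "i = 0" "n \<ge> 2" | "i = n - 1" "n \<ge> 2" | "0 < i" "Suc i < n" using i by linarith
  then show "nbrs F a = nbrs (path_of_list qs) a"
  proof cases
    case 1
    then have "nbrs F (last qs) = {}" using lastn by force
    moreover have "a = last qs" using 1 i l by simp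
    moreover have "{j. j < n \<and> (j = Suc i \<or> i = Suc j)} = {}" using 1 i by auto
    ultimately show ?thesis unfolding P by simp
  next
    case 2
    then have "{j. j < n \<and> (j = Suc i \<or> i = Suc j)} = {Suc 0}" by auto
    then show ?thesis unfolding P using first 2 i by simp
  next
    case 3
    then have "{j. j < n \<and> (j = Suc i \<or> i = Suc j)} = {n - 2}" by auto
    moreover have "{qs ! (n - 2), qs ! Suc (n - 2)} \<in> edges F" using edge 3 by simp
    then have "qs ! (n - 2) \<in> nbrs F (last qs)"
      using 3 l by (simp add: nbrs_def insert_commute Suc_diff_Suc numeral_2_eq_2)
    then have "nbrs F (last qs) = {qs ! (n - 2)}" using lastn by blast
    ultimately show ?thesis unfolding P using 3 i l by simp
  next
    case 4
    then have "{j. j < n \<and> (j = Suc i \<or> i = Suc j)} = {i - 1, Suc i}" by auto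
    moreover have "nbrs F (qs ! i) = {qs ! (i - 1), qs ! Suc i}"
      by (rule nbrs_path_interior[OF s qs(1)]) (use 4 c i n_def in auto)
    ultimately show ?thesis unfolding P using i by simp
  qed
qed

lemma graph_iso_path_of_list:
  assumes "distinct qs" shows "graph_iso (path_of_list qs) (path_graph (length qs))"
proof -
  have "graph_iso (path_graph (length qs)) (path_of_list qs)"
    unfolding graph_iso_def
  proof (intro exI[of _ "\<lambda>i. qs ! i"] conjI ballI)
    show "bij_betw ((!) qs) (verts (path_graph (length qs))) (verts (path_of_list qs))"
      using assms by (simp add: path_graph_def path_of_list_def bij_betw_nth lessThan_atLeast0)
    fix i j assume "i \<in> verts (path_graph (length qs))" "j \<in> verts (path_graph (length qs))"
    then have "i < length qs" "j < length qs" by (auto simp: path_graph_def path_of_list_def)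
    then show "{i, j} \<in> edges (path_graph (length qs)) \<longleftrightarrow> {qs ! i, qs ! j} \<in> edges (path_of_list qs)"
      using edges_path_of_list_nth[of "[0..<length qs]" i j] edges_path_of_list_nth[OF assms, of i j]
      by (simp add: path_graph_def)
  qed
  then show ?thesis by (rule graph_iso_sym)
qed

text \<open>The degrees over X sum to 2 |X| < 2 |Y|, so some vertex of Y has degree at most 1, and
  the maximal path from it is the component Q. Its far end also has degree at most 1, hence lies in
  Y. A second count on the rest leaves only vertices of degree 2.\<close>

lemma path_cycles_decomposition:
  assumes s: "simple_graph F" and V: "verts F = X \<union> Y" and dj: "X \<inter> Y = {}"
    and c: "card Y = Suc (card X)"
    and bip: "\<And>a b. {a, b} \<in> edges F \<Longrightarrow> a \<in> X \<longleftrightarrow> b \<notin> X"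
    and dX: "\<And>x. x \<in> X \<Longrightarrow> card (nbrs F x) = 2" and dY: "\<And>y. y \<in> Y \<Longrightarrow> card (nbrs F y) \<le> 2"
  shows "\<exists>qs Cs. distinct qs \<and> qs \<noteq> [] \<and> hd qs \<in> Y \<and> last qs \<in> Y \<and> (\<forall>C\<in>set Cs. even_cycle C) \<and>
    is_disjoint_union F (path_of_list qs # Cs)"
proof -
  have fin: "finite X" "finite Y" using s V by (auto simp: simple_graph_def)
  have nX: "nbrs F x \<subseteq> Y" if "x \<in> X" for x
  proof
    fix b assume "b \<in> nbrs F x"
    then have "{x, b} \<in> edges F" by (simp add: nbrs_def)
    then show "b \<in> Y" using bip[of x b] that simple_graph_edgeD(2)[OF s] V by blast
  qed
  have nY: "nbrs F y \<subseteq> X" if "y \<in> Y" for y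
  proof
    fix b assume "b \<in> nbrs F y"
    then have "{y, b} \<in> edges F" by (simp add: nbrs_def)
    then show "b \<in> X" using bip[of y b] that dj by blast
  qed
  have d2: "card (nbrs F v) \<le> 2" if "v \<in> verts F" for v using that V dX[of v] dY[of v] by auto
  have "\<exists>y\<in>Y. card (nbrs F y) \<le> 1"
  proof (rule ccontr)
    assume none: "\<not> (\<exists>y\<in>Y. card (nbrs F y) \<le> 1)"
    have "(\<Sum>x\<in>X. card {y \<in> Y. {x, y} \<in> edges F}) = 2 * card Y"
    proof (rule sum_multicount[OF fin], rule ballI)
      fix y assume y: "y \<in> Y"
      have "{x \<in> X. {x, y} \<in> edges F} = nbrs F y"
        using nY[OF y] unfolding nbrs_altdef by auto
      then show "card {x \<in> X. {x, y} \<in> edges F} = 2" using none dY[OF y] y by fastforce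
    qed
    moreover have "(\<Sum>x\<in>X. card {y \<in> Y. {x, y} \<in> edges F}) = (\<Sum>x\<in>X. 2)"
    proof (rule sum.cong)
      fix x assume x: "x \<in> X"
      have "{y \<in> Y. {x, y} \<in> edges F} = nbrs F x" using nX[OF x] by (auto simp: nbrs_def)
      then show "card {y \<in> Y. {x, y} \<in> edges F} = 2" using dX[OF x] by simp
    qed simp
    ultimately show False using c by simp
  qed
  then obtain y where y: "y \<in> Y" "card (nbrs F y) \<le> 1" by blast
  then have "y \<in> verts F" using V by simp
  then obtain qs where qs: "path_in F qs" "hd qs = y" "nbrs F (last qs) \<subseteq> set qs"
    by (rule maximal_path_from[OF s])
  have q: "distinct qs" "qs \<noteq> []" "set qs \<subseteq> X \<union> Y" using qs V by (auto simp: path_in_def)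
  have q2: "\<forall>v\<in>set qs. card (nbrs F v) \<le> 2" using d2 q V by blast
  have "card (nbrs F (hd qs)) \<le> 1" using y(2) qs(2) by simp
  note comp = path_component[OF s qs(1,3) q2 this]
  have lastY: "last qs \<in> Y" using comp(2) dX[of "last qs"] q last_in_set[OF q(2)] by fastforce
  have "nbrs F a \<subseteq> set qs" if "a \<in> set qs" for a
  proof -
    have "nbrs (path_of_list qs) a \<subseteq> set qs"
      by (auto simp: nbrs_def edges_path_of_list doubleton_eq_iff)
    then show ?thesis using comp(1)[OF that] by simp
  qed
  then have closed: "\<forall>a\<in>set qs. nbrs F a \<subseteq> set qs" by blast
  note rem = remove_closed[OF s closed]
  let ?R = "remove_verts F (set qs)"
  have "edges (induced_subgraph F (set qs)) = edges (path_of_list qs)"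
  proof (intro equalityI subsetI)
    fix e assume "e \<in> edges (induced_subgraph F (set qs))"
    then have e: "e \<in> edges F" "e \<subseteq> set qs" by (auto simp: induced_subgraph_def)
    then obtain a b where ab: "e = {a, b}" using simple_graph_edgeE[OF s, of e] by metis
    then have "a \<in> set qs" "b \<in> nbrs F a" using e by (auto simp: nbrs_def)
    then have "b \<in> nbrs (path_of_list qs) a" using comp(1) by blast
    then show "e \<in> edges (path_of_list qs)" using ab by (simp add: nbrs_def)
  next
    fix e assume "e \<in> edges (path_of_list qs)"
    then show "e \<in> edges (induced_subgraph F (set qs))"
      using qs(1) by (auto simp: path_of_list_def path_in_def induced_subgraph_def)
  qed
  then have edges: "edges F = edges (path_of_list qs) \<union> edges ?R" using rem(3) by simp
  have VR: "verts ?R = (X - set qs) \<union> (Y - set qs)" using V by (auto simp: remove_verts_def)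
  have nR: "nbrs ?R v = nbrs F v" "nbrs F v \<inter> set qs = {}" if "v \<in> verts ?R" for v
  proof -
    show *: "nbrs ?R v = nbrs F v" by (rule rem(2)) (use that VR in auto)
    have "nbrs ?R v \<inter> set qs = {}" by (auto simp: nbrs_def remove_verts_def)
    then show "nbrs F v \<inter> set qs = {}" using * by simp
  qed
  \<comment> \<open>The path avoids consecutive vertices of \<open>X\<close> and has both ends in
    \<open>Y\<close>, so it uses up the surplus vertex of \<open>Y\<close>.\<close>
  have cYX: "card (Y - set qs) \<le> card (X - set qs)"
  proof -
    have "successively (\<lambda>a b. \<not> (a \<in> X \<and> b \<in> X)) qs"
      using qs(1) bip by (auto simp: path_in_def successively_conv_nth)
    from alternating_count[OF this q(2)]
    have "length (filter (\<lambda>x. x \<in> X) qs) + 1 \<le> length (filter (\<lambda>x. x \<notin> X) qs)"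
      using qs(2) y(1) lastY dj by (auto simp: of_bool_def split: if_splits)
    moreover have "length (filter (\<lambda>x. x \<in> X) qs) = card (X \<inter> set qs)"
      using q by (subst distinct_card[symmetric]) (auto intro!: arg_cong[of _ _ card])
    moreover have "length (filter (\<lambda>x. x \<notin> X) qs) = card (Y \<inter> set qs)"
      using q dj by (subst distinct_card[symmetric]) (auto intro!: arg_cong[of _ _ card])
    moreover have "card (X - set qs) + card (X \<inter> set qs) = card X"
      "card (Y - set qs) + card (Y \<inter> set qs) = card Y"
      using fin by (simp_all add: card_Diff_subset_Int card_mono)
    ultimately show ?thesis using c by linarith
  qed
  have sumY: "(\<Sum>y\<in>Y - set qs. card (nbrs F y)) = 2 * card (X - set qs)"
  proof -
    have "(\<Sum>y\<in>Y - set qs. card {x \<in> X - set qs. {x, y} \<in> edges F}) = 2 * card (X - set qs)"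
    proof (rule sum_multicount)
      show "finite (Y - set qs)" "finite (X - set qs)" using fin by simp_all
      show "\<forall>x\<in>X - set qs. card {y \<in> Y - set qs. {x, y} \<in> edges F} = 2"
      proof
        fix x assume x: "x \<in> X - set qs"
        have "{y \<in> Y - set qs. {x, y} \<in> edges F} = nbrs F x"
          using nX[of x] nR(2)[of x] x VR by (auto simp: nbrs_def)
        then show "card {y \<in> Y - set qs. {x, y} \<in> edges F} = 2" using dX x by simp
      qed
    qed
    moreover have "card {x \<in> X - set qs. {x, y} \<in> edges F} = card (nbrs F y)" if "y \<in> Y - set qs" for y
    proof -
      have "{x \<in> X - set qs. {x, y} \<in> edges F} = nbrs F y"
        using nY[of y] nR(2)[of y] that VR unfolding nbrs_altdef by auto
      then show ?thesis by simp
    qed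
    ultimately show ?thesis by simp
  qed
  \<comment> \<open>The degrees over the rest of \<open>Y\<close> sum to twice the size of the rest
    of \<open>X\<close>, so to at least twice their own number; as none exceeds 2, all equal
    2.\<close>
  have dY2: "card (nbrs F y) = 2" if "y \<in> Y - set qs" for y
  proof (rule ccontr)
    assume "card (nbrs F y) \<noteq> 2"
    then have "card (nbrs F y) < 2" using dY[of y] that by force
    then have "(\<Sum>y\<in>Y - set qs. card (nbrs F y)) < (\<Sum>y\<in>Y - set qs. 2)"
      using dY that fin by (intro sum_strict_mono_ex1) auto
    then show False using sumY cYX by simp
  qed
  have "\<exists>Cs. (\<forall>C\<in>set Cs. even_cycle C) \<and> is_disjoint_union ?R Cs"
  proof (rule two_regular_decomposition[OF rem(1)])
    fix v assume v: "v \<in> verts ?R"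
    show "card (nbrs ?R v) = 2" unfolding nR(1)[OF v] using v VR dX dY2 by auto
  next
    fix a b assume "{a, b} \<in> edges ?R"
    then show "a \<in> X \<longleftrightarrow> b \<notin> X" using bip[of a b] by (simp add: remove_verts_def)
  qed
  then obtain Cs where Cs: "\<forall>C\<in>set Cs. even_cycle C" "is_disjoint_union ?R Cs" by blast
  have "is_disjoint_union F (path_of_list qs # Cs)"
    by (rule is_disjoint_union_Cons[OF Cs(2) _ _ edges]) (use q V in \<open>auto simp: path_of_list_def\<close>)
  then show ?thesis using q Cs(1) y(1) qs(2) lastY by blast
qed

text \<open>F is the bipartite complement on \<open>X \<union> Y0\<close>; leaving out
  \<open>u\<close> loses nothing because \<open>u\<close> is adjacent to all of X. For
  \<open>card X = 3\<close> the Hamilton path, not just the degrees, pins F down.\<close>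

lemma bipartite_form_family_G:
  assumes s: "simple_graph H" and form: "bipartite_form H X Y u"
  shows "H \<in> family_G"
proof -
  note D = bipartite_formD[OF form]
  define Y0 where "Y0 = Y - {u}"
  define F where "F = \<lparr>verts = X \<union> Y0, edges = {{x, y} | x y. x \<in> X \<and> y \<in> Y0 \<and> {x, y} \<notin> edges H}\<rparr>"
  have fin: "finite X" "finite Y" "finite Y0" using D(1) s by (auto simp: simple_graph_def Y0_def)
  have dj: "X \<inter> Y0 = {}" using D(2) by (auto simp: Y0_def)
  have c: "card Y0 = Suc (card X)" using D(3,5) fin by (simp add: Y0_def)
  have FE: "{a, b} \<in> edges F \<longleftrightarrow> ((a \<in> X \<and> b \<in> Y0) \<or> (a \<in> Y0 \<and> b \<in> X)) \<and> {a, b} \<notin> edges H" for a b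
  proof
    assume "{a, b} \<in> edges F"
    then obtain x y where "{a, b} = {x, y}" "x \<in> X" "y \<in> Y0" "{x, y} \<notin> edges H"
      by (auto simp: F_def)
    then show "((a \<in> X \<and> b \<in> Y0) \<or> (a \<in> Y0 \<and> b \<in> X)) \<and> {a, b} \<notin> edges H"
      by (metis doubleton_eq_iff)
  next
    assume "((a \<in> X \<and> b \<in> Y0) \<or> (a \<in> Y0 \<and> b \<in> X)) \<and> {a, b} \<notin> edges H"
    then obtain x y where "{a, b} = {x, y}" "x \<in> X" "y \<in> Y0" "{x, y} \<notin> edges H"
      by (metis insert_commute)
    then show "{a, b} \<in> edges F" unfolding F_def by auto
  qed
  have sF: "simple_graph F"
    unfolding simple_graph_def
  proof (intro conjI ballI)
    show "finite (verts F)" using fin by (simp add: F_def)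
    fix e assume "e \<in> edges F"
    then obtain x y where "e = {x, y}" "x \<in> X" "y \<in> Y0" by (auto simp: F_def)
    moreover from this have "x \<noteq> y" using dj by auto
    ultimately show "e \<subseteq> verts F" "card e = 2" by (auto simp: F_def)
  qed
  have nX: "nbrs F x = {y \<in> Y. {x, y} \<notin> edges H}" if "x \<in> X" for x
    using that dj D(8)[OF that] unfolding nbrs_def FE by (auto simp: Y0_def)
  have nY: "nbrs F y = {x \<in> X. {x, y} \<notin> edges H}" if "y \<in> Y0" for y
    using that dj unfolding nbrs_def FE by (auto simp: insert_commute[of y])
  have dX: "card (nbrs F x) = 2" if "x \<in> X" for x using nX D(9) that by simp
  have dY: "card (nbrs F y) \<le> 2" if "y \<in> Y0" for y using nY D(10) that by (simp add: Y0_def)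
  have sp: "spanning_subgraph F (complete_bipartite X Y0)"
    by (auto simp: spanning_subgraph_def F_def complete_bipartite_def)
  have HG: "H = G_of X Y F"
  proof -
    have E: "{a, b} \<in> edges H \<longleftrightarrow> {a, b} \<in> edges (G_of X Y F)" for a b
    proof
      assume ab: "{a, b} \<in> edges H"
      then have "a \<in> X \<union> Y" "b \<in> X \<union> Y" using simple_graph_edgeD[OF s ab] D(1) by auto
      then show "{a, b} \<in> edges (G_of X Y F)"
        using ab D(6)[of a b] D(7)[of a b] unfolding edges_G_of FE by blast
    next
      assume "{a, b} \<in> edges (G_of X Y F)"
      then have *: "(a \<in> X \<and> b \<in> Y) \<or> (a \<in> Y \<and> b \<in> X)" "{a, b} \<notin> edges F"
        unfolding edges_G_of by auto
      show "{a, b} \<in> edges H"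
      proof (cases "a = u \<or> b = u")
        case True
        then show ?thesis using * D(2,5) D(8)[of a] D(8)[of b] by (auto simp: insert_commute)
      next
        case False
        then show ?thesis using * unfolding FE Y0_def by blast
      qed
    qed
    have "edges H = edges (G_of X Y F)"
    proof (intro equalityI subsetI)
      fix e assume e: "e \<in> edges H"
      then obtain a b where "e = {a, b}" using simple_graph_edgeE[OF s, of e] by metis
      then show "e \<in> edges (G_of X Y F)" using E e by simp
    next
      fix e assume e: "e \<in> edges (G_of X Y F)"
      then obtain a b where "e = {a, b}" by (auto simp: G_of_def complete_bipartite_def)
      then show "e \<in> edges H" using E e by simp
    qed
    then show ?thesis using D(1) by (simp add: G_of_def)
  qed
  have "F \<in> family_F (card X) X Y0"
  proof (cases "card X = 3")
    case False
    have "\<exists>qs Cs. distinct qs \<and> qs \<noteq> [] \<and> hd qs \<in> Y0 \<and> last qs \<in> Y0 \<and>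
      (\<forall>C\<in>set Cs. even_cycle C) \<and> is_disjoint_union F (path_of_list qs # Cs)"
    proof (rule path_cycles_decomposition[OF sF _ dj c])
      show "verts F = X \<union> Y0" by (simp add: F_def)
      fix a b assume "{a, b} \<in> edges F"
      then show "a \<in> X \<longleftrightarrow> b \<notin> X" using dj unfolding FE by blast
    qed (rule dX dY; assumption)+
    then obtain qs Cs where q: "distinct qs" "qs \<noteq> []" "hd qs \<in> Y0" "last qs \<in> Y0"
      "\<forall>C\<in>set Cs. even_cycle C" "is_disjoint_union F (path_of_list qs # Cs)" by blast
    have "length qs \<ge> 2 \<and> hd qs \<in> Y0 \<and> last qs \<in> Y0 \<or> (\<exists>y\<in>Y0. qs = [y])"
    proof (cases qs)
      case (Cons y ys)
      then show ?thesis using q by (cases ys) auto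
    qed (use q in simp)
    then show ?thesis using sp False q by (auto simp: family_F_def)
  next
    case True
    obtain ws where ws: "path_in H ws" "set ws = verts H - {u}"
      using form by (auto simp only: bipartite_form_def)
    have d: "distinct ws" "ws \<noteq> []" and S: "set ws = X \<union> Y0"
      using ws D(1,2,5) by (auto simp: path_in_def Y0_def)
    have "card (X \<union> Y0) = 7" using fin dj c True by (simp add: card_Un_disjoint)
    then have "length ws = 7" using d S by (metis distinct_card)
    then obtain y0 x1 y1 x2 y2 x3 y3 where w: "ws = [y0, x1, y1, x2, y2, x3, y3]"
      by (rule distinct_length7)
    have e: "{y0, x1} \<in> edges H" "{x1, y1} \<in> edges H" "{y1, x2} \<in> edges H" "{x2, y2} \<in> edges H"
      "{y2, x3} \<in> edges H" "{x3, y3} \<in> edges H"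
      using ws(1) by (auto simp: path_in_iff w)
    have ends: "hd ws \<in> Y0" "last ws \<in> Y0"
    proof -
      have "successively (\<lambda>a b. \<not> (a \<in> Y0 \<and> b \<in> Y0)) ws"
        using ws(1) D(7) by (auto simp: path_in_def successively_conv_nth Y0_def)
      from alternating_ends[OF d S dj fin(1,3) c this] show "hd ws \<in> Y0" "last ws \<in> Y0" .
    qed
    have alt: "b \<in> (if a \<in> X then Y0 else X)" if "{a, b} \<in> edges H" "a \<in> set ws" "b \<in> set ws" for a b
      using that S D(6)[of a b] D(7)[of a b] by (auto simp: Y0_def)
    have m: "y0 \<in> Y0" "x1 \<in> X" "y1 \<in> Y0" "x2 \<in> X" "y2 \<in> Y0" "x3 \<in> X" "y3 \<in> Y0"
    proof -
      show 1: "y0 \<in> Y0" using ends w by simp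
      show 2: "x1 \<in> X" using alt[OF e(1)] 1 dj w by (auto split: if_splits)
      show 3: "y1 \<in> Y0" using alt[OF e(2)] 2 dj w by (auto split: if_splits)
      show 4: "x2 \<in> X" using alt[OF e(3)] 3 dj w by (auto split: if_splits)
      show 5: "y2 \<in> Y0" using alt[OF e(4)] 4 dj w by (auto split: if_splits)
      show 6: "x3 \<in> X" using alt[OF e(5)] 5 dj w by (auto split: if_splits)
      show 7: "y3 \<in> Y0" using alt[OF e(6)] 6 dj w by (auto split: if_splits)
    qed
    have XY: "X = {x1, x2, x3}" "Y0 = {y0, y1, y2, y3}"
    proof -
      have S': "X \<union> Y0 = {y0, x1, y1, x2, y2, x3, y3}" using S w by auto
      have n: "y0 \<notin> X" "y1 \<notin> X" "y2 \<notin> X" "y3 \<notin> X" "x1 \<notin> Y0" "x2 \<notin> Y0" "x3 \<notin> Y0"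
        using m dj by auto
      have "X \<subseteq> {y0, x1, y1, x2, y2, x3, y3}" "Y0 \<subseteq> {y0, x1, y1, x2, y2, x3, y3}"
        using S' by auto
      then have "X \<subseteq> {x1, x2, x3}" "Y0 \<subseteq> {y0, y1, y2, y3}"
        using n by (auto simp only: subset_insert)
      then show "X = {x1, x2, x3}" "Y0 = {y0, y1, y2, y3}" using m by (simp_all add: equalityI)
    qed
    \<comment> \<open>A vertex of \<open>X\<close> has two neighbours on the Hamilton path and two
      non-neighbours among the four vertices of \<open>Y0\<close>, so the latter are the other
      two.\<close>
    have N: "nbrs F x = {a, b}"
      if "x \<in> X" "Y0 = {a, b, a', b'}" "a \<noteq> b" "{x, a'} \<in> edges H" "{x, b'} \<in> edges H" for x a b a' b'
    proof -
      have "nbrs F x \<subseteq> {a, b}"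
        using that(1,2,4,5) dj unfolding nbrs_def FE by auto
      then show ?thesis using dX[OF that(1)] that(3) by (intro card_subset_eq) auto
    qed
    have dw: "distinct [y0, x1, y1, x2, y2, x3, y3]" using d w by simp
    have n: "nbrs F x1 = {y2, y3}" "nbrs F x2 = {y0, y3}" "nbrs F x3 = {y0, y1}"
    proof -
      show "nbrs F x1 = {y2, y3}"
        by (rule N[of _ _ _ y0 y1]) (use m XY dw e in \<open>auto simp: insert_commute\<close>)
      show "nbrs F x2 = {y0, y3}"
        by (rule N[of _ _ _ y1 y2]) (use m XY dw e in \<open>auto simp: insert_commute\<close>)
      show "nbrs F x3 = {y0, y1}"
        by (rule N[of _ _ _ y2 y3]) (use m XY dw e in \<open>auto simp: insert_commute\<close>)
    qed
    \<comment> \<open>Read off from the three neighbourhoods: \<open>y1\<close> and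
      \<open>y2\<close> occur in only one of them and are therefore the ends.\<close>
    define qs where "qs = [y1, x3, y0, x2, y3, x1, y2]"
    have dq: "distinct qs" "length qs = 7" using dw by (auto simp: qs_def)
    have "edges F = (\<Union>x\<in>X. (\<lambda>y. {x, y}) ` nbrs F x)"
    proof (intro equalityI subsetI)
      fix e assume e: "e \<in> edges F"
      then obtain x y where "e = {x, y}" "x \<in> X" by (auto simp: F_def)
      then show "e \<in> (\<Union>x\<in>X. (\<lambda>y. {x, y}) ` nbrs F x)" using e by (auto simp: nbrs_def)
    qed (auto simp: nbrs_def)
    also have "\<dots> = {{x3, y0}, {x3, y1}, {x2, y0}, {x2, y3}, {x1, y2}, {x1, y3}}"
      by (simp add: XY(1) n)
    also have "\<dots> = (\<lambda>i. {qs ! i, qs ! Suc i}) ` {0, 1, 2, 3, 4, 5}"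
      by (simp add: qs_def insert_commute)
    also have "{0, 1, 2, 3, 4, 5} = {i. Suc i < length qs}" using dq by auto
    finally have "edges F = edges (path_of_list qs)" by (auto simp add: path_of_list_def)
    moreover have "verts F = verts (path_of_list qs)"
      using XY by (auto simp: F_def path_of_list_def qs_def)
    ultimately have "F = path_of_list qs" by simp
    then have "graph_iso F (path_graph 7)" using graph_iso_path_of_list[OF dq(1)] dq(2) by simp
    then show ?thesis using sp True by (simp add: family_F_def)
  qed
  then have "H \<in> family_G_at (card X)"
    unfolding family_G_at_def using HG fin D(2,3,5) Y0_def by blast
  then show ?thesis using D(4) by (auto simp: family_G_def)
qed

section \<open>Components off a longest path\<close>

lemma connected_graph_closed:
  assumes conn: "connected_graph G" and a: "a \<in> verts G" "a \<in> A"
    and closed: "\<And>x y. x \<in> A \<Longrightarrow> {x, y} \<in> edges G \<Longrightarrow> y \<in> A"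
  shows "verts G \<subseteq> A"
proof
  fix b assume "b \<in> verts G"
  then obtain xs where xs: "path_in G xs" "hd xs = a" "last xs = b"
    using conn a by (auto simp: connected_graph_def)
  have "xs ! i \<in> A" if "i < length xs" for i
    using that
  proof (induction i)
    case 0
    then show ?case using xs a by (simp add: hd_conv_nth)
  next
    case (Suc i)
    then show ?case using xs(1) closed[of "xs ! i" "xs ! Suc i"] by (simp add: path_in_def)
  qed
  from this[of "length xs - 1"] show "b \<in> A" using xs by (simp add: last_conv_nth path_in_def)
qed

lemma top_vertex_degree:
  assumes "simple_graph G" "top_vertex G v" "w \<in> verts G"
  shows "degree G w \<le> degree G v"
  using assms by (simp add: top_vertex_def max_degree_def simple_graph_def)

lemma clique_successively:
  assumes "distinct xs" "\<And>p q. p \<in> set xs \<Longrightarrow> q \<in> set xs \<Longrightarrow> p \<noteq> q \<Longrightarrow> R p q"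
  shows "successively R xs"
  using assms by (auto simp: successively_conv_nth nth_eq_iff_index_eq)

text \<open>\<open>C_conn\<close> and \<open>C_closed\<close> make a nonempty C a component of G -
  P. Connectivity is stated through paths inside C because these are the pieces to be inserted into
  P.\<close>

locale off_path_component =
  fixes G :: "'a ugraph" and P :: "'a list" and C :: "'a set"
  assumes simple: "simple_graph G" and longest: "longest_path G P"
    and free: "\<And>a b T. \<not> three_isolated G a b T"
    and C_sub: "C \<subseteq> verts G - set P"
    and C_conn: "\<And>c c'. c \<in> C \<Longrightarrow> c' \<in> C \<Longrightarrow>
      \<exists>Q. path_in G Q \<and> set Q \<subseteq> C \<and> hd Q = c \<and> last Q = c'"
    and C_closed: "\<And>c w. c \<in> C \<Longrightarrow> {c, w} \<in> edges G \<Longrightarrow> w \<notin> set P \<Longrightarrow> w \<in> C"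
begin

text \<open>Arguments are given for successors on P; reversal transfers them to predecessors and to
  the other end.\<close>

lemma rev_component: "off_path_component G (rev P) C"
  using simple longest_path_rev[OF longest] free C_sub C_conn C_closed
  by unfold_locales auto

definition att :: "'a \<Rightarrow> bool" where
  "att x \<longleftrightarrow> (\<exists>c\<in>C. {c, x} \<in> edges G)"

lemma att_sym: "att x \<longleftrightarrow> (\<exists>c\<in>C. {x, c} \<in> edges G)"
  unfolding att_def by (simp add: insert_commute)

lemma path_P: "P \<noteq> []" "distinct P" "set P \<subseteq> verts G" "successively (\<lambda>a b. {a, b} \<in> edges G) P"
  using longest by (auto simp: longest_path_def path_in_iff)

lemma path_le: "path_in G T \<Longrightarrow> length T \<le> length P"
  using longest by (simp add: longest_path_def)

lemma edge_commute: "{a, b} \<in> edges G \<Longrightarrow> {b, a} \<in> edges G"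
  by (simp add: insert_commute)

lemma rev_successively:
  "successively (\<lambda>a b. {b, a} \<in> edges G) xs \<longleftrightarrow> successively (\<lambda>a b. {a, b} \<in> edges G) xs"
  by (simp add: insert_commute)

lemma not_att_hd: "\<not> att (hd P)"
proof
  assume "att (hd P)"
  then obtain c where "c \<in> C" "{c, hd P} \<in> edges G" by (auto simp: att_def)
  then have "path_in G (c # P)" using path_P C_sub by (auto simp: path_in_iff successively_Cons)
  from path_le[OF this] show False by simp
qed

text \<open>\<open>hd bs\<close> and \<open>hd cs\<close> are the successors of two attachment
  vertices. If they were adjacent, then \<open>as\<close>, a path through C, \<open>rev bs\<close>
  and \<open>cs\<close> would form a longer path.\<close>

lemma no_rotation:
  assumes P: "P = as @ bs @ cs" and ne: "as \<noteq> []" "bs \<noteq> []" "cs \<noteq> []"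
    and at: "att (last as)" "att (last bs)"
  shows "{hd bs, hd cs} \<notin> edges G"
proof
  assume e: "{hd bs, hd cs} \<in> edges G"
  obtain c c' where c: "c \<in> C" "{last as, c} \<in> edges G" "c' \<in> C" "{c', last bs} \<in> edges G"
    using at(1) at(2) att_sym att_def by metis
  then obtain Q where Q: "path_in G Q" "set Q \<subseteq> C" "hd Q = c" "last Q = c'" using C_conn by blast
  have "path_in G (as @ Q @ rev bs @ cs)"
    using path_P Q c e ne C_sub unfolding P
    by (auto simp: path_in_iff successively_append_iff rev_successively hd_rev last_rev)
  from path_le[OF this] show False using Q by (simp add: P path_in_def)
qed

text \<open>The first vertex of P acts like one more successor: a vertex of C, \<open>rev bs\<close>
  and \<open>cs\<close> would form a longer path.\<close>

lemma no_rotation_hd: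
  assumes P: "P = bs @ cs" and ne: "bs \<noteq> []" "cs \<noteq> []" and at: "att (last bs)"
  shows "{hd bs, hd cs} \<notin> edges G"
proof
  assume e: "{hd bs, hd cs} \<in> edges G"
  obtain c where c: "c \<in> C" "{c, last bs} \<in> edges G" using at by (auto simp: att_def)
  have "path_in G (c # rev bs @ cs)"
    using path_P c e ne C_sub unfolding P
    by (auto simp: path_in_iff successively_append_iff successively_Cons rev_successively hd_rev last_rev)
  from path_le[OF this] show False by (simp add: P)
qed

text \<open>Otherwise a path through C could be inserted between two consecutive vertices of
  P.\<close>

lemma no_detour:
  assumes P: "P = as @ cs" and ne: "as \<noteq> []" "cs \<noteq> []" and at: "att (last as)"
  shows "\<not> att (hd cs)"
proof
  assume "att (hd cs)"
  then obtain c c' where c: "c \<in> C" "{last as, c} \<in> edges G" "c' \<in> C" "{c', hd cs} \<in> edges G"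
    using at att_sym att_def by metis
  then obtain Q where Q: "path_in G Q" "set Q \<subseteq> C" "hd Q = c" "last Q = c'" using C_conn by blast
  have "path_in G (as @ Q @ cs)"
    using path_P Q c ne C_sub unfolding P by (auto simp: path_in_iff successively_append_iff)
  from path_le[OF this] show False using Q by (simp add: P path_in_def)
qed

lemma att_index:
  assumes "i < length P" "att (P ! i)"
  shows "0 < i" "Suc i < length P"
proof -
  show "0 < i" using not_att_hd assms path_P(1) by (cases i) (auto simp: hd_conv_nth)
  interpret rev: off_path_component G "rev P" C by (rule rev_component)
  have "\<not> att (last P)"
    using rev.not_att_hd unfolding rev.att_def att_def by (simp add: hd_rev)
  then have "i \<noteq> length P - 1" using assms path_P(1) by (auto simp: last_conv_nth)
  then show "Suc i < length P" using assms by auto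
qed

lemma att_Suc:
  assumes "Suc i < length P" "att (P ! i)"
  shows "\<not> att (P ! Suc i)"
proof -
  have "last (take (Suc i) P) = P ! i" "take (Suc i) P \<noteq> []" "drop (Suc i) P \<noteq> []"
    using assms by (auto simp: take_Suc_conv_app_nth)
  then have "\<not> att (hd (drop (Suc i) P))"
    using no_detour[OF append_take_drop_id[symmetric], of "Suc i"] assms by simp
  then show ?thesis using assms by (simp add: hd_drop_conv_nth)
qed

lemma att_succ_nonadjacent:
  assumes "i < j" "Suc j < length P" "att (P ! i)" "att (P ! j)"
  shows "{P ! Suc i, P ! Suc j} \<notin> edges G"
proof -
  let ?as = "take (Suc i) P" and ?bs = "take (j - i) (drop (Suc i) P)" and ?cs = "drop (Suc j) P"
  have "drop (Suc i) P = ?bs @ drop (j - i) (drop (Suc i) P)"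
    by (rule append_take_drop_id[symmetric])
  moreover have "drop (j - i) (drop (Suc i) P) = ?cs" using assms by simp
  ultimately have "P = ?as @ ?bs @ ?cs" by (metis append_take_drop_id)
  moreover have "hd ?bs = P ! Suc i" using assms by (simp add: hd_drop_conv_nth)
  moreover have "hd ?cs = P ! Suc j" using assms by (simp add: hd_drop_conv_nth)
  moreover have "last ?as = P ! i" using assms by (simp add: take_Suc_conv_app_nth)
  moreover have "last ?bs = P ! j"
  proof -
    have "length ?bs = j - i" "?bs \<noteq> []" using assms by auto
    then have "last ?bs = ?bs ! (j - i - 1)" by (simp add: last_conv_nth)
    also have "\<dots> = P ! j" using assms by simp
    finally show ?thesis .
  qed
  ultimately show ?thesis using no_rotation[of ?as ?bs ?cs] assms path_P(1) by simp
qed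

lemma att_succ_nonadjacent_hd:
  assumes "Suc j < length P" "att (P ! j)"
  shows "{P ! 0, P ! Suc j} \<notin> edges G"
proof -
  have "last (take (Suc j) P) = P ! j" "take (Suc j) P \<noteq> []" "drop (Suc j) P \<noteq> []"
    using assms by (auto simp: take_Suc_conv_app_nth)
  then have "{hd (take (Suc j) P), hd (drop (Suc j) P)} \<notin> edges G"
    using no_rotation_hd[OF append_take_drop_id[symmetric], of "Suc j"] assms by simp
  then show ?thesis using assms path_P(1) by (simp add: hd_drop_conv_nth hd_conv_nth)
qed

lemma not_att_edge:
  assumes "c \<in> C" "\<not> att x" shows "{c, x} \<notin> edges G" "{x, c} \<notin> edges G"
  using assms(1) assms(2)[unfolded att_def] assms(2)[unfolded att_sym] by blast+

lemma no_loop: "{a} \<notin> edges G"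
  using simple_graph_no_loop[OF simple] .

text \<open>Two attachment vertices would provide an independent triple not adjacent to C, namely
  \<open>P ! 0\<close> and their two successors; together with the edge \<open>v w\<close> it is
  forbidden.\<close>

lemma one_attachment:
  assumes e: "{v, w} \<in> edges G" "v \<in> C" "w \<in> C"
    and ij: "i < length P" "j < length P" "att (P ! i)" "att (P ! j)"
  shows "i = j"
proof (rule ccontr)
  have "False" if ij: "i < j" "j < length P" "att (P ! i)" "att (P ! j)" for i j
  proof -
    have j: "Suc j < length P" using att_index ij by blast
    let ?T = "{P ! 0, P ! Suc i, P ! Suc j}"
    have "\<not> att x" if "x \<in> ?T" for x
      using that att_Suc[of i] att_Suc[of j] ij j not_att_hd path_P(1) by (auto simp: hd_conv_nth)
    then have "{v, x} \<notin> edges G \<and> {w, x} \<notin> edges G" if "x \<in> ?T" for x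
      using not_att_edge e that by blast
    moreover have "P ! 0 \<noteq> P ! Suc i" "P ! 0 \<noteq> P ! Suc j" "P ! Suc i \<noteq> P ! Suc j"
    proof -
      have l: "0 < length P" "Suc i < length P" using ij j by auto
      show "P ! 0 \<noteq> P ! Suc i" "P ! 0 \<noteq> P ! Suc j" "P ! Suc i \<noteq> P ! Suc j"
        using nth_eq_iff_index_eq[OF path_P(2) l(1,2)] nth_eq_iff_index_eq[OF path_P(2) l(1) j]
          nth_eq_iff_index_eq[OF path_P(2) l(2) j] ij(1) by simp_all
    qed
    then have "card ?T = 3" by simp
    moreover have "?T \<subseteq> set P" using ij j path_P(1) by auto
    moreover then have "v \<notin> ?T" "w \<notin> ?T" "?T \<subseteq> verts G" using e C_sub path_P(3) by blast+
    moreover have "{x, y} \<notin> edges G" if "x \<in> ?T" "y \<in> ?T" for x y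
    proof -
      have "{P ! Suc i, P ! Suc j} \<notin> edges G" "{P ! 0, P ! Suc j} \<notin> edges G"
        "{P ! 0, P ! Suc i} \<notin> edges G"
        using att_succ_nonadjacent[OF ij(1) j ij(3,4)] att_succ_nonadjacent_hd[OF j ij(4)]
          att_succ_nonadjacent_hd[of i] ij j by auto
      then show ?thesis
        using that no_loop edge_commute[of "P ! Suc j" "P ! Suc i"]
          edge_commute[of "P ! Suc j" "P ! 0"] edge_commute[of "P ! Suc i" "P ! 0"] by auto
    qed
    ultimately have "three_isolated G v w ?T" using e by (simp add: three_isolated_def)
    then show False using free by blast
  qed
  moreover assume "i \<noteq> j"
  ultimately show False using ij by (meson linorder_neqE_nat)
qed

end

section \<open>Components with an edge: attachment at a single vertex\<close>

context off_path_component
begin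

lemma single_attachment_bound:
  assumes P: "P = L @ z # R" and c: "path_in G Q" "set Q \<subseteq> C" "{last Q, z} \<in> edges G"
    and T: "T \<noteq> []" "distinct T" "set T \<subseteq> set L \<union> set R" "successively (\<lambda>a b. {a, b} \<in> edges G) T"
      "{z, hd T} \<in> edges G"
  shows "length Q + length T \<le> length L + length R"
proof -
  have "path_in G (Q @ z # T)"
    using c T path_P C_sub unfolding P by (auto simp: path_in_iff successively_append_iff successively_Cons)
  from path_le[OF this] show ?thesis by (simp add: P)
qed

text \<open>No path starting next to \<open>z\<close> may cover both L and R. This keeps
  \<open>hd L\<close> away from both ends of R. Freeness with the edge \<open>c0 c1\<close> makes
  the non-neighbours of \<open>hd L\<close> in R pairwise adjacent, so the ends of R are adjacent
  and R can be traversed cyclically from any vertex. Hence \<open>hd L\<close> has no neighbour in R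
  at all, and R is a clique.\<close>

lemma single_attachment_right:
  assumes P: "P = L @ z # R" and c: "c0 \<in> C" "c1 \<in> C" "{c1, c0} \<in> edges G" "{c0, z} \<in> edges G"
    and only: "\<And>x. x \<in> set P \<Longrightarrow> att x \<Longrightarrow> x = z"
  shows "L \<noteq> []" "R \<noteq> []" "2 \<le> length R" "\<And>y. y \<in> set R \<Longrightarrow> {hd L, y} \<notin> edges G"
    and "\<And>y y'. y \<in> set R \<Longrightarrow> y' \<in> set R \<Longrightarrow> y \<noteq> y' \<Longrightarrow> {y, y'} \<in> edges G"
proof -
  have az: "att z" using c by (auto simp: att_def)
  have zP: "P ! length L = z" "length L < length P" by (simp_all add: P)
  show L: "L \<noteq> []" using att_index(1)[OF zP(2)] zP(1) az by auto
  show R: "R \<noteq> []" using att_index(2)[OF zP(2)] zP(1) az by (auto simp: P)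
  have d: "distinct L" "distinct R" "set L \<inter> set R = {}" "z \<notin> set L" "z \<notin> set R"
    using path_P(2) by (auto simp: P)
  have s: "successively (\<lambda>a b. {a, b} \<in> edges G) L" "successively (\<lambda>a b. {a, b} \<in> edges G) R"
    "{last L, z} \<in> edges G" "{z, hd R} \<in> edges G"
    using path_P(4) L R by (auto simp: P successively_append_iff successively_Cons)
  have zL: "{z, last L} \<in> edges G" using s(3) by (rule edge_commute)
  have "c0 \<noteq> c1" using c(3) no_loop by auto
  then have Q: "path_in G [c1, c0]" "set [c1, c0] \<subseteq> C" "{last [c1, c0], z} \<in> edges G"
    using c C_sub by (auto simp: path_in_iff)
  note bound = single_attachment_bound[OF P Q]
  \<comment> \<open>Taking \<open>rev L\<close> for \<open>T\<close> shows that R has at least as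
    many vertices as the two-vertex path in C, so the ends of R differ.\<close>
  have "2 + length L \<le> length L + length R"
    using bound[of "rev L"] L d s zL by (simp add: rev_successively hd_rev)
  then show R2: "2 \<le> length R" by simp
  have long: False if "length T = length L + length R" "distinct T" "set T \<subseteq> set L \<union> set R"
     "successively (\<lambda>a b. {a, b} \<in> edges G) T" "{z, hd T} \<in> edges G" for T
  proof -
    have "T \<noteq> []" using that(1) L by auto
    then show False using bound[OF _ that(2-5)] that(1) by simp
  qed
  have h: "{hd L, hd R} \<notin> edges G"
  proof
    assume "{hd L, hd R} \<in> edges G"
    then show False
      by (intro long[of "rev L @ R"])
        (use L R d s zL in \<open>auto simp: successively_append_iff rev_successively hd_rev last_rev\<close>)
  qed
  have t: "{hd L, last R} \<notin> edges G"
  proof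
    assume "{hd L, last R} \<in> edges G"
    then show False
      by (intro long[of "rev L @ rev R"])
        (use L R d s zL in \<open>auto simp: successively_append_iff rev_successively hd_rev last_rev\<close>)
  qed
  have nC: "{c0, x} \<notin> edges G" "{c1, x} \<notin> edges G" "x \<noteq> c0" "x \<noteq> c1" "x \<in> verts G"
    if "x \<in> set L \<union> set R" for x
  proof -
    have "\<not> att x" using only[of x] that d by (auto simp: P)
    then show "{c0, x} \<notin> edges G" "{c1, x} \<notin> edges G" using not_att_edge c by blast+
    show "x \<noteq> c0" "x \<noteq> c1" "x \<in> verts G" using that c C_sub path_P(3) by (auto simp: P)
  qed
  have hL: "hd L \<in> set L" using L by simp
  have adj: "{y, y'} \<in> edges G"
    if y: "y \<in> set R" "y' \<in> set R" "y \<noteq> y'" and n: "{hd L, y} \<notin> edges G" "{hd L, y'} \<notin> edges G" for y y'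
  proof (rule ccontr)
    assume "{y, y'} \<notin> edges G"
    moreover have "hd L \<noteq> y" "hd L \<noteq> y'" using hL y d by auto
    moreover have "\<forall>p\<in>{hd L, y, y'}. \<forall>q\<in>{hd L, y, y'}. {p, q} \<notin> edges G"
      using n calculation(1) no_loop
        edge_commute[of y "hd L"] edge_commute[of y' "hd L"] edge_commute[of y' y] by auto
    moreover have sub: "{hd L, y, y'} \<subseteq> set L \<union> set R" using hL y by simp
    moreover have "card {hd L, y, y'} = 3" using calculation(2,3) y(3) by simp
    ultimately have "three_isolated G c0 c1 {hd L, y, y'}"
      using edge_commute[OF c(3)] nC by (intro three_isolatedI) blast+
    then show False using free by blast
  qed
  have "hd R \<noteq> last R"
    using R2 d(2) by (cases R) auto
  then have hR: "{last R, hd R} \<in> edges G"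
    using adj[of "last R" "hd R"] h t R by auto
  show nLR: "{hd L, y} \<notin> edges G" if y: "y \<in> set R" for y
  proof
    assume e: "{hd L, y} \<in> edges G"
    obtain R1 R2 where R12: "R = R1 @ y # R2" using y by (meson split_list)
    have "R1 \<noteq> []" using e h R12 by auto
    have "successively (\<lambda>a b. {a, b} \<in> edges G) ((y # R2) @ R1)"
      using s(2) hR \<open>R1 \<noteq> []\<close> unfolding R12 successively_append_iff by simp
    then have "successively (\<lambda>a b. {a, b} \<in> edges G) (rev L @ (y # R2) @ R1)"
      using L s(1) e by (subst successively_append_iff) (simp add: rev_successively last_rev)
    then show False
      by (intro long[of "rev L @ (y # R2) @ R1"]) (use L d zL R12 in \<open>auto simp: hd_rev\<close>)
  qed
  show "{y, y'} \<in> edges G" if "y \<in> set R" "y' \<in> set R" "y \<noteq> y'" for y y'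
    using adj that nLR by simp
qed

lemma single_attachment_contradiction:
  assumes P: "P = L @ z # R" and c: "c0 \<in> C" "c1 \<in> C" "{c1, c0} \<in> edges G" "{c0, z} \<in> edges G"
    and only: "\<And>x. x \<in> set P \<Longrightarrow> att x \<Longrightarrow> x = z"
    and v: "v \<in> C" "top_vertex G v"
  shows False
proof -
  interpret rev: off_path_component G "rev P" C by (rule rev_component)
  note right = single_attachment_right[OF P c only]
  have P': "rev P = rev R @ z # rev L" by (simp add: P)
  have only': "x = z" if "x \<in> set (rev P)" "rev.att x" for x
    using that only unfolding rev.att_def att_def by simp
  note left = rev.single_attachment_right[OF P' c only']
  have L: "L \<noteq> []" "2 \<le> length L" and R: "R \<noteq> []" using left(3) right by auto
  have finC: "finite C" using C_sub simple by (auto simp: simple_graph_def intro: finite_subset)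
  have d: "distinct L" "distinct R" "set L \<inter> set R = {}" "z \<notin> set L" "z \<notin> set R"
    using path_P(2) by (auto simp: P)
  have s: "successively (\<lambda>a b. {a, b} \<in> edges G) L" "successively (\<lambda>a b. {a, b} \<in> edges G) R"
    "{last L, z} \<in> edges G" "{z, hd R} \<in> edges G"
    using path_P(4) L R by (auto simp: P successively_append_iff successively_Cons)
  have zL: "{z, last L} \<in> edges G" using s(3) by (rule edge_commute)
  have cliqueL: "{p, q} \<in> edges G" if "p \<in> set L" "q \<in> set L" "p \<noteq> q" for p q
    using left(5)[of p q] that by simp
  have cliqueR: "{p, q} \<in> edges G" if "p \<in> set R" "q \<in> set R" "p \<noteq> q" for p q
    using right(5)[of p q] that by simp
  have lastR: "{last R, p} \<notin> edges G" if "p \<in> set L" for p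
    using left(4)[of p] that R by (simp add: hd_rev)
  have sub: "set L \<subseteq> verts G" "set R \<subseteq> verts G" "z \<in> verts G" "C \<inter> set L = {}" "C \<inter> set R = {}" "z \<notin> C"
    "C \<subseteq> verts G"
    using path_P(3) C_sub by (auto simp: P)
  have nC: "{p, x} \<notin> edges G" "{x, p} \<notin> edges G" if "p \<in> C" "x \<in> set L \<union> set R" for p x
  proof -
    have "\<not> att x" using only[of x] that d by (auto simp: P)
    then show "{p, x} \<notin> edges G" "{x, p} \<notin> edges G" using not_att_edge that by blast+
  qed
  \<comment> \<open>Two nonadjacent vertices of C and \<open>last R\<close> would be isolated from
    the edge formed by the first two vertices of L.\<close>
  have cliqueC: "{p, q} \<in> edges G" if pq: "p \<in> C" "q \<in> C" "p \<noteq> q" for p q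
  proof (rule ccontr)
    assume n: "{p, q} \<notin> edges G"
    obtain a b L' where ab: "L = a # b # L'"
      using L by (cases L; cases "tl L") auto
    have r: "last R \<in> set R" using R by simp
    have dist: "p \<noteq> last R" "q \<noteq> last R" "a \<noteq> p" "a \<noteq> q" "b \<noteq> p" "b \<noteq> q" "a \<noteq> last R" "b \<noteq> last R"
      using pq r sub d(3) ab by auto
    have "{a, b} \<in> edges G" using s(1) by (simp add: ab)
    moreover have "{p, q, last R} \<subseteq> verts G" using pq r sub by auto
    moreover have "card {p, q, last R} = 3" using pq(3) dist by simp
    moreover have "\<forall>x\<in>{p, q, last R}. {a, x} \<notin> edges G \<and> {b, x} \<notin> edges G"
      using nC[of p a] nC[of p b] nC[of q a] nC[of q b] pq ab lastR[of a] lastR[of b]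
        edge_commute[of a "last R"] edge_commute[of b "last R"] by auto
    moreover have "\<forall>x\<in>{p, q, last R}. \<forall>y\<in>{p, q, last R}. {x, y} \<notin> edges G"
      using n edge_commute[of q p] no_loop nC[of p "last R"] nC[of q "last R"] pq r by auto
    ultimately have "three_isolated G a b {p, q, last R}"
      using dist by (simp add: three_isolated_def)
    then show False using free by blast
  qed
  \<comment> \<open>As C is a clique, one path covers all of C and ends at \<open>c0\<close>, which
    improves the length bound from 2 to \<open>card C\<close>.\<close>
  obtain cs where cs: "set cs = C - {c0}" "distinct cs" using finC finite_distinct_list[of "C - {c0}"] by auto
  define Q where "Q = cs @ [c0]"
  have Q: "path_in G Q" "set Q \<subseteq> C" "{last Q, z} \<in> edges G" "length Q = card C"
  proof -
    have dQ: "distinct Q" "set Q = C" using cs c(1) by (auto simp: Q_def)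
    show "path_in G Q"
      using dQ cliqueC sub by (auto simp: path_in_iff Q_def intro!: clique_successively)
    show "set Q \<subseteq> C" "{last Q, z} \<in> edges G" using dQ c(4) by (auto simp: Q_def)
    show "length Q = card C" using dQ by (metis distinct_card)
  qed
  note bound = single_attachment_bound[OF P Q(1-3), unfolded Q(4)]
  have cR: "card C \<le> length R"
    using bound[of "rev L"] L d s zL by (simp add: rev_successively hd_rev)
  have cL: "card C \<le> length L"
    using bound[of R] R d s by simp
  have C1: "card C \<ge> 1" using finC c(1) by (metis Suc_leI One_nat_def card_gt_0_iff empty_iff)
  \<comment> \<open>Cliques can be traversed in any order: with \<open>a \<noteq> last L\<close>, an
    edge \<open>a b\<close> would extend a path from \<open>last L\<close> through all of L, ending
    at \<open>a\<close>, to one that also covers R.\<close>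
  have noLR: "{a, b} \<notin> edges G" if a: "a \<in> set L" "a \<noteq> last L" and b: "b \<in> set R" for a b
  proof
    assume e: "{a, b} \<in> edges G"
    obtain M where M: "set M = set L - {last L, a}" "distinct M"
      using finite_distinct_list[of "set L - {last L, a}"] by auto
    obtain N where N: "set N = set R - {b}" "distinct N"
      using finite_distinct_list[of "set R - {b}"] by auto
    let ?A = "last L # M @ [a]" and ?B = "b # N"
    have "last L \<in> set L" using L(1) by simp
    then have A: "set ?A = set L" "distinct ?A" using a M by auto
    have B: "set ?B = set R" "distinct ?B" using b N by auto
    have "successively (\<lambda>a b. {a, b} \<in> edges G) ?A"
      by (rule clique_successively[OF A(2)]) (use cliqueL A(1) in auto)
    moreover have "successively (\<lambda>a b. {a, b} \<in> edges G) ?B"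
      by (rule clique_successively[OF B(2)]) (use cliqueR B(1) in auto)
    ultimately have "successively (\<lambda>a b. {a, b} \<in> edges G) (?A @ ?B)"
      using e by (simp only: successively_append_iff) simp
    moreover have "distinct (?A @ ?B)" using A B d(3) by (simp only: distinct_append)
    moreover have "length (?A @ ?B) = length L + length R"
      using distinct_card[OF A(2)] distinct_card[OF B(2)] distinct_card[OF d(1)] distinct_card[OF d(2)] A B
      by (simp only: length_append)
    moreover have "set (?A @ ?B) \<subseteq> set L \<union> set R" using A B by (simp only: set_append)
    ultimately have "card C + (length L + length R) \<le> length L + length R"
      using bound[of "?A @ ?B"] zL by simp
    then show False using C1 by simp
  qed
  have "degree G v \<le> card C"
  proof -
    have "{w \<in> verts G. {v, w} \<in> edges G} \<subseteq> insert z (C - {v})"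
    proof
      fix w assume w: "w \<in> {w \<in> verts G. {v, w} \<in> edges G}"
      show "w \<in> insert z (C - {v})"
      proof (cases "w \<in> set P")
        case True
        then show ?thesis using only[of w] w v(1) by (auto simp: att_def)
      next
        case False
        then show ?thesis using C_closed[OF v(1), of w] w no_loop by auto
      qed
    qed
    then have "degree G v \<le> card (insert z (C - {v}))"
      unfolding degree_def using finC by (intro card_mono) auto
    also have "\<dots> \<le> Suc (card (C - {v}))" by (rule card_insert_le_m1[THEN order_trans]) (use C1 in auto)
    also have "\<dots> = card C" by (rule card_Suc_Diff1[OF finC v(1)])
    finally show ?thesis .
  qed
  then have dz: "degree G z \<le> card C" using top_vertex_degree[OF simple v(2) sub(3)] by linarith
  define N where "N = {w \<in> verts G. {z, w} \<in> edges G}"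
  have finN: "finite N" using simple by (simp add: N_def simple_graph_def)
  have "(C \<inter> N) \<union> (set L \<inter> N) \<union> (set R \<inter> N) \<subseteq> N" by auto
  then have "card ((C \<inter> N) \<union> (set L \<inter> N) \<union> (set R \<inter> N)) \<le> card C"
    using card_mono[OF finN] dz unfolding degree_def N_def[symmetric] by (meson order_trans)
  moreover have "card ((C \<inter> N) \<union> (set L \<inter> N) \<union> (set R \<inter> N)) =
      card (C \<inter> N) + card (set L \<inter> N) + card (set R \<inter> N)"
    using finN sub(4,5) d(3) by (subst card_Un_disjoint; (subst card_Un_disjoint)?; auto)
  ultimately have sum: "card (C \<inter> N) + card (set L \<inter> N) + card (set R \<inter> N) \<le> card C" by simp
  have "c0 \<in> C \<inter> N" "last L \<in> set L \<inter> N" "hd R \<in> set R \<inter> N"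
    using c edge_commute[OF c(4)] zL s L R sub by (auto simp: N_def)
  then have "card (C \<inter> N) \<ge> 1" "card (set L \<inter> N) \<ge> 1" "card (set R \<inter> N) \<ge> 1"
    using finN by (metis Suc_leI One_nat_def card_gt_0_iff empty_iff finite_Int)+
  \<comment> \<open>\<open>z\<close> has a neighbour in each of C, L and R and at most
    \<open>card C\<close> in total, so at most \<open>card C - 2\<close> in any one of them, while L
    and R have at least \<open>card C\<close> vertices.\<close>
  then have less: "card (C \<inter> N) + 2 \<le> card C" "card (set L \<inter> N) < length L" "card (set R \<inter> N) < length R"
    using sum cL cR by auto
  have "set L \<inter> N \<noteq> set L" using less(2) distinct_card[OF d(1)] by auto
  then obtain a where a: "a \<in> set L" "a \<notin> N" by blast
  have "set R \<inter> N \<noteq> set R" using less(3) distinct_card[OF d(2)] by auto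
  then obtain b where b: "b \<in> set R" "b \<notin> N" by blast
  have "card (C - N) \<ge> 2" using less(1) card_Int_Diff[OF finC, of N] by linarith
  then obtain W where "W \<subseteq> C - N" "card W = 2" by (meson obtain_subset_with_card_n)
  then obtain p q where pq: "p \<in> C" "p \<notin> N" "q \<in> C" "q \<notin> N" "p \<noteq> q" by (auto simp: card_2_iff)
  have "a \<noteq> last L" using a(2) zL L a(1) sub by (auto simp: N_def)
  then have ab: "{a, b} \<notin> edges G" using noLR a b by blast
  have nz: "{z, x} \<notin> edges G" "{x, z} \<notin> edges G" if "x \<notin> N" "x \<in> verts G" for x
    using that edge_commute[of x z] by (auto simp: N_def)
  have V: "a \<in> verts G" "b \<in> verts G" "p \<in> verts G" "q \<in> verts G" using a b pq sub by auto
  have dist: "a \<noteq> b" "a \<noteq> z" "b \<noteq> z" "p \<notin> {z, a, b}" "q \<notin> {z, a, b}"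
    using a b pq d sub by auto
  have "\<forall>x\<in>{z, a, b}. {p, x} \<notin> edges G \<and> {q, x} \<notin> edges G"
    using nz(2)[OF pq(2) V(3)] nz(2)[OF pq(4) V(4)] nC(1)[OF pq(1)] nC(1)[OF pq(3)] a(1) b(1) by auto
  moreover have "\<forall>x\<in>{z, a, b}. \<forall>y\<in>{z, a, b}. {x, y} \<notin> edges G"
    using nz[OF a(2) V(1)] nz[OF b(2) V(2)] ab edge_commute[of b a] no_loop by auto
  moreover have "card {z, a, b} = 3" using dist by simp
  ultimately have "three_isolated G p q {z, a, b}"
    using cliqueC[OF pq(1,3,5)] V sub(3) dist by (simp add: three_isolated_def)
  then show False using free by blast
qed

lemma top_vertex_isolated:
  assumes conn: "connected_graph G" and v: "v \<in> C" "top_vertex G v"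
  shows "{v, w} \<in> edges G \<Longrightarrow> w \<in> set P"
proof (rule ccontr)
  assume vw: "{v, w} \<in> edges G" "w \<notin> set P"
  then have w: "w \<in> C" using C_closed v by blast
  have "\<exists>x\<in>set P. att x"
  proof (rule ccontr)
    assume none: "\<not> (\<exists>x\<in>set P. att x)"
    have "verts G \<subseteq> C"
    proof (rule connected_graph_closed[OF conn _ v(1)])
      show "v \<in> verts G" using v C_sub by blast
      show "y \<in> C" if "x \<in> C" "{x, y} \<in> edges G" for x y
        using that none C_closed[OF that] by (auto simp: att_def)
    qed
    then show False using path_P(1,3) C_sub by (cases P) auto
  qed
  then obtain z where z: "z \<in> set P" "att z" by blast
  then obtain c0 where c0: "c0 \<in> C" "{c0, z} \<in> edges G" by (auto simp: att_def)
  obtain L R where P: "P = L @ z # R" using z by (meson split_list)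
  have only: "x = z" if x: "x \<in> set P" "att x" for x
  proof -
    obtain i where i: "i < length P" "P ! i = x" using x(1) unfolding in_set_conv_nth by blast
    have "P ! length L = z" "length L < length P" by (simp_all add: P)
    then show ?thesis using one_attachment[OF vw(1) v(1) w i(1), of "length L"] i x z by auto
  qed
  \<comment> \<open>The first step of a path in C from \<open>c0\<close> to another vertex gives the
    edge of C that ends at the neighbour \<open>c0\<close> of \<open>z\<close>.\<close>
  obtain c where c: "c \<in> C" "c \<noteq> c0" using v(1) w vw(1) no_loop by (metis insert_absorb2)
  obtain Q where Q: "path_in G Q" "set Q \<subseteq> C" "hd Q = c0" "last Q = c" using C_conn[OF c0(1) c(1)] by blast
  obtain Q' where Q': "Q = c0 # Q'" using Q by (cases Q) (auto simp: path_in_def)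
  then have "Q' \<noteq> []" using Q c by auto
  then obtain c1 Q'' where "Q' = c1 # Q''" by (cases Q') auto
  then have "c1 \<in> C" "{c0, c1} \<in> edges G" using Q Q' by (auto simp: path_in_iff)
  then show False
    using single_attachment_contradiction[OF P c0(1) _ edge_commute c0(2) only v] by blast
qed

end

text \<open>C is the reachability class of \<open>v\<close> in G - P. The relation
  \<open>?rC\<close>, restricted to the class itself, is needed because the connecting paths must
  stay inside C.\<close>

lemma off_path_component_exists:
  assumes G: "simple_graph G" and lp: "longest_path G P" and free: "\<And>a b T. \<not> three_isolated G a b T"
    and v: "v \<in> verts G" "v \<notin> set P"
  obtains C where "off_path_component G P C" "v \<in> C"
proof -
  let ?W = "verts G - set P"
  let ?r = "{(p, q). p \<in> ?W \<and> q \<in> ?W \<and> {p, q} \<in> edges G}"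
  let ?C = "{w. (v, w) \<in> ?r\<^sup>*}"
  let ?rC = "{(p, q). p \<in> ?C \<and> q \<in> ?C \<and> {p, q} \<in> edges G}"
  have CW: "?C \<subseteq> ?W"
  proof
    fix w assume "w \<in> ?C"
    then have "(v, w) \<in> ?r\<^sup>*" by simp
    then show "w \<in> ?W" by (cases rule: rtranclE) (use v in auto)
  qed
  have closed: "w \<in> ?C" if c: "c \<in> ?C" "{c, w} \<in> edges G" "w \<notin> set P" for c w
  proof -
    have "(c, w) \<in> ?r" using c CW simple_graph_edgeD[OF G c(2)] by blast
    then show ?thesis using c(1) by (auto intro: rtrancl_into_rtrancl)
  qed
  have reach: "(v, c) \<in> ?rC\<^sup>*" if "c \<in> ?C" for c
  proof -
    have "(v, c) \<in> ?r\<^sup>*" using that by simp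
    then show ?thesis
    proof (induction rule: rtrancl_induct)
      case (step y z)
      then have "z \<in> ?C" "y \<in> ?C" by (auto intro: rtrancl_into_rtrancl)
      then have "(y, z) \<in> ?rC" using step(2) by blast
      with step(3) show ?case by (rule rtrancl_into_rtrancl)
    qed simp
  qed
  have "sym ?rC" by (auto simp: sym_def insert_commute)
  then have sy: "sym (?rC\<^sup>*)" by (rule sym_rtrancl)
  have "off_path_component G P ?C"
  proof
    show "?C \<subseteq> verts G - set P" by (rule CW)
    show "\<exists>Q. path_in G Q \<and> set Q \<subseteq> ?C \<and> hd Q = c \<and> last Q = c'" if "c \<in> ?C" "c' \<in> ?C" for c c'
    proof (rule path_in_reachable)
      have "(c, v) \<in> ?rC\<^sup>*" using reach[OF that(1)] sy by (meson symD)
      then show "(c, c') \<in> ?rC\<^sup>*" using reach[OF that(2)] by (rule rtrancl_trans)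
      show "c \<in> ?C" by (rule that)
      show "?C \<subseteq> verts G" using CW by blast
    qed
  qed (use G lp free closed in auto)
  then show ?thesis by (rule that) simp
qed

section \<open>Top vertices off a longest path\<close>

locale top_vertex_off_path = off_path_component +
  fixes v
  assumes connected: "connected_graph G" and v: "v \<in> C" and top: "top_vertex G v"
begin

definition N where "N = {x. {v, x} \<in> edges G}"

text \<open>Cutting P behind every neighbour of \<open>v\<close> leaves pieces whose first vertices,
  together with \<open>v\<close>, form this set. No neighbour of \<open>v\<close> is last on P, so
  \<open>P ! Suc i\<close> is always a proper list entry.\<close>

definition starts where
  "starts = insert v (insert (P ! 0) ((\<lambda>i. P ! Suc i) ` {i. i < length P \<and> P ! i \<in> N}))"

lemma N_sub: "N \<subseteq> set P"
  using top_vertex_isolated[OF connected v top] by (auto simp: N_def)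

lemma v_facts: "v \<in> verts G" "v \<notin> set P" "v \<notin> N"
  using v C_sub no_loop by (auto simp: N_def)

lemma C_eq: "C = {v}"
proof -
  have "c = v" if c: "c \<in> C" for c
  proof (rule ccontr)
    assume "c \<noteq> v"
    obtain Q where Q: "path_in G Q" "set Q \<subseteq> C" "hd Q = v" "last Q = c" using C_conn[OF v c] by blast
    obtain Q' where Q': "Q = v # Q'" using Q by (cases Q) (auto simp: path_in_def)
    then have "Q' \<noteq> []" using Q \<open>c \<noteq> v\<close> by auto
    then obtain c1 Q'' where "Q' = c1 # Q''" by (cases Q') auto
    then have "c1 \<in> C" "{v, c1} \<in> edges G" using Q Q' by (auto simp: path_in_iff)
    then show False using N_sub C_sub by (auto simp: N_def)
  qed
  then show ?thesis using v by blast
qed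

lemma att_iff: "att x \<longleftrightarrow> x \<in> N"
  unfolding att_def N_def using C_eq by blast

lemma N_commute: "x \<in> N \<longleftrightarrow> {x, v} \<in> edges G"
  by (simp add: N_def insert_commute)

lemma degree_le: "w \<in> verts G \<Longrightarrow> degree G w \<le> card N"
proof -
  assume "w \<in> verts G"
  moreover have "{w \<in> verts G. {v, w} \<in> edges G} = N"
    using simple_graph_edgeD[OF simple] by (auto simp: N_def)
  ultimately show ?thesis using top_vertex_degree[OF simple top] by (simp add: degree_def)
qed

lemma card_le_degree:
  assumes "A \<subseteq> {x. {w, x} \<in> edges G}" "w \<in> verts G" shows "card A \<le> card N"
proof -
  have "card A \<le> degree G w"
    unfolding degree_def
    using assms simple simple_graph_edgeD[OF simple] by (intro card_mono) (auto simp: simple_graph_def)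
  then show ?thesis using degree_le[OF assms(2)] by linarith
qed

lemma P_index_eq: "i < length P \<Longrightarrow> j < length P \<Longrightarrow> P ! i = P ! j \<longleftrightarrow> i = j"
  using path_P(2) by (simp add: nth_eq_iff_index_eq)

lemma P_edge: "Suc i < length P \<Longrightarrow> {P ! i, P ! Suc i} \<in> edges G"
  using path_P(4) by (simp add: successively_conv_nth)

lemma P_verts: "i < length P \<Longrightarrow> P ! i \<in> verts G"
  using path_P(3) by auto

lemma N_index: "i < length P \<Longrightarrow> P ! i \<in> N \<Longrightarrow> 0 < i \<and> Suc i < length P"
  using att_index[of i] by (simp add: att_iff)

lemma N_Suc: "Suc i < length P \<Longrightarrow> P ! i \<in> N \<Longrightarrow> P ! Suc i \<notin> N"
  using att_Suc[of i] by (simp add: att_iff)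

lemma N_nonempty: "N \<noteq> {}"
proof
  assume "N = {}"
  then have "verts G \<subseteq> {v}"
    by (intro connected_graph_closed[OF connected v_facts(1)]) (auto simp: N_def)
  then show False using path_P(1,3) v_facts(2) by (cases P) auto
qed

text \<open>A neighbour of \<open>v\<close> is adjacent to \<open>v\<close> and to two vertices of
  P, and \<open>v\<close> has maximum degree. This is the origin of t \<ge> 3.\<close>

lemma card_N: "card N \<ge> 3"
proof -
  obtain x where x: "x \<in> N" using N_nonempty by blast
  then obtain i where i: "i < length P" "P ! i = x" using N_sub by (metis in_set_conv_nth subsetD)
  then have i': "0 < i" "Suc i < length P" using N_index x by auto
  have e: "{P ! (i - 1), x} \<in> edges G" "{x, P ! Suc i} \<in> edges G"
    using P_edge[of "i - 1"] P_edge[of i] i i' by auto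
  have "{P ! (i - 1), P ! Suc i, v} \<subseteq> {y. {x, y} \<in> edges G}"
    using e edge_commute[OF e(1)] x by (auto simp: N_commute)
  then have "card {P ! (i - 1), P ! Suc i, v} \<le> card N"
    using P_verts[OF i(1)] i by (intro card_le_degree) auto
  moreover have "P ! (i - 1) \<noteq> P ! Suc i" using P_index_eq[of "i - 1" "Suc i"] i' by simp
  moreover have "P ! (i - 1) \<noteq> v" "P ! Suc i \<noteq> v"
    using v_facts(2) nth_mem[of "i - 1" P] nth_mem[of "Suc i" P] i' by auto
  ultimately show ?thesis by simp
qed

text \<open>Membership by index; \<open>i = 0\<close> is kept apart because \<open>i - 1\<close>
  truncates there.\<close>

lemma startsE:
  assumes "a \<in> starts"
  obtains "a = v" | i where "i < length P" "a = P ! i" "i = 0 \<or> P ! (i - 1) \<in> N" "P ! i \<notin> N"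
proof -
  have P0: "P ! 0 \<notin> N" "0 < length P" using N_index[of 0] path_P(1) by auto
  have S: "Suc i < length P \<and> P ! Suc i \<notin> N" if "i < length P" "P ! i \<in> N" for i
    using N_index[OF that] N_Suc[of i] that by blast
  consider "a = v" | "a = P ! 0" | i where "i < length P" "P ! i \<in> N" "a = P ! Suc i"
    using assms unfolding starts_def by blast
  then show thesis
  proof cases
    case 1
    then show ?thesis by (rule that(1))
  next
    case 2
    then show ?thesis using that(2)[of 0] P0 by simp
  next
    case (3 i)
    then show ?thesis using that(2)[of "Suc i"] S[of i] by simp
  qed
qed

lemma starts_nthI: "i < length P \<Longrightarrow> i = 0 \<or> P ! (i - 1) \<in> N \<Longrightarrow> P ! i \<in> starts"
  by (cases i) (auto simp: starts_def)

lemma starts_verts: "starts \<subseteq> verts G"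
proof
  fix a assume "a \<in> starts"
  then show "a \<in> verts G" by (cases rule: startsE) (use v_facts P_verts in auto)
qed

lemma starts_disjoint: "a \<in> starts \<Longrightarrow> a \<notin> N"
  by (erule startsE) (use v_facts in auto)

lemma starts_independent:
  assumes "a \<in> starts" "b \<in> starts" shows "{a, b} \<notin> edges G"
proof -
  have P0: "{P ! i, P ! j} \<notin> edges G"
    if "i < j" "j < length P" "i = 0 \<or> P ! (i - 1) \<in> N" "P ! (j - 1) \<in> N" for i j
  proof (cases "i = 0")
    case True
    then show ?thesis using that att_succ_nonadjacent_hd[of "j - 1"] by (simp add: att_iff)
  next
    case False
    then show ?thesis using that att_succ_nonadjacent[of "i - 1" "j - 1"] by (simp add: att_iff)
  qed
  show ?thesis
    using assms(1)
  proof (cases rule: startsE)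
    case 1
    then show ?thesis using starts_disjoint[OF assms(2)] by (simp add: N_def)
  next
    case (2 i)
    show ?thesis
      using assms(2)
    proof (cases rule: startsE)
      case 1
      then show ?thesis using 2 by (simp add: N_commute)
    next
      case j: (2 j)
      consider "i = j" | "i < j" | "j < i" by linarith
      then show ?thesis
      proof cases
        case 1
        then show ?thesis using 2 j no_loop by simp
      next
        case ij: 2
        then show ?thesis using P0[of i j] 2 j by auto
      next
        case 3
        then show ?thesis using P0[of j i] 2 j edge_commute by auto
      qed
    qed
  qed
qed

lemma finite_starts: "finite starts"
  by (simp add: starts_def)

lemma card_starts: "card starts = card N + 2"
proof -
  let ?J = "{i. i < length P \<and> P ! i \<in> N}"
  have J: "Suc i < length P" if "i \<in> ?J" for i using that N_index by auto
  have "card ((\<lambda>i. P ! Suc i) ` ?J) = card ?J"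
    using J P_index_eq by (intro card_image) (auto simp: inj_on_def)
  moreover have "card ?J = card ((\<lambda>i. P ! i) ` ?J)"
    using P_index_eq by (intro card_image[symmetric]) (auto simp: inj_on_def)
  moreover have "(\<lambda>i. P ! i) ` ?J = N" using N_sub by (auto simp: in_set_conv_nth subset_iff image_iff)
  moreover have "P ! 0 \<notin> (\<lambda>i. P ! Suc i) ` ?J"
    using J P_index_eq[of 0] path_P(1) by fastforce
  moreover have "v \<notin> insert (P ! 0) ((\<lambda>i. P ! Suc i) ` ?J)"
  proof
    assume "v \<in> insert (P ! 0) ((\<lambda>i. P ! Suc i) ` ?J)"
    then have "v \<in> set P" using J path_P(1) by auto
    then show False using v_facts by simp
  qed
  ultimately show ?thesis by (simp add: starts_def)
qed

text \<open>Freeness as a cardinality bound: a larger \<open>T\<close> would contain a forbidden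
  triple.\<close>

lemma few_nonadjacent:
  assumes e: "{x, y} \<in> edges G" and T: "T \<subseteq> verts G" "\<forall>c\<in>T. \<forall>d\<in>T. {c, d} \<notin> edges G"
    and n: "x \<notin> T" "y \<notin> T" "\<forall>c\<in>T. {x, c} \<notin> edges G \<and> {y, c} \<notin> edges G"
  shows "card T \<le> 2"
proof (rule ccontr)
  assume "\<not> card T \<le> 2"
  then obtain T' where "T' \<subseteq> T" "card T' = 3"
    using obtain_subset_with_card_n[of 3 T] by auto
  then have "three_isolated G x y T'" using e T n by (intro three_isolatedI) blast+
  then show False using free by blast
qed

text \<open>\<open>?b\<close> misses at most two of the \<open>card N + 2\<close> starts, so it has
  at least \<open>card N\<close> neighbours among them. Its successor \<open>?e\<close> is not a
  start, because \<open>?b \<notin> N\<close>, and would be one neighbour too many.\<close>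

lemma gap_at_end:
  assumes i: "P ! i \<in> starts" "Suc i < length P" "P ! Suc i \<notin> N"
  shows "Suc (Suc i) = length P"
proof (rule ccontr)
  assume "Suc (Suc i) \<noteq> length P"
  then have i2: "Suc (Suc i) < length P" using i by simp
  let ?a = "P ! i" and ?b = "P ! Suc i" and ?e = "P ! Suc (Suc i)"
  have ab: "{?a, ?b} \<in> edges G" using P_edge i by blast
  have b: "?b \<notin> starts" using starts_independent[OF i(1)] ab by blast
  let ?T = "{c \<in> starts - {?a}. {?b, c} \<notin> edges G}" and ?U = "{c \<in> starts. {?b, c} \<in> edges G}"
  have "card ?T \<le> 2"
    by (rule few_nonadjacent[OF ab])
      (use starts_verts starts_independent i(1) b in blast)+
  moreover have aU: "?a \<in> ?U" using i(1) edge_commute[OF ab] by simp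
  have "starts = ?T \<union> ?U" using aU by blast
  then have "card starts \<le> card ?T + card ?U" by (metis (no_types, lifting) card_Un_le)
  ultimately have U: "card N \<le> card ?U" using card_starts by linarith
  have "?e \<notin> starts"
  proof
    assume "?e \<in> starts"
    then show False
    proof (cases rule: startsE)
      case 1
      then show False using v_facts(2) nth_mem[OF i2] by simp
    next
      case (2 j)
      then have "j = Suc (Suc i)" using P_index_eq[OF i2] by simp
      then show False using 2 i(3) by simp
    qed
  qed
  moreover have "insert ?e ?U \<subseteq> {x. {?b, x} \<in> edges G}" using P_edge[OF i2] by auto
  then have "card (insert ?e ?U) \<le> card N" using P_verts[OF i(2)] by (rule card_le_degree)
  moreover have "finite ?U" using finite_starts by simp
  ultimately show False using U by simp
qed

text \<open>The leftmost gap begins at a start, so \<open>gap_at_end\<close> places it at the end of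
  P; any gap lies no further left.\<close>

lemma gap_unique:
  assumes i: "Suc i < length P" "P ! i \<notin> N" "P ! Suc i \<notin> N"
  shows "Suc (Suc i) = length P"
proof -
  let ?g = "\<lambda>i. Suc i < length P \<and> P ! i \<notin> N \<and> P ! Suc i \<notin> N"
  define j where "j = (LEAST i. ?g i)"
  have j: "?g j" "j \<le> i" using LeastI[of ?g i] Least_le[of ?g i] i by (auto simp: j_def)
  have "P ! (j - 1) \<in> N" if "j \<noteq> 0"
  proof (rule ccontr)
    assume "P ! (j - 1) \<notin> N"
    then have "?g (j - 1)" using j that by auto
    then have "j \<le> j - 1" unfolding j_def by (rule Least_le)
    then show False using that by simp
  qed
  then have "P ! j \<in> starts" using j by (intro starts_nthI) auto
  then have "Suc (Suc j) = length P" using gap_at_end j by blast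
  then show ?thesis using j i by linarith
qed

lemma rev_top_vertex_off_path: "top_vertex_off_path G (rev P) C v"
  using rev_component connected v top by (simp add: top_vertex_off_path_def top_vertex_off_path_axioms_def)

text \<open>By reversal a gap is also at the beginning of P, so P consists of two vertices outside
  N, although N is nonempty and lies on P.\<close>

lemma no_gap:
  assumes i: "Suc i < length P" "P ! i \<notin> N"
  shows "P ! Suc i \<in> N"
proof (rule ccontr)
  assume n: "P ! Suc i \<notin> N"
  interpret rev: top_vertex_off_path G "rev P" C v by (rule rev_top_vertex_off_path)
  have k: "Suc (Suc i) = length P" using gap_unique[OF i n] .
  have "rev P ! 0 = P ! Suc i" "rev P ! Suc 0 = P ! i" using k by (simp_all add: rev_nth flip: k)
  then have "Suc (Suc 0) = length (rev P)" using i n k by (intro rev.gap_unique) simp_all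
  then have "i = 0" "length P = 2" using k by auto
  then have "set P = {P ! 0, P ! Suc 0}" by (auto simp: set_conv_nth less_Suc_eq numeral_2_eq_2)
  then show False using N_sub N_nonempty i n \<open>i = 0\<close> by auto
qed

lemma N_iff_odd: "i < length P \<Longrightarrow> P ! i \<in> N \<longleftrightarrow> odd i"
proof (induction i)
  case 0
  then show ?case using N_index[of 0] by auto
next
  case (Suc i)
  then show ?case using no_gap[of i] N_Suc[of i] by auto
qed

lemma starts_eq: "starts = insert v (set P - N)"
proof (intro equalityI subsetI)
  fix a assume "a \<in> starts"
  then show "a \<in> insert v (set P - N)" by (cases rule: startsE) auto
next
  fix a assume a: "a \<in> insert v (set P - N)"
  show "a \<in> starts"
  proof (cases "a = v")
    case False
    then have "a \<in> set P" using a by simp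
    then obtain i where i: "i < length P" "a = P ! i" by (metis in_set_conv_nth)
    then have "even i" using a False N_iff_odd[of i] by auto
    then have "i = 0 \<or> P ! (i - 1) \<in> N" using N_iff_odd[of "i - 1"] i by (cases i) auto
    then show ?thesis using i starts_nthI by simp
  qed (simp add: starts_def)
qed

text \<open>Equality throughout: \<open>x\<close> misses at most two of the
  \<open>card N + 2\<close> starts and has at most \<open>card N\<close> neighbours
  altogether.\<close>

lemma N_nbrs:
  assumes x: "x \<in> N"
  shows "{c. {x, c} \<in> edges G} \<subseteq> starts" and "card {c \<in> starts. {x, c} \<notin> edges G} = 2"
proof -
  let ?T = "{c \<in> starts. {x, c} \<notin> edges G}" and ?U = "{c \<in> starts. {x, c} \<in> edges G}"
  have xv: "{x, v} \<in> edges G" using x by (simp add: N_commute)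
  have xV: "x \<in> verts G" using simple_graph_edgeD[OF simple xv] by simp
  have vs: "v \<in> starts" by (simp add: starts_def)
  have "card ?T \<le> 2"
    by (rule few_nonadjacent[OF xv])
      (use starts_verts starts_independent starts_disjoint x xv vs in blast)+
  moreover have "card starts = card ?T + card ?U"
    using finite_starts by (subst card_Un_disjoint[symmetric]) (auto intro: arg_cong[of _ _ card])
  moreover have "card ?U \<le> card N" using xV by (intro card_le_degree) auto
  ultimately have c: "card ?T = 2" "card ?U = card N" using card_starts by linarith+
  then show "card ?T = 2" by simp
  have fin: "finite {c. {x, c} \<in> edges G}"
  proof (rule finite_subset)
    show "{c. {x, c} \<in> edges G} \<subseteq> verts G" using simple_graph_edgeD(2)[OF simple] by blast
    show "finite (verts G)" using simple by (simp add: simple_graph_def)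
  qed
  have "card {c. {x, c} \<in> edges G} \<le> card N" using xV by (intro card_le_degree) auto
  then have "?U = {c. {x, c} \<in> edges G}" using fin c by (intro card_seteq) auto
  then show "{c. {x, c} \<in> edges G} \<subseteq> starts" by blast
qed

text \<open>Vertices of N have all their neighbours in \<open>starts\<close>. If another vertex x of
  P had a neighbour y elsewhere, then \<open>hd P\<close>, \<open>last P\<close> and
  \<open>v\<close> would be isolated from the edge \<open>x y\<close>, since y cannot be appended at
  either end of P.\<close>

lemma verts_eq: "verts G = insert v (set P)"
proof (rule equalityI)
  show "insert v (set P) \<subseteq> verts G" using v_facts path_P(3) by auto
  have ends: "{hd P, y} \<notin> edges G" "{last P, y} \<notin> edges G" if y: "y \<notin> set P" for y
  proof -
    show "{hd P, y} \<notin> edges G"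
    proof
      assume e: "{hd P, y} \<in> edges G"
      then have "path_in G (y # P)"
        using path_P y edge_commute[OF e] simple_graph_edgeD[OF simple e]
        by (auto simp: path_in_iff successively_Cons)
      from path_le[OF this] show False by simp
    qed
    show "{last P, y} \<notin> edges G"
    proof
      assume e: "{last P, y} \<in> edges G"
      then have "path_in G (P @ [y])"
        using path_P y simple_graph_edgeD[OF simple e]
        by (auto simp: path_in_iff successively_append_iff)
      from path_le[OF this] show False by simp
    qed
  qed
  show "verts G \<subseteq> insert v (set P)"
  proof (rule connected_graph_closed[OF connected v_facts(1)])
    fix x y assume x: "x \<in> insert v (set P)" and xy: "{x, y} \<in> edges G"
    show "y \<in> insert v (set P)"
    proof (cases "x \<in> N")
      case True
      then show ?thesis using N_nbrs(1) xy starts_eq by auto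
    next
      case False
      show ?thesis
      proof (rule ccontr)
        assume y: "y \<notin> insert v (set P)"
        then have "x \<noteq> v" using xy N_sub by (auto simp: N_def)
        then have xs: "x \<in> starts" using x False by (simp add: starts_eq)
        have hl: "hd P \<in> starts" "last P \<in> starts"
          using N_index[of 0] N_index[of "length P - 1"] path_P(1)
          by (auto simp: starts_eq hd_conv_nth last_conv_nth)
        have vs: "v \<in> starts" by (simp add: starts_def)
        have yP: "y \<notin> set P" "y \<noteq> v" using y by auto
        have ne: "x \<noteq> hd P" "x \<noteq> last P" using ends[OF yP(1)] xy by auto
        have "hd P \<noteq> last P"
        proof
          assume "hd P = last P"
          then have "length P = 1" using path_P(1,2) by (cases P) (auto split: if_splits)
          then show False using N_nonempty N_sub N_index by (metis One_nat_def all_not_in_conv in_set_conv_nth less_Suc0 not_less_zero subsetD)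
        qed
        moreover have "v \<noteq> hd P" "v \<noteq> last P" using v_facts(2) path_P(1) by auto
        ultimately have "card {hd P, last P, v} = 3" by auto
        moreover have "card {hd P, last P, v} \<le> 2"
        proof (rule few_nonadjacent[OF xy])
          have sub: "{hd P, last P, v} \<subseteq> starts" using hl vs by simp
          then show "{hd P, last P, v} \<subseteq> verts G" using starts_verts by blast
          show "\<forall>c\<in>{hd P, last P, v}. \<forall>d\<in>{hd P, last P, v}. {c, d} \<notin> edges G"
            using sub starts_independent by blast
          show "x \<notin> {hd P, last P, v}" using ne \<open>x \<noteq> v\<close> by simp
          show "y \<notin> {hd P, last P, v}" using yP path_P(1) by auto
          have "{y, c} \<notin> edges G" if "c \<in> {hd P, last P, v}" for c
            using that ends[OF yP(1)] edge_commute[of y c] yP N_sub by (auto simp: N_def)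
          then show "\<forall>c\<in>{hd P, last P, v}. {x, c} \<notin> edges G \<and> {y, c} \<notin> edges G"
            using sub starts_independent[OF xs] by blast
        qed
        ultimately show False by simp
      qed
    qed
  qed simp
qed

lemma form: "bipartite_form G N starts v"
  unfolding bipartite_form_def
proof (intro conjI ballI)
  show "verts G = N \<union> starts" using verts_eq starts_eq N_sub by auto
  show "N \<inter> starts = {}" using starts_disjoint by blast
  show "card starts = card N + 2" "3 \<le> card N" by (rule card_starts card_N)+
  show vs: "v \<in> starts" by (simp add: starts_def)
  show "\<exists>ws. path_in G ws \<and> set ws = verts G - {v}"
    using longest verts_eq v_facts(2) by (intro exI[of _ P]) (auto simp: longest_path_def)
  show ind: "{x, x'} \<notin> edges G" if "x \<in> N" "x' \<in> N" for x x'
    using N_nbrs(1)[OF that(1)] starts_disjoint that(2) by blast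
  show "{y, y'} \<notin> edges G" if "y \<in> starts" "y' \<in> starts" for y y'
    using starts_independent that .
  show "{x, v} \<in> edges G" if "x \<in> N" for x using that by (simp add: N_commute)
  show "card {y \<in> starts. {x, y} \<notin> edges G} = 2" if "x \<in> N" for x using N_nbrs(2)[OF that] .
  show "card {x \<in> N. {x, y} \<notin> edges G} \<le> 2" if y: "y \<in> starts" for y
    using y
  proof (cases rule: startsE)
    case 1
    then have "{x \<in> N. {x, y} \<notin> edges G} = {}" by (auto simp: N_commute)
    then show ?thesis by (metis card.empty zero_le)
  next
    case (2 i)
    \<comment> \<open>The edge needed for freeness: \<open>x0\<close> is the predecessor of
      \<open>y\<close> on P, or the second vertex of P if \<open>y\<close> is the first. As
      \<open>N\<close> is independent, the non-neighbours of \<open>y\<close> in \<open>N\<close>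
      are isolated from this edge.\<close>
    have "\<exists>x0\<in>N. {y, x0} \<in> edges G"
    proof (cases i)
      case 0
      have "length P \<ge> 2"
      proof -
        obtain x where "x \<in> N" using N_nonempty by blast
        then obtain j where "j < length P" "P ! j \<in> N" using N_sub by (metis in_set_conv_nth subsetD)
        then show ?thesis using N_index by fastforce
      qed
      then show ?thesis using 0 2 N_iff_odd[of 1] P_edge[of 0] by auto
    next
      case (Suc j)
      then have "P ! j \<in> N" using 2 by simp
      moreover have "{P ! Suc j, P ! j} \<in> edges G" using P_edge[of j] edge_commute 2 Suc by blast
      ultimately show ?thesis using 2 Suc by auto
    qed
    then obtain x0 where x0: "x0 \<in> N" "{y, x0} \<in> edges G" by blast
    have sub: "{x \<in> N. {x, y} \<notin> edges G} \<subseteq> N" by blast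
    show ?thesis
    proof (rule few_nonadjacent[OF x0(2)])
      show "{x \<in> N. {x, y} \<notin> edges G} \<subseteq> verts G" using N_sub path_P(3) by blast
      show "\<forall>c\<in>{x \<in> N. {x, y} \<notin> edges G}. \<forall>d\<in>{x \<in> N. {x, y} \<notin> edges G}. {c, d} \<notin> edges G"
        using ind by blast
      show "y \<notin> {x \<in> N. {x, y} \<notin> edges G}" using starts_disjoint[OF y] by blast
      show "x0 \<notin> {x \<in> N. {x, y} \<notin> edges G}" using edge_commute[OF x0(2)] by blast
      show "\<forall>c\<in>{x \<in> N. {x, y} \<notin> edges G}. {y, c} \<notin> edges G \<and> {x0, c} \<notin> edges G"
        using ind[OF x0(1)] edge_commute by blast
    qed
  qed
qed

end

theorem proposition2:
  fixes G :: "'a ugraph"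
  assumes "simple_graph G"
  shows "(connected_graph G
          \<and> induced_free (graph_sum (path_graph 2) (graph_copies 3 (path_graph 1))) G
          \<and> (\<exists>v. top_vertex G v \<and> \<not> gallai_vertex G v))
         \<longleftrightarrow> member_upto_iso G family_G"
  unfolding induced_P2_3P1_free_iff[OF assms]
proof
  assume G: "connected_graph G \<and> (\<nexists>a b T. three_isolated G a b T) \<and>
    (\<exists>v. top_vertex G v \<and> \<not> gallai_vertex G v)"
  then obtain v where v: "top_vertex G v" "\<not> gallai_vertex G v" by blast
  then have "v \<in> verts G" by (simp add: top_vertex_def)
  with v(2) obtain P where P: "longest_path G P" "v \<notin> set P" by (auto simp: gallai_vertex_def)
  have free: "\<not> three_isolated G a b T" for a b T using G by blast
  obtain C where C: "off_path_component G P C" "v \<in> C"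
    by (rule off_path_component_exists[OF assms P(1) free \<open>v \<in> verts G\<close> P(2)])
  then have "top_vertex_off_path G P C v"
    using G v(1) by (simp add: top_vertex_off_path_def top_vertex_off_path_axioms_def)
  then have form: "bipartite_form G (top_vertex_off_path.N G v) (top_vertex_off_path.starts G P v) v"
    by (rule top_vertex_off_path.form)
  obtain H :: "nat ugraph" where H: "simple_graph H" "graph_iso G H"
    by (rule simple_graph_iso_nat[OF assms])
  obtain X Y u where "bipartite_form H X Y u"
    using bipartite_form_iso[OF form H(2)] by blast
  then have "H \<in> family_G" by (rule bipartite_form_family_G[OF H(1)])
  then show "member_upto_iso G family_G" using H(2) by (auto simp: member_upto_iso_def)
next
  assume "member_upto_iso G family_G"
  then obtain H where H: "H \<in> family_G" "graph_iso G H" by (auto simp: member_upto_iso_def)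
  obtain X Y u where "bipartite_form H X Y u" using family_G_bipartite_form[OF H(1)] by blast
  then obtain X' Y' u' where form: "bipartite_form G X' Y' u'"
    using bipartite_form_iso[OF _ graph_iso_sym[OF H(2)]] by blast
  show "connected_graph G \<and> (\<nexists>a b T. three_isolated G a b T) \<and>
    (\<exists>v. top_vertex G v \<and> \<not> gallai_vertex G v)"
    using bipartite_form_suffices[OF assms form] by blast
qed

end
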